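(* Let $d\in\mathbb{N}$ and let $\omega$ be a weight function for which there exists $H>1$ such that $$2\omega(t)\le\omega(Ht)+H\qquad\text{for all } t\ge 0.$$ Then $\mathcal{S}_\omega(\mathbb{R}^d)$ is a nuclear space.
   Context: A weight function is a continuous increasing (not necessarily strictly) function $\omega:[0,+\infty)\to[0,+\infty)$ such that: $(\alpha)$ there is $L>0$ with $\omega(2t)\le L(\omega(t)+1)$ for all $t\ge0$; $(\beta)$ $\omega(t)=o(t)$ as $t\to+\infty$; $(\gamma)$ there are $a\in\mathbb{R}$, $b>0$ with $\omega(t)\ge a+b\log(1+t)$ for all $t\ge0$; $(\delta)$ $\varphi:t\mapsto\omega(e^t)$ is convex. One sets $\omega(\zeta):=\omega(|\zeta|)$ for $\zeta\in\mathbb{C}^d$. $\mathcal{S}_\omega(\mathbb{R}^d)$ is the set of all $u\in L^1(\mathbb{R}^d)$ such that $u$ and its Fourier transform $\hat u$ belong to $C^\infty(\mathbb{R}^d)$ and (i) for all $\lambda>0$, $\alpha\in\mathbb{N}_0^d$: $\sup_{x\in\mathbb{R}^d}e^{\lambda\omega(x)}|D^\alpha u(x)|<+\infty$; (ii) for all $\lambda>0$, $\alpha\in\mathbb{N}_0^d$: $\sup_{\xi\in\mathbb{R}^d}e^{\lambda\omega(\xi)}|D^\alpha\hat u(\xi)|<+\infty$, where $D^\alpha=(-i)^{|\alpha|}\partial^\alpha$. It is a Fréchet space with the topology given by the seminorms $$p_\lambda(u)=\sup_{\alpha,\beta\in\mathbb{N}_0^d}\sup_{x\in\mathbb{R}^d}|x^\beta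 D^\alpha u(x)|e^{-\lambda\varphi^*\left(\frac{|\alpha+\beta|}{\lambda}\right)},\qquad\lambda>0,$$ where $\varphi^*(s):=\sup_{t\ge0}(ts-\varphi(t))$ is the Young conjugate of $\varphi$. *)

theory Defs
  imports "HOL-Analysis.Analysis" "HOL-Library.Landau_Symbols" "HOL-Library.Function_Algebras"
begin

section \<open>Nuclear locally convex spaces\<close>

text \<open>
  A complex vector space is given as a linear subspace \<open>E\<close> of a type, with scalar
  multiplication \<open>sc\<close>; a topological vector space is a topology \<open>T\<close> with
  \<open>topspace T = E\<close>.
\<close>

definition seminorm_on :: "(complex \<Rightarrow> 'v \<Rightarrow> 'v) \<Rightarrow> 'v::ab_group_add set \<Rightarrow> ('v \<Rightarrow> real) \<Rightarrow> bool" where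
  "seminorm_on sc E p \<longleftrightarrow>
     (\<forall>u\<in>E. 0 \<le> p u) \<and>
     (\<forall>c. \<forall>u\<in>E. p (sc c u) = cmod c * p u) \<and>
     (\<forall>u\<in>E. \<forall>v\<in>E. p (u + v) \<le> p u + p v)"

definition seminorm_topology :: "'v::ab_group_add set \<Rightarrow> ('v \<Rightarrow> real) set \<Rightarrow> 'v topology" where
  "seminorm_topology E P =
     topology_generated_by {{v \<in> E. p (v - u) < r} |p u r. p \<in> P \<and> u \<in> E \<and> 0 < r}"

definition locally_convex_space :: "(complex \<Rightarrow> 'v \<Rightarrow> 'v) \<Rightarrow> 'v::ab_group_add topology \<Rightarrow> bool" where
  "locally_convex_space sc T \<longleftrightarrow>
     vector_space sc \<and> module.subspace sc (topspace T) \<and> Hausdorff_space T \<and>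
     (\<exists>P. (\<forall>p\<in>P. seminorm_on sc (topspace T) p) \<and> T = seminorm_topology (topspace T) P)"

definition continuous_seminorm :: "(complex \<Rightarrow> 'v \<Rightarrow> 'v) \<Rightarrow> 'v::ab_group_add topology \<Rightarrow> ('v \<Rightarrow> real) \<Rightarrow> bool" where
  "continuous_seminorm sc T p \<longleftrightarrow>
     seminorm_on sc (topspace T) p \<and> continuous_map T euclideanreal p"

text \<open>
  The local Banach space of a seminorm \<open>p\<close> is the completion of \<open>E / {u. p u = 0}\<close>.
  Its elements are represented by the \<open>p\<close>-Cauchy sequences in \<open>E\<close>; the norm of the element
  represented by \<open>s\<close> is the limit of \<open>p (s k)\<close>, and the vector space operations are
  termwise. An element of \<open>E\<close> is represented by the constant sequence.
\<close>

definition seminorm_Cauchy :: "'v::ab_group_add set \<Rightarrow> ('v \<Rightarrow> real) \<Rightarrow> (nat \<Rightarrow> 'v) \<Rightarrow> bool" where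
  "seminorm_Cauchy E p s \<longleftrightarrow>
     (\<forall>k. s k \<in> E) \<and> (\<forall>e>0. \<exists>N. \<forall>m\<ge>N. \<forall>n\<ge>N. p (s m - s n) < e)"

definition completion_norm :: "('v \<Rightarrow> real) \<Rightarrow> (nat \<Rightarrow> 'v) \<Rightarrow> real" where
  "completion_norm p s = lim (\<lambda>k. p (s k))"

text \<open>
  A bounded functional on the local Banach space of \<open>q\<close> is the same as a linear functional on
  \<open>E\<close> bounded by a multiple of \<open>q\<close> (it then vanishes where \<open>q\<close> does).
\<close>

definition bounded_functional :: "(complex \<Rightarrow> 'v \<Rightarrow> 'v) \<Rightarrow> 'v::ab_group_add set \<Rightarrow> ('v \<Rightarrow> real) \<Rightarrow> ('v \<Rightarrow> complex) \<Rightarrow> bool" where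
  "bounded_functional sc E q f \<longleftrightarrow>
     (\<forall>u\<in>E. \<forall>v\<in>E. f (u + v) = f u + f v) \<and>
     (\<forall>c. \<forall>u\<in>E. f (sc c u) = c * f u) \<and>
     (\<exists>C. \<forall>u\<in>E. cmod (f u) \<le> C * q u)"

definition dual_norm :: "'v set \<Rightarrow> ('v \<Rightarrow> real) \<Rightarrow> ('v \<Rightarrow> complex) \<Rightarrow> real" where
  "dual_norm E q f = (SUP u\<in>{u\<in>E. q u \<le> 1}. cmod (f u))"

text \<open>
  For seminorms \<open>p \<le> q\<close>: the canonical map from the local Banach space of \<open>q\<close> to that of \<open>p\<close>
  is a nuclear operator, that is, of the form \<open>x \<mapsto> (\<Sum>j. f j x \<cdot> y j)\<close> with
  \<open>(\<Sum>j. \<parallel>f j\<parallel> \<cdot> \<parallel>y j\<parallel>) < \<infinity>\<close>. Both sides being continuous, the identity is only required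
  on the dense image of \<open>E\<close>.
\<close>

definition nuclear_linking_map :: "(complex \<Rightarrow> 'v \<Rightarrow> 'v) \<Rightarrow> 'v::ab_group_add set \<Rightarrow> ('v \<Rightarrow> real) \<Rightarrow> ('v \<Rightarrow> real) \<Rightarrow> bool" where
  "nuclear_linking_map sc E q p \<longleftrightarrow>
     (\<exists>(f :: nat \<Rightarrow> 'v \<Rightarrow> complex) (y :: nat \<Rightarrow> nat \<Rightarrow> 'v).
        (\<forall>j. bounded_functional sc E q (f j)) \<and>
        (\<forall>j. seminorm_Cauchy E p (y j)) \<and>
        summable (\<lambda>j. dual_norm E q (f j) * completion_norm p (y j)) \<and>
        (\<forall>x\<in>E. (\<lambda>n. completion_norm p (\<lambda>k. x - (\<Sum>j<n. sc (f j x) (y j k)))) \<longlonglongrightarrow> 0))"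

definition nuclear_space :: "(complex \<Rightarrow> 'v \<Rightarrow> 'v) \<Rightarrow> 'v::ab_group_add topology \<Rightarrow> bool" where
  "nuclear_space sc T \<longleftrightarrow>
     locally_convex_space sc T \<and>
     (\<forall>p. continuous_seminorm sc T p \<longrightarrow>
        (\<exists>q. continuous_seminorm sc T q \<and> (\<forall>u\<in>topspace T. p u \<le> q u) \<and>
             nuclear_linking_map sc (topspace T) q p))"

section \<open>Weight functions\<close>

text \<open>Only the values of \<open>\<omega>\<close> on \<open>[0,\<infinity>)\<close> matter.\<close>

definition weight_function :: "(real \<Rightarrow> real) \<Rightarrow> bool" where
  "weight_function \<omega> \<longleftrightarrow>
     (\<forall>t\<ge>0. 0 \<le> \<omega> t) \<and> continuous_on {0..} \<omega> \<and> mono_on {0..} \<omega> \<and>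
     (\<exists>L>0. \<forall>t\<ge>0. \<omega> (2 * t) \<le> L * (\<omega> t + 1)) \<and>
     \<omega> \<in> o[at_top](\<lambda>t. t) \<and>
     (\<exists>a. \<exists>b>0. \<forall>t\<ge>0. \<omega> t \<ge> a + b * ln (1 + t)) \<and>
     convex_on UNIV (\<lambda>t. \<omega> (exp t))"

text \<open>
  The Young conjugate of \<open>\<phi> t = \<omega> (exp t)\<close>. The supremum is finite for every \<open>s\<close> as soon as
  \<open>ln t = o(\<omega> t)\<close>, which follows from \<open>2 * \<omega> t \<le> \<omega> (H * t) + H\<close> for a weight function.
\<close>

definition young_conj :: "(real \<Rightarrow> real) \<Rightarrow> real \<Rightarrow> real" where
  "young_conj \<omega> s = (SUP t\<in>{0..}. t * s - \<omega> (exp t))"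

section \<open>Derivatives and the Fourier transform\<close>

definition pderiv_at :: "'d \<Rightarrow> (real^'d::finite \<Rightarrow> complex) \<Rightarrow> real^'d \<Rightarrow> complex" where
  "pderiv_at i u x = vector_derivative (\<lambda>t. u (x + t *\<^sub>R axis i 1)) (at 0)"

definition pderivs :: "'d list \<Rightarrow> (real^'d::finite \<Rightarrow> complex) \<Rightarrow> real^'d \<Rightarrow> complex" where
  "pderivs is u = foldr pderiv_at is u"

definition smooth :: "(real^'d::finite \<Rightarrow> complex) \<Rightarrow> bool" where
  "smooth u \<longleftrightarrow>
     (\<forall>is. continuous_on UNIV (pderivs is u) \<and>
           (\<forall>i x. (\<lambda>t. pderivs is u (x + t *\<^sub>R axis i 1)) differentiable (at 0)))"

definition mi_size :: "('d::finite \<Rightarrow> nat) \<Rightarrow> nat" where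
  "mi_size \<alpha> = (\<Sum>i\<in>UNIV. \<alpha> i)"

text \<open>
  \<open>D\<^sup>\<alpha> = (-\<i>)\<^bsup>|\<alpha>|\<^esup> \<partial>\<^sup>\<alpha>\<close>. The index type carries no order, so the order of the partial
  derivatives is an arbitrary one; it is irrelevant for smooth functions.
\<close>

definition D :: "('d \<Rightarrow> nat) \<Rightarrow> (real^'d::finite \<Rightarrow> complex) \<Rightarrow> real^'d \<Rightarrow> complex" where
  "D \<alpha> u x = (- \<i>) ^ mi_size \<alpha> * pderivs (SOME is. \<forall>i. count_list is i = \<alpha> i) u x"

definition fourier :: "(real^'d::finite \<Rightarrow> complex) \<Rightarrow> real^'d \<Rightarrow> complex" where
  "fourier u \<xi> = (LINT x|lborel. exp (- (\<i> * of_real (x \<bullet> \<xi>))) * u x)"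

section \<open>The space of \<open>\<omega>\<close>-ultradifferentiable rapidly decreasing functions\<close>

definition S_omega :: "(real \<Rightarrow> real) \<Rightarrow> (real^'d::finite \<Rightarrow> complex) set" where
  "S_omega \<omega> = {u. integrable lborel u \<and> smooth u \<and> smooth (fourier u) \<and>
     (\<forall>\<mu>>0. \<forall>\<alpha>. bdd_above (range (\<lambda>x. exp (\<mu> * \<omega> (norm x)) * cmod (D \<alpha> u x)))) \<and>
     (\<forall>\<mu>>0. \<forall>\<alpha>. bdd_above (range (\<lambda>\<xi>. exp (\<mu> * \<omega> (norm \<xi>)) * cmod (D \<alpha> (fourier u) \<xi>))))}"

text \<open>
  The supremum is finite for \<open>u \<in> S_omega \<omega>\<close> when \<open>young_conj \<omega>\<close> is (see above).
\<close>

definition S_seminorm :: "(real \<Rightarrow> real) \<Rightarrow> real \<Rightarrow> (real^'d::finite \<Rightarrow> complex) \<Rightarrow> real" where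
  "S_seminorm \<omega> \<mu> u =
     (SUP (\<alpha>, \<beta>, x)\<in>UNIV.
        cmod (of_real (\<Prod>i\<in>UNIV. (x $ i) ^ \<beta> i) * D \<alpha> u x) *
        exp (- \<mu> * young_conj \<omega> (real (mi_size (\<lambda>i. \<alpha> i + \<beta> i)) / \<mu>)))"

definition S_topology :: "(real \<Rightarrow> real) \<Rightarrow> (real^'d::finite \<Rightarrow> complex) topology" where
  "S_topology \<omega> = seminorm_topology (S_omega \<omega>) {S_seminorm \<omega> \<mu> |\<mu>. 0 < \<mu>}"

definition fun_scale :: "complex \<Rightarrow> ('a \<Rightarrow> complex) \<Rightarrow> 'a \<Rightarrow> complex" where
  "fun_scale c u = (\<lambda>x. c * u x)"

end

theory Submission
  imports Defs "HOL-Probability.Characteristic_Functions" "HOL-Probability.Sinc_Integral"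
begin

text \<open>
  Let \<open>M n\<close> be the supremum of \<open>r ^ n * exp (- \<omega> r)\<close> over \<open>r \<ge> 1\<close>, that is
  \<open>exp (young_conj \<omega> n)\<close>, and let \<open>weight_seq \<omega> \<mu> n\<close> be the same supremum for \<open>\<mu> * \<omega>\<close>.
  Dilating \<open>r\<close> shows what the hypotheses on \<open>\<omega>\<close> mean for these sequences: by the doubling
  hypothesis any two of them agree up to factors \<open>C * A ^ n\<close>, and by condition \<open>(\<alpha>)\<close> every
  factor \<open>A ^ n\<close> is absorbed by enlarging \<open>\<mu>\<close>. Hence the topology of \<open>S_omega\<close> is given by the
  norms

    \<open>sup\<close> of \<open>A ^ n / M n * \<bar>x\<^bsup>js\<^esup> \<partial>\<^bsup>is\<^esup> u(x)\<bar>\<close>, \<open>n = length js + length is\<close>, over all \<open>js\<close>, \<open>is\<close>, \<open>x\<close>,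

  where \<open>A \<ge> 1\<close> is arbitrary and a multi-index is written as a word in the coordinates
  (\<open>weight_seq_equiv\<close>, \<open>weight_seq_geometric\<close>).

  A loss that is geometric in \<open>n\<close> is therefore harmless. Multiplying by a fixed polynomial or
  applying a Sobolev inequality changes \<open>n\<close> by a bounded amount and costs only that much, so
  the supremum may be replaced by an \<open>L\<^sup>2\<close>-norm (\<open>sup_le_L2\<close>) and a factor decaying in \<open>x\<close> is
  gained for free (\<open>weighted_sup_le\<close>). The result is a family of Hilbert norms
  \<open>h\<^sub>A(u)\<^sup>2 = \<Sum> (A ^ n / M n)\<^sup>2 * \<parallel>x\<^bsup>js\<^esup> \<partial>\<^bsup>is\<^esup> u\<parallel>\<^sup>2\<close> for which the evaluations
  \<open>u \<mapsto> x\<^bsup>js\<^esup> \<partial>\<^bsup>is\<^esup> u(x)\<close> are bounded, with bounds that are square integrable in \<open>(js, is, x)\<close>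
  against the weights of any \<open>h\<^sub>B\<close> with \<open>B\<close> sufficiently smaller than \<open>A\<close>. This makes the
  inclusions Hilbert-Schmidt, and a composition of two such maps is nuclear.

  The nuclear representation itself is \<open>x = \<Sum> \<langle>x, e\<^sub>j\<rangle> e\<^sub>j\<close> for an orthonormal sequence in
  \<open>S_omega\<close>. Bessel's inequality for the evaluations makes both \<open>p(e\<^sub>j)\<close> and the dual norms of
  \<open>\<langle>\<cdot>, e\<^sub>j\<rangle>\<close> square summable (\<open>nuclear_linking_map_of_kernels\<close>). The expansion converges
  on the whole space because the sequence is chosen greedily
  (\<open>nuclear_linking_map_of_hilbert_schmidt\<close>).

  It remains to see that the norms are finite on \<open>S_omega\<close>, whose elements are only required to
  decay separately, each derivative with its own constant. Fourier inversion and the decay of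
  the transform control \<open>\<partial>\<^bsup>is\<^esup> u\<close>, the decay of \<open>u\<close> controls \<open>x\<^bsup>js\<^esup> u\<close>, and integration by parts in
  \<open>\<parallel>x\<^bsup>js\<^esup> \<partial>\<^bsup>is\<^esup> u\<parallel>\<^sup>2\<close> combines the two (\<open>S_omega_L2_bound\<close>). The factorials that this produces are
  dominated by \<open>M\<close> because \<open>\<omega>(t) = o(t)\<close> (\<open>fact_le_weight_seq\<close>).
\<close>

section \<open>Nuclear maps from Hilbert-Schmidt estimates\<close>

locale hermitian_form = vector_space sc
  for sc :: "complex \<Rightarrow> 'v \<Rightarrow> 'v::ab_group_add" +
  fixes E :: "'v set" and B :: "'v \<Rightarrow> 'v \<Rightarrow> complex"
  assumes subspace_E: "subspace E"
    and form_add: "u \<in> E \<Longrightarrow> v \<in> E \<Longrightarrow> w \<in> E \<Longrightarrow> B (u + v) w = B u w + B v w"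
    and form_scale: "u \<in> E \<Longrightarrow> w \<in> E \<Longrightarrow> B (sc c u) w = c * B u w"
    and form_cnj: "u \<in> E \<Longrightarrow> w \<in> E \<Longrightarrow> B w u = cnj (B u w)"
    and form_nonneg: "u \<in> E \<Longrightarrow> 0 \<le> Re (B u u)"
begin

definition hnorm :: "'v \<Rightarrow> real" where
  "hnorm u = sqrt (Re (B u u))"

text \<open>Zero vectors are admitted, so that the construction of a sequence need not stop when the
  space is exhausted.\<close>

definition orthonormal_upto :: "(nat \<Rightarrow> 'v) \<Rightarrow> nat \<Rightarrow> bool" where
  "orthonormal_upto e n \<longleftrightarrow>
     (\<forall>j<n. e j \<in> E \<and> (e j = 0 \<or> B (e j) (e j) = 1) \<and> (\<forall>k<n. j \<noteq> k \<longrightarrow> B (e j) (e k) = 0))"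

definition residual :: "(nat \<Rightarrow> 'v) \<Rightarrow> nat \<Rightarrow> 'v \<Rightarrow> 'v" where
  "residual e n u = u - (\<Sum>j<n. sc (B u (e j)) (e j))"

lemma E_closed: "0 \<in> E" "u \<in> E \<Longrightarrow> sc c u \<in> E" "u \<in> E \<Longrightarrow> v \<in> E \<Longrightarrow> u + v \<in> E"
  "u \<in> E \<Longrightarrow> v \<in> E \<Longrightarrow> u - v \<in> E"
  using subspace_E by (auto intro: subspace_0 subspace_scale subspace_add subspace_diff)

lemma form_zero: "w \<in> E \<Longrightarrow> B 0 w = 0" "w \<in> E \<Longrightarrow> B w 0 = 0"
proof -
  assume w: "w \<in> E"
  show z: "B 0 w = 0" using form_scale[of 0 w 0] w E_closed by simp
  show "B w 0 = 0" using form_cnj[of 0 w] w E_closed z by simp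
qed

lemma form_sum:
  "(\<And>k. k \<in> A \<Longrightarrow> e k \<in> E) \<Longrightarrow> w \<in> E \<Longrightarrow>
     B (\<Sum>k\<in>A. sc (c k) (e k)) w = (\<Sum>k\<in>A. c k * B (e k) w)"
proof (induction A rule: infinite_finite_induct)
  case (insert x F)
  have "(\<Sum>k\<in>F. sc (c k) (e k)) \<in> E"
    using insert by (intro subspace_sum subspace_E E_closed) auto
  then show ?case using insert by (simp add: form_add form_scale E_closed)
qed (auto simp: form_zero)

lemma hnorm_square: "u \<in> E \<Longrightarrow> B u u = of_real ((hnorm u)\<^sup>2)"
  using form_nonneg[of u] form_cnj[of u u] unfolding hnorm_def
  by (auto simp: complex_eq_iff)

lemma hnorm_nonneg: "u \<in> E \<Longrightarrow> 0 \<le> hnorm u"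
  using form_nonneg unfolding hnorm_def by auto

lemma form_scale_right: "u \<in> E \<Longrightarrow> w \<in> E \<Longrightarrow> B u (sc c w) = cnj c * B u w"
  using form_cnj[of "sc c w" u] form_scale[of w u c] form_cnj[of u w] E_closed by simp

lemma hnorm_scale: "u \<in> E \<Longrightarrow> hnorm (sc c u) = cmod c * hnorm u"
proof -
  assume u: "u \<in> E"
  have "B (sc c u) (sc c u) = c * cnj c * B u u"
    using u E_closed by (simp add: form_scale form_scale_right)
  then have "Re (B (sc c u) (sc c u)) = (cmod c)\<^sup>2 * Re (B u u)"
    by (metis Re_complex_of_real complex_norm_square hnorm_square of_real_mult u)
  then show ?thesis unfolding hnorm_def by (simp add: real_sqrt_mult)
qed

lemma proj_in_E: "orthonormal_upto e n \<Longrightarrow> (\<Sum>j<n. sc (c j) (e j)) \<in> E"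
  unfolding orthonormal_upto_def by (intro subspace_sum subspace_E E_closed) auto

lemma residual_in_E: "orthonormal_upto e n \<Longrightarrow> u \<in> E \<Longrightarrow> residual e n u \<in> E"
  unfolding residual_def by (intro E_closed proj_in_E)

lemma form_diff: "u \<in> E \<Longrightarrow> v \<in> E \<Longrightarrow> w \<in> E \<Longrightarrow> B (u - v) w = B u w - B v w"
  using form_add[of "u - v" v w] E_closed by simp

lemma orthonormal_sum:
  assumes "orthonormal_upto e n" "j < n"
  shows "B (\<Sum>k<n. sc (c k) (e k)) (e j) = c j * B (e j) (e j)"
proof -
  have "B (\<Sum>k<n. sc (c k) (e k)) (e j) = (\<Sum>k<n. c k * B (e k) (e j))"
    using assms unfolding orthonormal_upto_def by (intro form_sum) auto
  also have "\<dots> = (\<Sum>k<n. if k = j then c j * B (e j) (e j) else 0)"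
    using assms unfolding orthonormal_upto_def by (intro sum.cong) auto
  finally show ?thesis using assms by simp
qed

lemma residual_orthogonal:
  assumes "orthonormal_upto e n" "u \<in> E" "j < n"
  shows "B (residual e n u) (e j) = 0"
proof -
  have e: "e j \<in> E" "e j = 0 \<or> B (e j) (e j) = 1"
    using assms unfolding orthonormal_upto_def by auto
  have "B (residual e n u) (e j) = B u (e j) - B u (e j) * B (e j) (e j)"
    unfolding residual_def using assms e
    by (simp add: form_diff proj_in_E orthonormal_sum[of e n j "\<lambda>j. B u (e j)"])
  then show ?thesis using e assms form_zero by auto
qed

lemma form_proj_residual:
  assumes "orthonormal_upto e n" "u \<in> E"
  shows "B (\<Sum>j<n. sc (c j) (e j)) (residual e n u) = 0"
proof -
  have "B (\<Sum>j<n. sc (c j) (e j)) (residual e n u) = (\<Sum>j<n. c j * B (e j) (residual e n u))"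
    using assms residual_in_E[OF assms] unfolding orthonormal_upto_def by (intro form_sum) auto
  also have "\<dots> = 0"
  proof (intro sum.neutral ballI)
    fix j assume "j \<in> {..<n}"
    then have "e j \<in> E" "B (residual e n u) (e j) = 0"
      using assms residual_orthogonal[OF assms, of j] unfolding orthonormal_upto_def by auto
    then show "c j * B (e j) (residual e n u) = 0"
      using form_cnj[of "residual e n u" "e j"] residual_in_E[OF assms] by simp
  qed
  finally show ?thesis .
qed

lemma form_residual:
  assumes "orthonormal_upto e n" "u \<in> E"
  shows "B u (residual e n u) = of_real ((hnorm (residual e n u))\<^sup>2)"
proof -
  let ?r = "residual e n u" and ?s = "\<Sum>j<n. sc (B u (e j)) (e j)"
  have "B (?r + ?s) ?r = B ?r ?r + B ?s ?r"
    using assms by (intro form_add residual_in_E proj_in_E) auto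
  moreover have "?r + ?s = u" by (simp add: residual_def)
  ultimately show ?thesis
    using form_proj_residual[OF assms] hnorm_square residual_in_E[OF assms] by simp
qed

lemma hnorm_residual_le:
  assumes "orthonormal_upto e n" "u \<in> E"
  shows "hnorm (residual e n u) \<le> hnorm u"
proof -
  let ?r = "residual e n u" and ?s = "\<Sum>j<n. sc (B u (e j)) (e j)"
  have r: "?r \<in> E" and s: "?s \<in> E" using assms residual_in_E proj_in_E by auto
  have us: "u = ?r + ?s" by (simp add: residual_def)
  have "B u ?s = B ?r ?s + B ?s ?s"
    using form_add[OF r s s] us by simp
  moreover have "B ?r ?s = 0"
    using form_proj_residual[OF assms] form_cnj[OF s r] by simp
  moreover have "B u u = B ?r u + B ?s u"
    using form_add[OF r s assms(2)] us by simp
  ultimately have "B u u = of_real ((hnorm ?r)\<^sup>2) + B ?s ?s"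
    using form_residual[OF assms] form_cnj[OF assms(2) r] form_cnj[OF assms(2) s] hnorm_square[OF s]
    by simp
  then have "Re (B u u) \<ge> (hnorm ?r)\<^sup>2" using form_nonneg[OF s] by simp
  then show ?thesis unfolding hnorm_def[of u] by (simp add: real_le_rsqrt)
qed

definition normalise :: "'v \<Rightarrow> 'v" where
  "normalise v = (if hnorm v = 0 then 0 else sc (of_real (1 / hnorm v)) v)"

text \<open>Gram-Schmidt, except that the vector to be orthonormalised next is selected in view of the
  vectors found so far: \<open>pick\<close> receives the current residual map.\<close>

lemma orthonormalisation_exists:
  assumes "\<And>R. pick R \<in> E"
  obtains e where "\<And>n. orthonormal_upto e n"
    and "\<And>n. e n = normalise (residual e n (pick (residual e n)))"
proof -
  define res where "res es u = u - sum_list (map (\<lambda>v. sc (B u v) v) es)" for es u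
  define nxt where "nxt es = normalise (res es (pick (res es)))" for es
  define gs where "gs = rec_nat [] (\<lambda>_ es. es @ [nxt es])"
  define e where "e n = nxt (gs n)" for n
  have gs: "gs 0 = []" "gs (Suc n) = gs n @ [e n]" for n
    by (auto simp: gs_def e_def)
  have gs_map: "gs n = map e [0..<n]" for n by (induction n) (auto simp: gs)
  have res: "res (gs n) = residual e n" for n
    by (intro ext) (simp add: res_def residual_def gs_map comp_def interv_sum_list_conv_sum_set_nat
        atLeast0LessThan)
  have e_eq: "e n = normalise (residual e n (pick (residual e n)))" for n
    by (simp add: e_def[of n] nxt_def res)
  have ortho: "orthonormal_upto e n" for n
  proof (induction n)
    case 0 show ?case by (simp add: orthonormal_upto_def)
  next
    case (Suc n)
    define r where "r = residual e n (pick (residual e n))"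
    have r: "r \<in> E" unfolding r_def using residual_in_E[OF Suc] assms by auto
    have en: "e n = normalise r" using e_eq[of n] by (simp add: r_def)
    have enE: "e n \<in> E" unfolding en normalise_def using r E_closed by auto
    have one: "e n = 0 \<or> B (e n) (e n) = 1"
    proof (cases "hnorm r = 0")
      case False
      then have "B (e n) (e n) = 1" using r E_closed(2)[OF r] unfolding en normalise_def
        by (simp add: form_scale form_scale_right hnorm_square[OF r] power2_eq_square)
      then show ?thesis ..
    qed (simp add: en normalise_def)
    have zero: "B (e n) (e j) = 0" if "j < n" for j
    proof -
      have ej: "e j \<in> E" using Suc that unfolding orthonormal_upto_def by auto
      have "B r (e j) = 0"
        unfolding r_def by (intro residual_orthogonal Suc that assms)
      then show ?thesis using r ej form_zero unfolding en normalise_def by (auto simp: form_scale)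
    qed
    have zero': "B (e j) (e n) = 0" if "j < n" for j
      using zero[OF that] form_cnj[of "e n" "e j"] enE Suc that
      unfolding orthonormal_upto_def by auto
    show ?case using Suc enE one zero zero' unfolding orthonormal_upto_def
      by (auto simp: less_Suc_eq)
  qed
  show ?thesis by (rule that[OF ortho e_eq])
qed

lemma residual_scale:
  assumes "orthonormal_upto e n" "u \<in> E"
  shows "residual e n (sc c u) = sc c (residual e n u)"
proof -
  have "(\<Sum>j<n. sc (B (sc c u) (e j)) (e j)) = sc c (\<Sum>j<n. sc (B u (e j)) (e j))"
    unfolding scale_sum_right using assms unfolding orthonormal_upto_def
    by (intro sum.cong) (auto simp: form_scale)
  then show ?thesis unfolding residual_def by (simp add: scale_right_diff_distrib)
qed

text \<open>If the dual norms of \<open>\<lambda>u. B u (e j)\<close> and the numbers \<open>p (e j)\<close> are square summable, their products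
  are summable, so that only the convergence of the orthonormal expansion is at stake. For the greedy
  sequence the dual norm of the \<open>n\<close>-th functional is at least half the largest residual after \<open>n\<close> steps,
  taken over the unit ball of \<open>q\<close>; square summability forces it to \<open>0\<close>.\<close>

theorem nuclear_linking_map_of_hilbert_schmidt:
  assumes q: "seminorm_on sc E q" and p: "seminorm_on sc E p"
    and hq: "\<And>u. u \<in> E \<Longrightarrow> hnorm u \<le> K * q u"
    and ph: "\<And>u. u \<in> E \<Longrightarrow> p u \<le> K' * hnorm u"
    and bounded: "\<And>v. v \<in> E \<Longrightarrow> \<exists>C. \<forall>u\<in>E. cmod (B u v) \<le> C * q u"
    and dual: "\<And>e n. orthonormal_upto e n \<Longrightarrow> (\<Sum>j<n. (dual_norm E q (\<lambda>u. B u (e j)))\<^sup>2) \<le> C1"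
    and prim: "\<And>e n. orthonormal_upto e n \<Longrightarrow> (\<Sum>j<n. (p (e j))\<^sup>2) \<le> C2"
  shows "nuclear_linking_map sc E q p"
proof -
  \<comment> \<open>\<open>good R u\<close>: up to the factor \<open>2\<close>, the residual of \<open>u\<close> is the largest one over the unit ball of \<open>q\<close>.\<close>
  define good where "good R u \<longleftrightarrow> u \<in> E \<and> q u \<le> 1 \<and>
    (\<forall>v\<in>E. q v \<le> 1 \<longrightarrow> hnorm (R v) \<le> 2 * hnorm (R u))" for R u
  define pick where "pick R = (if \<exists>u. good R u then SOME u. good R u else 0)" for R
  have good_E: "good R u \<Longrightarrow> u \<in> E" for R u by (simp add: good_def)
  have pick_E: "pick R \<in> E" for R
    unfolding pick_def using E_closed good_E by (auto intro: someI2)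
  obtain e where e: "\<And>n. orthonormal_upto e n"
    "\<And>n. e n = normalise (residual e n (pick (residual e n)))"
    using orthonormalisation_exists[of pick] pick_E by metis
  have eE: "e j \<in> E" for j using e(1)[of "Suc j"] by (auto simp: orthonormal_upto_def)
  have q0: "q 0 = 0" and p0: "p 0 = 0"
  proof -
    have "q (sc 0 0) = cmod 0 * q 0" "p (sc 0 0) = cmod 0 * p 0"
      using q p E_closed unfolding seminorm_on_def by blast+
    then show "q 0 = 0" "p 0 = 0" by auto
  qed
  have qn: "u \<in> E \<Longrightarrow> 0 \<le> q u" and pn: "u \<in> E \<Longrightarrow> 0 \<le> p u" for u
    using q p unfolding seminorm_on_def by auto
  define d where "d j = dual_norm E q (\<lambda>u. B u (e j))" for j
  have bdd: "bdd_above ((\<lambda>u. cmod (B u v)) ` {u \<in> E. q u \<le> 1})" if v: "v \<in> E" for v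
  proof -
    obtain C where C: "\<forall>u\<in>E. cmod (B u v) \<le> C * q u" using bounded[OF v] by blast
    show ?thesis
    proof (rule bdd_aboveI2)
      fix u assume u: "u \<in> {u \<in> E. q u \<le> 1}"
      have "cmod (B u v) \<le> C * q u" using C u by auto
      also have "\<dots> \<le> \<bar>C\<bar> * 1" using u qn by (intro mult_mono) auto
      finally show "cmod (B u v) \<le> \<bar>C\<bar>" by simp
    qed
  qed
  have d_upper: "cmod (B u (e j)) \<le> d j" if "u \<in> E" "q u \<le> 1" for u j
    unfolding d_def dual_norm_def using that bdd[OF eE] by (intro cSUP_upper) auto
  have d_nonneg: "0 \<le> d j" for j using d_upper[of 0 j] E_closed q0 eE by (simp add: form_zero)
  have pick_good: "good (residual e n) (pick (residual e n))" for n
  proof -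
    let ?R = "residual e n" and ?A = "{u \<in> E. q u \<le> 1}"
    have bd: "bdd_above ((\<lambda>u. hnorm (?R u)) ` ?A)"
    proof (rule bdd_aboveI2)
      fix u assume u: "u \<in> ?A"
      have "hnorm (?R u) \<le> K * q u"
        using hnorm_residual_le[OF e(1)] hq u by (auto intro: order_trans)
      also have "\<dots> \<le> \<bar>K\<bar> * 1" using u qn by (intro mult_mono) auto
      finally show "hnorm (?R u) \<le> \<bar>K\<bar>" by simp
    qed
    have A0: "0 \<in> ?A" using E_closed q0 by auto
    define s where "s = (SUP u\<in>?A. hnorm (?R u))"
    have up: "u \<in> ?A \<Longrightarrow> hnorm (?R u) \<le> s" for u unfolding s_def using bd by (rule cSUP_upper2) auto
    have "\<exists>u. good ?R u"
    proof (cases "s > 0")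
      case True
      then have "s / 2 < (SUP u\<in>?A. hnorm (?R u))" unfolding s_def[symmetric] by simp
      then obtain u where "u \<in> ?A" "s / 2 < hnorm (?R u)"
        using less_cSUP_iff[OF _ bd, of "s/2"] A0 by blast
      then have "good ?R u" unfolding good_def using up by force
      then show ?thesis ..
    next
      case False
      have "hnorm (?R u) \<le> 2 * hnorm (?R 0)" if "u \<in> E" "q u \<le> 1" for u
        using up[of u] False that hnorm_nonneg[OF residual_in_E[OF e(1)], of 0 n] E_closed by auto
      then have "good ?R 0" unfolding good_def using A0 by auto
      then show ?thesis ..
    qed
    then show ?thesis unfolding pick_def by (auto intro: someI)
  qed
  \<comment> \<open>For the picked vector \<open>v\<close>, \<open>B v (e n)\<close> is the norm of its residual, so that the dual norm of
    \<open>\<lambda>u. B u (e n)\<close> controls the residuals of the whole unit ball.\<close>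
  have res_d: "hnorm (residual e n u) \<le> 2 * d n" if u: "u \<in> E" "q u \<le> 1" for n u
  proof -
    define v where "v = pick (residual e n)"
    define r where "r = residual e n v"
    have v: "v \<in> E" "q v \<le> 1" and rv: "hnorm (residual e n u) \<le> 2 * hnorm r"
      using pick_good[of n] u unfolding good_def v_def r_def by auto
    have rE: "r \<in> E" unfolding r_def by (rule residual_in_E[OF e(1) v(1)])
    have "hnorm r \<le> d n"
    proof (cases "hnorm r = 0")
      case False
      have "e n = sc (of_real (1 / hnorm r)) r"
        using e(2)[of n] False by (simp add: v_def r_def normalise_def)
      then have "B v (e n) = of_real (1 / hnorm r) * B v r"
        using form_scale_right[OF v(1) rE] by simp
      also have "B v r = of_real ((hnorm r)\<^sup>2)" unfolding r_def by (rule form_residual[OF e(1) v(1)])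
      also have "of_real (1 / hnorm r) * of_real ((hnorm r)\<^sup>2) = (of_real (hnorm r) :: complex)"
        using False by (simp add: power2_eq_square)
      finally have "cmod (B v (e n)) = hnorm r" using hnorm_nonneg[OF rE] by simp
      then show ?thesis using d_upper[OF v, of n] by simp
    qed (use d_nonneg in simp)
    then show ?thesis using rv by simp
  qed
  have sum_d: "summable (\<lambda>j. (d j)\<^sup>2)"
    using dual[OF e(1)] unfolding d_def by (intro summableI_nonneg_bounded[where x=C1]) auto
  have sum_p: "summable (\<lambda>j. (p (e j))\<^sup>2)"
    using prim[OF e(1)] by (intro summableI_nonneg_bounded[where x=C2]) auto
  have d0: "d \<longlonglongrightarrow> 0"
  proof -
    have "(\<lambda>j. sqrt ((d j)\<^sup>2)) \<longlonglongrightarrow> sqrt 0"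
      by (intro tendsto_intros summable_LIMSEQ_zero sum_d)
    then show ?thesis using d_nonneg by simp
  qed
  have sum_dp: "summable (\<lambda>j. d j * p (e j))"
  proof (rule summable_comparison_test'[where N=0])
    show "summable (\<lambda>j. (d j)\<^sup>2 + (p (e j))\<^sup>2)" by (intro summable_add sum_d sum_p)
    fix j
    have "0 \<le> (d j - p (e j))\<^sup>2" by simp
    then have "2 * (d j * p (e j)) \<le> (d j)\<^sup>2 + (p (e j))\<^sup>2" by (simp add: power2_diff)
    moreover have "0 \<le> d j * p (e j)" using d_nonneg pn eE by simp
    ultimately show "norm (d j * p (e j)) \<le> (d j)\<^sup>2 + (p (e j))\<^sup>2" by simp
  qed
  have conv: "(\<lambda>n. p (residual e n x)) \<longlonglongrightarrow> 0" if x: "x \<in> E" for x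
  proof -
    \<comment> \<open>The summand \<open>1\<close> covers the case \<open>q x = 0\<close>.\<close>
    define c where "c = q x + 1"
    have c: "c > 0" using qn[OF x] by (simp add: c_def)
    define y where "y = sc (of_real (1 / c)) x"
    have y: "y \<in> E" unfolding y_def using x E_closed by auto
    have "q y = cmod (of_real (1 / c)) * q x" using q x unfolding y_def seminorm_on_def by blast
    also have "\<dots> = q x / c" using c by (simp add: norm_divide)
    also have "\<dots> \<le> 1" using c by (simp add: c_def)
    finally have qy: "q y \<le> 1" .
    have hx: "hnorm (residual e n x) \<le> 2 * c * d n" for n
    proof -
      have "hnorm (residual e n y) = hnorm (residual e n x) / c"
        unfolding y_def residual_scale[OF e(1) x] using c
        by (simp add: hnorm_scale[OF residual_in_E[OF e(1) x]] norm_divide)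
      then show ?thesis
        using mult_left_mono[OF res_d[OF y qy, of n], of c] c by (simp add: mult_ac)
    qed
    have "norm (p (residual e n x)) \<le> \<bar>K'\<bar> * (2 * c * d n)" for n
    proof -
      have rE: "residual e n x \<in> E" by (rule residual_in_E[OF e(1) x])
      have "p (residual e n x) \<le> K' * hnorm (residual e n x)" using ph rE by auto
      also have "\<dots> \<le> \<bar>K'\<bar> * (2 * c * d n)"
        using hx[of n] hnorm_nonneg[OF rE] by (intro mult_mono) auto
      finally show ?thesis using pn[OF rE] by simp
    qed
    then have ev: "eventually (\<lambda>n. norm (p (residual e n x)) \<le> \<bar>K'\<bar> * (2 * c * d n)) sequentially"
      by (rule always_eventually[OF allI])
    have "(\<lambda>n. \<bar>K'\<bar> * (2 * c * d n)) \<longlonglongrightarrow> \<bar>K'\<bar> * (2 * c * 0)"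
      by (intro tendsto_intros d0)
    then have "(\<lambda>n. \<bar>K'\<bar> * (2 * c * d n)) \<longlonglongrightarrow> 0" by simp
    with ev show ?thesis by (rule Lim_null_comparison)
  qed
  show ?thesis unfolding nuclear_linking_map_def
  proof (intro exI[of _ "\<lambda>j u. B u (e j)"] exI[of _ "\<lambda>j k. e j"] conjI allI ballI)
    fix j
    show "bounded_functional sc E q (\<lambda>u. B u (e j))"
      unfolding bounded_functional_def using form_add form_scale eE bounded[OF eE] by auto
    show "seminorm_Cauchy E p (\<lambda>k. e j)"
      unfolding seminorm_Cauchy_def using eE p0 by auto
  next
    show "summable (\<lambda>j. dual_norm E q (\<lambda>u. B u (e j)) * completion_norm p (\<lambda>k. e j))"
      using sum_dp unfolding d_def completion_norm_def by simp
  next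
    fix x assume "x \<in> E"
    then show "(\<lambda>n. completion_norm p (\<lambda>k. x - (\<Sum>j<n. sc (B x (e j)) (e j)))) \<longlonglongrightarrow> 0"
      using conv unfolding completion_norm_def residual_def by simp
  qed
qed

end

lemma borel_measurable_cnj [measurable (raw)]:
  "f \<in> borel_measurable m \<Longrightarrow> (\<lambda>z. cnj (f z)) \<in> borel_measurable m"
  by (rule borel_measurable_continuous_on[where f=cnj]) (intro continuous_intros)

text \<open>The quadratic polynomial \<open>\<lambda>t. \<integral>z. \<phi> z / w z * (g z - t * w z)\<^sup>2 \<partial>m\<close> is nonnegative.\<close>

lemma weighted_Cauchy_Schwarz:
  fixes \<phi> w g :: "'z \<Rightarrow> real"
  assumes "\<And>z. 0 \<le> \<phi> z" "\<And>z. 0 < w z"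
    and A: "integrable m (\<lambda>z. \<phi> z * w z)" and B: "integrable m (\<lambda>z. \<phi> z * g z)"
    and D: "integrable m (\<lambda>z. \<phi> z / w z * (g z)\<^sup>2)"
  shows "(\<integral>z. \<phi> z * g z \<partial>m)\<^sup>2 \<le> (\<integral>z. \<phi> z * w z \<partial>m) * (\<integral>z. \<phi> z / w z * (g z)\<^sup>2 \<partial>m)"
proof -
  define a b d where "a = (\<integral>z. \<phi> z * w z \<partial>m)" "b = (\<integral>z. \<phi> z * g z \<partial>m)"
    "d = (\<integral>z. \<phi> z / w z * (g z)\<^sup>2 \<partial>m)"
  have poly: "0 \<le> d - 2 * t * b + t\<^sup>2 * a" for t
  proof -
    have "0 \<le> (\<integral>z. \<phi> z / w z * (g z - t * w z)\<^sup>2 \<partial>m)"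
      using assms by (intro integral_nonneg_AE AE_I2 mult_nonneg_nonneg divide_nonneg_pos) auto
    also have "(\<lambda>z. \<phi> z / w z * (g z - t * w z)\<^sup>2)
      = (\<lambda>z. \<phi> z / w z * (g z)\<^sup>2 - 2 * t * (\<phi> z * g z) + t\<^sup>2 * (\<phi> z * w z))"
    proof
      fix z
      have "w z \<noteq> 0" using assms(2)[of z] by simp
      then show "\<phi> z / w z * (g z - t * w z)\<^sup>2
          = \<phi> z / w z * (g z)\<^sup>2 - 2 * t * (\<phi> z * g z) + t\<^sup>2 * (\<phi> z * w z)"
        by (simp add: field_simps power2_eq_square)
    qed
    also have "(\<integral>z. \<phi> z / w z * (g z)\<^sup>2 - 2 * t * (\<phi> z * g z) + t\<^sup>2 * (\<phi> z * w z) \<partial>m)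
        = d - 2 * t * b + t\<^sup>2 * a"
      unfolding a_b_d_def using A B D by simp
    finally show ?thesis .
  qed
  have a0: "a \<ge> 0" unfolding a_b_d_def using assms(1,2)
    by (intro integral_nonneg_AE AE_I2 mult_nonneg_nonneg) (auto intro: less_imp_le)
  have "b\<^sup>2 \<le> a * d"
  proof (cases "a = 0")
    case True
    have "b = 0"
    proof (rule ccontr)
      assume "b \<noteq> 0"
      then show False using poly[of "(d + 1) / (2 * b)"] True by (simp add: field_simps)
    qed
    then show ?thesis using True by simp
  next
    case False
    have "0 \<le> a * (d - 2 * (b / a) * b + (b / a)\<^sup>2 * a)"
      by (intro mult_nonneg_nonneg a0 poly)
    also have "\<dots> = a * d - b\<^sup>2" using False by (simp add: field_simps power2_eq_square)
    finally show ?thesis by simp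
  qed
  then show ?thesis unfolding a_b_d_def .
qed

text \<open>A family of functionals \<open>L z\<close>, bounded by \<open>w z\<close> for the Hilbert norm \<open>h\<close> with weight \<open>c\<close> and by \<open>a z\<close>
  for \<open>q\<close>. Bessel's inequality gives \<open>(\<Sum>j. (cmod (L z (e j)))\<^sup>2) \<le> (w z)\<^sup>2\<close> for every orthonormal family.
  Integrated against \<open>b\<close> this sums the \<open>(p (e j))\<^sup>2\<close>; paired with the bound by \<open>q\<close> it sums the squares of
  the dual norms, and the integral of \<open>c z * a z * w z\<close> is what bounds that sum.\<close>

theorem nuclear_linking_map_of_kernels:
  fixes sc :: "complex \<Rightarrow> 'v \<Rightarrow> 'v::ab_group_add" and L :: "'z \<Rightarrow> 'v \<Rightarrow> complex"
    and c w a b :: "'z \<Rightarrow> real"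
  assumes vs: "vector_space sc" and sub: "module.subspace sc E"
    and q: "seminorm_on sc E q" and p: "seminorm_on sc E p"
    and L_add: "\<And>z u v. u \<in> E \<Longrightarrow> v \<in> E \<Longrightarrow> L z (u + v) = L z u + L z v"
    and L_scale: "\<And>z u k. u \<in> E \<Longrightarrow> L z (sc k u) = k * L z u"
    and L_meas: "\<And>u. u \<in> E \<Longrightarrow> (\<lambda>z. L z u) \<in> borel_measurable m"
    and [measurable]: "c \<in> borel_measurable m" "w \<in> borel_measurable m"
      "a \<in> borel_measurable m" "b \<in> borel_measurable m"
    and pos: "\<And>z. 0 \<le> c z" "\<And>z. 0 < w z" "\<And>z. 0 \<le> a z" "\<And>z. 0 \<le> b z"
    and ca: "integrable m (\<lambda>z. c z * (a z)\<^sup>2)"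
    and bw: "integrable m (\<lambda>z. b z * (w z)\<^sup>2)"
    and caw: "integrable m (\<lambda>z. c z * a z * w z)"
    and L_q: "\<And>z u. u \<in> E \<Longrightarrow> cmod (L z u) \<le> a z * q u"
    and L_h: "\<And>z u. u \<in> E \<Longrightarrow> cmod (L z u) \<le> w z * sqrt (\<integral>z. c z * (cmod (L z u))\<^sup>2 \<partial>m)"
    and p_L: "\<And>u. u \<in> E \<Longrightarrow> (p u)\<^sup>2 \<le> (\<integral>z. b z * (cmod (L z u))\<^sup>2 \<partial>m)"
  shows "nuclear_linking_map sc E q p"
proof -
  define B where "B u v = (\<integral>z. of_real (c z) * (L z u * cnj (L z v)) \<partial>m)" for u v
  have qn: "u \<in> E \<Longrightarrow> 0 \<le> q u" and pn: "u \<in> E \<Longrightarrow> 0 \<le> p u" for u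
    using q p unfolding seminorm_on_def by auto
  have int_B: "integrable m (\<lambda>z. of_real (c z) * (L z u * cnj (L z v)))" if "u \<in> E" "v \<in> E" for u v
  proof -
    have [measurable]: "(\<lambda>z. of_real (c z) * (L z u * cnj (L z v))) \<in> borel_measurable m"
      using L_meas[OF that(1)] L_meas[OF that(2)] by measurable
    show ?thesis
    proof (rule Bochner_Integration.integrable_bound[where f="\<lambda>z. q u * q v * (c z * (a z)\<^sup>2)"])
    show "AE z in m. norm (complex_of_real (c z) * (L z u * cnj (L z v)))
         \<le> norm (q u * q v * (c z * (a z)\<^sup>2))"
    proof (rule AE_I2)
      fix z
      have "c z * (cmod (L z u) * cmod (L z v)) \<le> c z * ((a z * q u) * (a z * q v))"
        using L_q that pos qn by (intro mult_left_mono mult_mono) auto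
      then show "norm (complex_of_real (c z) * (L z u * cnj (L z v)))
         \<le> norm (q u * q v * (c z * (a z)\<^sup>2))"
        using pos qn that by (simp add: norm_mult power2_eq_square mult_ac)
    qed
    qed (use ca in simp_all)
  qed
  have int_sq: "integrable m (\<lambda>z. c z * (cmod (L z u))\<^sup>2)" if "u \<in> E" for u
  proof -
    have "(\<lambda>z. c z * (cmod (L z u))\<^sup>2) = (\<lambda>z. Re (of_real (c z) * (L z u * cnj (L z u))))"
      by (intro ext) (simp flip: complex_norm_square)
    then show ?thesis using integrable_Re[OF int_B[OF that that]] by (simp only:)
  qed
  have Buu: "Re (B u u) = (\<integral>z. c z * (cmod (L z u))\<^sup>2 \<partial>m)" if "u \<in> E" for u
  proof -
    have "B u u = (\<integral>z. of_real (c z * (cmod (L z u))\<^sup>2) \<partial>m)"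
      unfolding B_def by (intro Bochner_Integration.integral_cong refl) (simp only: of_real_mult complex_norm_square)
    then show ?thesis unfolding integral_complex_of_real by simp
  qed
  interpret vector_space sc by (rule vs)
  interpret hermitian_form sc E B
  proof
    show "subspace E" by (rule sub)
    show "B (u + v) x = B u x + B v x" if "u \<in> E" "v \<in> E" "x \<in> E" for u v x
      unfolding B_def Bochner_Integration.integral_add[OF int_B[OF that(1,3)] int_B[OF that(2,3)], symmetric]
      by (intro Bochner_Integration.integral_cong refl) (simp only: L_add[OF that(1,2)] ring_distribs)
    show "B (sc k u) x = k * B u x" if "u \<in> E" "x \<in> E" for u x k
      unfolding B_def
      by (rule trans[OF _ integral_mult_right_zero], intro Bochner_Integration.integral_cong refl) (simp only: L_scale[OF that(1)] mult_ac)
    show "B x u = cnj (B u x)" if "u \<in> E" "x \<in> E" for u x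
    proof -
      have "cnj (B u x) = (\<integral>z. cnj (of_real (c z) * (L z u * cnj (L z x))) \<partial>m)"
        unfolding B_def by (rule Bochner_Integration.integral_cnj[symmetric])
      also have "\<dots> = B x u"
        unfolding B_def by (intro Bochner_Integration.integral_cong refl) (simp add: mult.commute)
      finally show ?thesis ..
    qed
    show "0 \<le> Re (B u u)" if "u \<in> E" for u
      unfolding Buu[OF that] by (intro integral_nonneg_AE AE_I2 mult_nonneg_nonneg pos) simp
  qed
  have hn: "hnorm u = sqrt (\<integral>z. c z * (cmod (L z u))\<^sup>2 \<partial>m)" if "u \<in> E" for u
    unfolding hnorm_def Buu[OF that] ..
  have Lh: "cmod (L z u) \<le> w z * hnorm u" if "u \<in> E" for u z
    using L_h[OF that] hn[OF that] by simp
  have L_sum: "L z (\<Sum>j<n. sc (k j) (e j)) = (\<Sum>j<n. k j * L z (e j))"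
    if "\<And>j. j < n \<Longrightarrow> e j \<in> E" for z n k and e :: "nat \<Rightarrow> 'v"
    using that
  proof (induction n)
    case 0
    show ?case using L_scale[of 0 z 0] E_closed by simp
  next
    case (Suc n)
    have "(\<Sum>j<n. sc (k j) (e j)) \<in> E"
      using Suc by (intro subspace_sum subspace_E E_closed) auto
    then show ?case using Suc E_closed by (simp add: L_add L_scale)
  qed
  \<comment> \<open>Test \<open>L_h\<close> on the combination of the \<open>e j\<close> with coefficients \<open>cnj (L z (e j))\<close>.\<close>
  have bessel: "(\<Sum>j<n. (cmod (L z (e j)))\<^sup>2) \<le> (w z)\<^sup>2" if o: "orthonormal_upto e n" for e n z
  proof -
    define S where "S = (\<Sum>j<n. (cmod (L z (e j)))\<^sup>2)"
    define v where "v = (\<Sum>j<n. sc (cnj (L z (e j))) (e j))"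
    have eE: "j < n \<Longrightarrow> e j \<in> E" for j using o unfolding orthonormal_upto_def by auto
    have vE: "v \<in> E" unfolding v_def by (rule proj_in_E[OF o])
    have "L z v = (\<Sum>j<n. cnj (L z (e j)) * L z (e j))" unfolding v_def by (rule L_sum[OF eE])
    also have "\<dots> = of_real S" unfolding S_def
      by (simp only: of_real_sum complex_norm_square mult.commute)
    finally have Lz: "L z v = of_real S" .
    have S0: "0 \<le> S" unfolding S_def by (simp add: sum_nonneg)
    have Lv: "cmod (L z v) = S" unfolding Lz using S0 by simp
    have "B v v = (\<Sum>j<n. cnj (L z (e j)) * B (e j) v)"
    proof -
      have "B (\<Sum>j<n. sc (cnj (L z (e j))) (e j)) v = (\<Sum>j<n. cnj (L z (e j)) * B (e j) v)"
        using eE by (intro form_sum vE) auto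
      then show ?thesis unfolding v_def[symmetric] .
    qed
    also have "\<dots> = (\<Sum>j<n. cnj (L z (e j)) * (L z (e j) * B (e j) (e j)))"
    proof (intro sum.cong refl)
      fix j assume j: "j \<in> {..<n}"
      have "B v (e j) = cnj (L z (e j)) * B (e j) (e j)"
        unfolding v_def using j by (intro orthonormal_sum o) auto
      then have "B (e j) v = L z (e j) * B (e j) (e j)"
        using form_cnj[OF vE eE, of j] form_cnj[OF eE eE, of j j] j by simp
      then show "cnj (L z (e j)) * B (e j) v = cnj (L z (e j)) * (L z (e j) * B (e j) (e j))" by simp
    qed
    finally have Bvv: "B v v = (\<Sum>j<n. cnj (L z (e j)) * (L z (e j) * B (e j) (e j)))" .
    have "Re (B v v) \<le> S" unfolding S_def Bvv Re_sum
    proof (intro sum_mono)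
      fix j assume j: "j \<in> {..<n}"
      have "e j = 0 \<or> B (e j) (e j) = 1" using o j unfolding orthonormal_upto_def by auto
      then show "Re (cnj (L z (e j)) * (L z (e j) * B (e j) (e j))) \<le> (cmod (L z (e j)))\<^sup>2"
        using form_zero(1)[OF E_closed(1)]
        by (elim disjE; simp add: cmod_power2; simp add: power2_eq_square)
    qed
    then have "(hnorm v)\<^sup>2 \<le> S" using form_nonneg[OF vE] unfolding hnorm_def by simp
    moreover have "S\<^sup>2 \<le> (w z * hnorm v)\<^sup>2" using Lh[OF vE, of z] Lv by (intro power_mono) auto
    ultimately have "S * S \<le> (w z)\<^sup>2 * S"
      using mult_left_mono[of "(hnorm v)\<^sup>2" S "(w z)\<^sup>2"] by (simp add: power_mult_distrib power2_eq_square[of S])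
    then have "S \<le> (w z)\<^sup>2"
      using S0 mult_right_le_imp_le[of S S "(w z)\<^sup>2"] by (cases "S = 0") simp_all
    then show ?thesis unfolding S_def .
  qed
  have Le: "cmod (L z (e j)) \<le> w z" if o: "orthonormal_upto e n" and j: "j < n" for e n j z
  proof -
    have "(cmod (L z (e j)))\<^sup>2 \<le> (\<Sum>j<n. (cmod (L z (e j)))\<^sup>2)"
      using j by (intro member_le_sum) auto
    also have "\<dots> \<le> (w z)\<^sup>2" by (rule bessel[OF o])
    finally show ?thesis using pos(2)[of z] by (auto intro: power2_le_imp_le)
  qed
  have B_bound: "cmod (B u v) \<le> q u * (\<integral>z. c z * a z * cmod (L z v) \<partial>m)"
    if u: "u \<in> E" and v: "v \<in> E" for u v
  proof -
    note [measurable] = L_meas[OF v]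
    have iv: "integrable m (\<lambda>z. c z * a z * cmod (L z v))"
    proof (rule Bochner_Integration.integrable_bound[where f="\<lambda>z. q v * (c z * (a z)\<^sup>2)"])
      show "AE z in m. norm (c z * a z * cmod (L z v)) \<le> norm (q v * (c z * (a z)\<^sup>2))"
      proof (rule AE_I2)
        fix z
        have "c z * a z * cmod (L z v) \<le> c z * a z * (a z * q v)"
          using L_q v pos by (intro mult_left_mono) auto
        then show "norm (c z * a z * cmod (L z v)) \<le> norm (q v * (c z * (a z)\<^sup>2))"
          using pos qn v by (simp add: power2_eq_square mult_ac)
      qed
    qed (use ca in auto)
    have "cmod (B u v) \<le> (\<integral>z. q u * (c z * a z * cmod (L z v)) \<partial>m)"
      unfolding B_def
    proof (rule order_trans[OF Bochner_Integration.integral_norm_bound Bochner_Integration.integral_mono])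
      show "integrable m (\<lambda>z. cmod (complex_of_real (c z) * (L z u * cnj (L z v))))"
        using int_B[OF u v] by (rule integrable_norm)
      show "integrable m (\<lambda>z. q u * (c z * a z * cmod (L z v)))" using iv by simp
      fix z
      have "c z * (cmod (L z u) * cmod (L z v)) \<le> c z * ((a z * q u) * cmod (L z v))"
        using L_q u pos by (intro mult_left_mono mult_right_mono) auto
      then show "norm (complex_of_real (c z) * (L z u * cnj (L z v))) \<le> q u * (c z * a z * cmod (L z v))"
        using pos by (simp add: norm_mult mult_ac)
    qed
    then show ?thesis by simp
  qed
  define I where "I = (\<integral>z. c z * a z * w z \<partial>m)"
  show ?thesis
  proof (rule nuclear_linking_map_of_hilbert_schmidt[OF q p,
        where K="sqrt (\<integral>z. c z * (a z)\<^sup>2 \<partial>m)" and K'="sqrt (\<integral>z. b z * (w z)\<^sup>2 \<partial>m)"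
        and ?C1.0="I * I" and ?C2.0="\<integral>z. b z * (w z)\<^sup>2 \<partial>m"])
    fix u assume u: "u \<in> E"
    have "(\<integral>z. c z * (cmod (L z u))\<^sup>2 \<partial>m) \<le> (\<integral>z. (c z * (a z)\<^sup>2) * (q u)\<^sup>2 \<partial>m)"
    proof (rule Bochner_Integration.integral_mono)
      fix z
      have "(cmod (L z u))\<^sup>2 \<le> (a z * q u)\<^sup>2" using L_q[OF u] by (intro power_mono) auto
      then show "c z * (cmod (L z u))\<^sup>2 \<le> (c z * (a z)\<^sup>2) * (q u)\<^sup>2"
        using mult_left_mono[OF _ pos(1)[of z]] by (simp add: power_mult_distrib mult.assoc)
    qed (use int_sq u ca in auto)
    then have "hnorm u \<le> sqrt ((\<integral>z. c z * (a z)\<^sup>2 \<partial>m) * (q u)\<^sup>2)"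
      unfolding hn[OF u] by simp
    then show "hnorm u \<le> sqrt (\<integral>z. c z * (a z)\<^sup>2 \<partial>m) * q u"
      using qn[OF u] by (simp add: real_sqrt_mult)
    have hn0: "0 \<le> hnorm u" by (rule hnorm_nonneg[OF u])
    have "(p u)\<^sup>2 \<le> (\<integral>z. b z * (cmod (L z u))\<^sup>2 \<partial>m)" by (rule p_L[OF u])
    also have "\<dots> \<le> (\<integral>z. (b z * (w z)\<^sup>2) * (hnorm u)\<^sup>2 \<partial>m)"
    proof (rule Bochner_Integration.integral_mono')
      show "integrable m (\<lambda>z. b z * (w z)\<^sup>2 * (hnorm u)\<^sup>2)" using bw by simp
      fix z
      have "(cmod (L z u))\<^sup>2 \<le> (w z * hnorm u)\<^sup>2" using Lh[OF u] by (intro power_mono) auto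
      then show "b z * (cmod (L z u))\<^sup>2 \<le> b z * (w z)\<^sup>2 * (hnorm u)\<^sup>2"
        using mult_left_mono[OF _ pos(4)[of z]] by (simp add: power_mult_distrib mult.assoc)
    qed (use pos in auto)
    finally have "(p u)\<^sup>2 \<le> (\<integral>z. b z * (w z)\<^sup>2 \<partial>m) * (hnorm u)\<^sup>2" by simp
    then have "sqrt ((p u)\<^sup>2) \<le> sqrt ((\<integral>z. b z * (w z)\<^sup>2 \<partial>m) * (hnorm u)\<^sup>2)"
      by (rule real_sqrt_le_mono)
    then show "p u \<le> sqrt (\<integral>z. b z * (w z)\<^sup>2 \<partial>m) * hnorm u"
      using hn0 pn[OF u] by (simp add: real_sqrt_mult)
  next
    fix v assume v: "v \<in> E"
    show "\<exists>C. \<forall>u\<in>E. cmod (B u v) \<le> C * q u"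
      using B_bound[OF _ v] by (intro exI[of _ "\<integral>z. c z * a z * cmod (L z v) \<partial>m"]) (auto simp: mult.commute)
  next
    fix e n assume o: "orthonormal_upto e n"
    have eE: "j < n \<Longrightarrow> e j \<in> E" for j using o unfolding orthonormal_upto_def by auto
    have i1: "integrable m (\<lambda>z. c z * a z * cmod (L z (e j)))" if j: "j < n" for j
      supply [measurable] = L_meas[OF eE[OF j]]
    proof (rule Bochner_Integration.integrable_bound[OF caw])
      show "AE z in m. norm (c z * a z * cmod (L z (e j))) \<le> norm (c z * a z * w z)"
        using Le[OF o j] pos less_imp_le[OF pos(2)] by (intro AE_I2) (auto simp: abs_mult intro!: mult_mono)
    qed measurable
    have i2_bd: "c z * a z / w z * x \<le> c z * a z * w z" if "x \<le> (w z)\<^sup>2" for x z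
    proof -
      have "c z * a z / w z * x \<le> c z * a z / w z * (w z)\<^sup>2"
        using that pos(1,3)[of z] pos(2)[of z] by (intro mult_left_mono divide_nonneg_pos) auto
      also have "\<dots> = c z * a z * w z" using pos(2)[of z] by (simp add: field_simps power2_eq_square)
      finally show ?thesis .
    qed
    have i2: "integrable m (\<lambda>z. c z * a z / w z * (cmod (L z (e j)))\<^sup>2)" if j: "j < n" for j
      supply [measurable] = L_meas[OF eE[OF j]]
    proof (rule Bochner_Integration.integrable_bound[OF caw])
      show "AE z in m. norm (c z * a z / w z * (cmod (L z (e j)))\<^sup>2) \<le> norm (c z * a z * w z)"
      proof (rule AE_I2)
        fix z
        have "c z * a z / w z * (cmod (L z (e j)))\<^sup>2 \<le> c z * a z * w z"
          using Le[OF o j] by (intro i2_bd power_mono) auto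
        moreover have "0 \<le> c z * a z / w z * (cmod (L z (e j)))\<^sup>2"
          using pos(1,3)[of z] pos(2)[of z] by auto
        ultimately show "norm (c z * a z / w z * (cmod (L z (e j)))\<^sup>2) \<le> norm (c z * a z * w z)"
          by (metis abs_ge_self abs_of_nonneg order_trans real_norm_def)
      qed
    qed measurable
    have I0: "0 \<le> I" unfolding I_def using pos less_imp_le[OF pos(2)] by (intro integral_nonneg_AE AE_I2) auto
    have dn: "(dual_norm E q (\<lambda>u. B u (e j)))\<^sup>2 \<le> I * (\<integral>z. c z * a z / w z * (cmod (L z (e j)))\<^sup>2 \<partial>m)"
      if j: "j < n" for j
    proof -
      define d where "d = (\<integral>z. c z * a z * cmod (L z (e j)) \<partial>m)"
      have d0: "0 \<le> d" unfolding d_def using pos by (intro integral_nonneg_AE AE_I2) auto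
      have bd: "cmod (B u (e j)) \<le> d" if "u \<in> E" "q u \<le> 1" for u
        using B_bound[OF that(1) eE[OF j]] mult_right_mono[OF that(2) d0] unfolding d_def[symmetric] by simp
      have "q (sc 0 0) = cmod 0 * q 0" using q E_closed unfolding seminorm_on_def by blast
      then have z: "0 \<in> {u \<in> E. q u \<le> 1}" using E_closed by auto
      have "dual_norm E q (\<lambda>u. B u (e j)) \<le> d"
        unfolding dual_norm_def using bd z by (intro cSUP_least) auto
      moreover have "0 \<le> dual_norm E q (\<lambda>u. B u (e j))"
        unfolding dual_norm_def using bd z by (intro cSUP_upper2[where x=0]) (auto intro!: bdd_aboveI2)
      ultimately have "(dual_norm E q (\<lambda>u. B u (e j)))\<^sup>2 \<le> d\<^sup>2" by (intro power_mono) auto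
      also have "d\<^sup>2 \<le> I * (\<integral>z. c z * a z / w z * (cmod (L z (e j)))\<^sup>2 \<partial>m)"
        unfolding d_def I_def using pos i1[OF j] i2[OF j] caw
        by (intro weighted_Cauchy_Schwarz) auto
      finally show ?thesis .
    qed
    have "(\<Sum>j<n. (dual_norm E q (\<lambda>u. B u (e j)))\<^sup>2)
        \<le> (\<Sum>j<n. I * (\<integral>z. c z * a z / w z * (cmod (L z (e j)))\<^sup>2 \<partial>m))"
      using dn by (intro sum_mono) auto
    also have "\<dots> = I * (\<integral>z. (\<Sum>j<n. c z * a z / w z * (cmod (L z (e j)))\<^sup>2) \<partial>m)"
      using i2 by (subst Bochner_Integration.integral_sum) (auto simp: sum_distrib_left)
    also have "\<dots> \<le> I * I" unfolding I_def[symmetric]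
    proof (intro mult_left_mono I0)
      have "(\<integral>z. (\<Sum>j<n. c z * a z / w z * (cmod (L z (e j)))\<^sup>2) \<partial>m) \<le> (\<integral>z. c z * a z * w z \<partial>m)"
        using i2 caw bessel[OF o] unfolding sum_distrib_left[symmetric]
        by (intro Bochner_Integration.integral_mono i2_bd) (auto simp: sum_distrib_left)
      then show "(\<integral>z. (\<Sum>j<n. c z * a z / w z * (cmod (L z (e j)))\<^sup>2) \<partial>m) \<le> I" unfolding I_def .
    qed
    finally show "(\<Sum>j<n. (dual_norm E q (\<lambda>u. B u (e j)))\<^sup>2) \<le> I * I" .
    have i3: "integrable m (\<lambda>z. b z * (cmod (L z (e j)))\<^sup>2)" if j: "j < n" for j
      supply [measurable] = L_meas[OF eE[OF j]]
    proof (rule Bochner_Integration.integrable_bound[OF bw])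
      show "AE z in m. norm (b z * (cmod (L z (e j)))\<^sup>2) \<le> norm (b z * (w z)\<^sup>2)"
        using Le[OF o j] pos by (intro AE_I2) (auto simp: abs_mult intro!: mult_left_mono power_mono)
    qed measurable
    have "(\<Sum>j<n. (p (e j))\<^sup>2) \<le> (\<Sum>j<n. (\<integral>z. b z * (cmod (L z (e j)))\<^sup>2 \<partial>m))"
      using p_L eE by (intro sum_mono) auto
    also have "\<dots> = (\<integral>z. (\<Sum>j<n. b z * (cmod (L z (e j)))\<^sup>2) \<partial>m)"
      by (rule Bochner_Integration.integral_sum[symmetric]) (simp add: i3)
    also have "\<dots> \<le> (\<integral>z. b z * (w z)\<^sup>2 \<partial>m)"
    proof (rule Bochner_Integration.integral_mono)
      show "integrable m (\<lambda>z. \<Sum>j<n. b z * (cmod (L z (e j)))\<^sup>2)"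
        by (rule Bochner_Integration.integrable_sum) (simp add: i3)
      show "(\<Sum>j<n. b z * (cmod (L z (e j)))\<^sup>2) \<le> b z * (w z)\<^sup>2" for z
        unfolding sum_distrib_left[symmetric] by (intro mult_left_mono bessel[OF o] pos)
    qed (rule bw)
    finally show "(\<Sum>j<n. (p (e j))\<^sup>2) \<le> (\<integral>z. b z * (w z)\<^sup>2 \<partial>m)" .
  qed
qed

section \<open>Topologies generated by seminorms\<close>

locale seminormed_space = vector_space sc
  for sc :: "complex \<Rightarrow> 'v \<Rightarrow> 'v::ab_group_add" +
  fixes E :: "'v set" and P :: "('v \<Rightarrow> real) set"
  assumes subspace_E: "subspace E"
    and seminorm: "p \<in> P \<Longrightarrow> seminorm_on sc E p"
    and nonempty: "P \<noteq> {}"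
    and directed: "p \<in> P \<Longrightarrow> q \<in> P \<Longrightarrow> \<exists>r\<in>P. \<forall>u\<in>E. p u \<le> r u \<and> q u \<le> r u"
    and separating: "u \<in> E \<Longrightarrow> u \<noteq> 0 \<Longrightarrow> \<exists>p\<in>P. 0 < p u"
begin

abbreviation T :: "'v topology" where "T \<equiv> seminorm_topology E P"

lemma diff_E: "u \<in> E \<Longrightarrow> v \<in> E \<Longrightarrow> u - v \<in> E"
  using subspace_E by (rule subspace_diff)

lemma seminorm_triangle:
  assumes p: "seminorm_on sc E p" and "u \<in> E" "v \<in> E" "w \<in> E"
  shows "p (u - w) \<le> p (u - v) + p (v - w)"
proof -
  have "p ((u - v) + (v - w)) \<le> p (u - v) + p (v - w)"
    using p diff_E assms unfolding seminorm_on_def by blast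
  then show ?thesis by simp
qed

lemma seminorm_minus:
  assumes p: "seminorm_on sc E p" and "u \<in> E" "v \<in> E"
  shows "p (u - v) = p (v - u)"
proof -
  have "p (sc (- 1) (v - u)) = cmod (- 1) * p (v - u)"
    using p diff_E assms unfolding seminorm_on_def by blast
  then show ?thesis by simp
qed

lemma seminorm_zero: "seminorm_on sc E p \<Longrightarrow> p 0 = 0"
proof -
  assume p: "seminorm_on sc E p"
  have "p (sc 0 0) = cmod 0 * p 0"
    using p subspace_0[OF subspace_E] unfolding seminorm_on_def by blast
  then show ?thesis by simp
qed

lemma topspace_T [simp]: "topspace T = E"
proof -
  obtain p where p: "p \<in> P" using nonempty by blast
  have "u \<in> {v \<in> E. p (v - u) < 1}" if "u \<in> E" for u
    using that seminorm_zero[OF seminorm[OF p]] by simp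
  then have "E \<subseteq> \<Union> {{v \<in> E. p (v - u) < r} |p u r. p \<in> P \<and> u \<in> E \<and> 0 < r}"
    using p zero_less_one by blast
  moreover have "\<Union> {{v \<in> E. p (v - u) < r} |p u r. p \<in> P \<and> u \<in> E \<and> 0 < r} \<subseteq> E" by blast
  ultimately show ?thesis unfolding seminorm_topology_def topology_generated_by_topspace by blast
qed

lemma openin_ball: "p \<in> P \<Longrightarrow> u \<in> E \<Longrightarrow> 0 < r \<Longrightarrow> openin T {v \<in> E. p (v - u) < r}"
  unfolding seminorm_topology_def by (rule topology_generated_by_Basis) blast

text \<open>The balls of the single seminorms are only a subbasis; directedness makes them a base of
  neighbourhoods of each point.\<close>

lemma ball_in_open:
  assumes "openin T U" "u \<in> U"
  shows "\<exists>p\<in>P. \<exists>r>0. {v \<in> E. p (v - u) < r} \<subseteq> U"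
proof -
  define S where "S = {{v \<in> E. p (v - u) < r} |p u r. p \<in> P \<and> u \<in> E \<and> 0 < r}"
  have "generate_topology_on S U"
    using assms(1) unfolding seminorm_topology_def S_def openin_topology_generated_by_iff .
  then show ?thesis using assms(2)
  proof (induction arbitrary: u)
    case Empty
    then show ?case by simp
  next
    case (Int a b)
    obtain p r where p: "p \<in> P" "r > 0" "{v \<in> E. p (v - u) < r} \<subseteq> a" using Int by blast
    obtain q s where q: "q \<in> P" "s > 0" "{v \<in> E. q (v - u) < s} \<subseteq> b" using Int by blast
    obtain t where t: "t \<in> P" "\<forall>u\<in>E. p u \<le> t u \<and> q u \<le> t u" using directed[OF p(1) q(1)] by blast
    have uE: "u \<in> E"
    proof -
      have "openin T a" using Int.hyps(1) unfolding seminorm_topology_def S_def openin_topology_generated_by_iff .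
      then show ?thesis using Int.prems openin_subset by fastforce
    qed
    have "v \<in> a \<inter> b" if "v \<in> E" "t (v - u) < min r s" for v
    proof -
      have "p (v - u) < r" "q (v - u) < s" using t(2) diff_E[OF that(1) uE] that(2) by fastforce+
      then show ?thesis using p(3) q(3) that(1) by blast
    qed
    then have "{v \<in> E. t (v - u) < min r s} \<subseteq> a \<inter> b" by blast
    then show ?case using t(1) p(2) q(2) by (meson min_less_iff_conj)
  next
    case (UN K)
    then show ?case by (meson Sup_upper UnionE subset_trans)
  next
    case (Basis s)
    then obtain p w r where s: "s = {v \<in> E. p (v - w) < r}" and p: "p \<in> P" "w \<in> E" "r > 0"
      unfolding S_def by blast
    have u: "u \<in> E" "p (u - w) < r" using Basis.prems s by auto
    have "{v \<in> E. p (v - u) < r - p (u - w)} \<subseteq> s"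
      using seminorm_triangle[OF seminorm[OF p(1)] _ u(1) p(2)] unfolding s by fastforce
    then show ?case using p(1) u(2) by (meson diff_gt_0_iff_gt)
  qed
qed

lemma Hausdorff_T: "Hausdorff_space T"
  unfolding Hausdorff_space_def
proof (intro allI impI)
  fix u v assume "u \<in> topspace T \<and> v \<in> topspace T \<and> u \<noteq> v"
  then have uv: "u \<in> E" "v \<in> E" "u \<noteq> v" by auto
  obtain p where p: "p \<in> P" "0 < p (u - v)" using separating[OF diff_E[OF uv(1,2)]] uv(3) by auto
  define r where "r = p (u - v) / 2"
  have r: "r > 0" using p by (simp add: r_def)
  have sp: "seminorm_on sc E p" by (rule seminorm[OF p(1)])
  have "w \<notin> {w \<in> E. p (w - v) < r}" if "w \<in> {w \<in> E. p (w - u) < r}" for w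
    using that seminorm_triangle[OF sp uv(1) _ uv(2), of w] seminorm_minus[OF sp uv(1), of w]
    unfolding r_def by auto
  then have "disjnt {w \<in> E. p (w - u) < r} {w \<in> E. p (w - v) < r}"
    unfolding disjnt_def by blast
  moreover have "u \<in> {w \<in> E. p (w - u) < r}" "v \<in> {w \<in> E. p (w - v) < r}"
    using uv r seminorm_zero[OF sp] by auto
  ultimately show "\<exists>U V. openin T U \<and> openin T V \<and> u \<in> U \<and> v \<in> V \<and> disjnt U V"
    using openin_ball[OF p(1) uv(1) r] openin_ball[OF p(1) uv(2) r] by blast
qed

lemma locally_convex_T: "locally_convex_space sc T"
  unfolding locally_convex_space_def topspace_T
  using vector_space_axioms subspace_E Hausdorff_T seminorm by blast

text \<open>A continuous seminorm is less than \<open>1\<close> on some ball around \<open>0\<close>; rescale.\<close>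

lemma continuous_seminorm_le:
  assumes "continuous_seminorm sc T p"
  shows "\<exists>q\<in>P. \<exists>K>0. \<forall>u\<in>E. p u \<le> K * q u"
proof -
  have p: "seminorm_on sc E p" and c: "continuous_map T euclideanreal p"
    using assms unfolding continuous_seminorm_def by auto
  have "openin T {u \<in> topspace T. p u \<in> {..<1}}"
    by (rule openin_continuous_map_preimage[OF c]) simp
  moreover have "0 \<in> {u \<in> topspace T. p u \<in> {..<1}}"
    using seminorm_zero[OF p] subspace_0[OF subspace_E] by simp
  ultimately obtain q r where q: "q \<in> P" and r: "r > 0"
    and sub: "{v \<in> E. q (v - 0) < r} \<subseteq> {u \<in> topspace T. p u \<in> {..<1}}"
    using ball_in_open by blast
  have sq: "seminorm_on sc E q" by (rule seminorm[OF q])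
  have "p u \<le> (1 / r) * q u" if u: "u \<in> E" for u
  proof (rule field_le_epsilon)
    fix e :: real assume e: "e > 0"
    define t where "t = q u + r * e"
    have qu: "0 \<le> q u" using sq u unfolding seminorm_on_def by auto
    have t: "t > 0" using qu r e by (simp add: t_def add_nonneg_pos)
    define v where "v = sc (of_real (r / t)) u"
    have v: "v \<in> E" unfolding v_def by (rule subspace_scale[OF subspace_E u])
    have qv: "q v = cmod (of_real (r / t)) * q u" and pv: "p v = cmod (of_real (r / t)) * p u"
      using sq p u unfolding seminorm_on_def v_def by blast+
    have "q v = r * (q u / t)" unfolding qv using r t by (simp add: norm_divide)
    also have "\<dots> < r * 1"
      using r t e unfolding t_def by (intro mult_strict_left_mono) (auto simp: divide_less_eq)
    finally have "p v < 1" using sub v by auto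
    then have "r / t * p u < 1" unfolding pv using r t by (simp add: norm_divide)
    then have "p u < t / r" using r t by (simp add: field_simps)
    also have "t / r = (1 / r) * q u + e" using r by (simp add: t_def field_simps)
    finally show "p u \<le> (1 / r) * q u + e" by simp
  qed
  then show ?thesis using q r by (intro bexI[of _ q] exI[of _ "1 / r"]) auto
qed

lemma continuous_seminorm_scaled:
  assumes q: "q \<in> P" and K: "K > 0"
  shows "continuous_seminorm sc T (\<lambda>u. K * q u)"
  unfolding continuous_seminorm_def topspace_T
proof
  have sq: "seminorm_on sc E q" by (rule seminorm[OF q])
  then show "seminorm_on sc E (\<lambda>u. K * q u)"
    using K unfolding seminorm_on_def by (simp add: distrib_left[symmetric])
  show "continuous_map T euclideanreal (\<lambda>u. K * q u)"
    unfolding continuous_map_def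
  proof (intro conjI allI impI)
    fix U :: "real set" assume U: "openin euclidean U"
    show "openin T {u \<in> topspace T. K * q u \<in> U}"
    proof (subst openin_subopen, intro ballI)
      fix u assume u: "u \<in> {u \<in> topspace T. K * q u \<in> U}"
      then have uE: "u \<in> E" "K * q u \<in> U" by auto
      obtain e where e: "e > 0" "\<And>y. \<bar>y - K * q u\<bar> < e \<Longrightarrow> y \<in> U"
        using U uE(2) unfolding open_openin[symmetric] open_dist dist_real_def by blast
      have "K * q v \<in> U" if v: "v \<in> E" "q (v - u) < e / K" for v
      proof (rule e(2))
        have z: "0 \<in> E" by (rule subspace_0[OF subspace_E])
        have 1: "q v \<le> q (v - u) + q u" using seminorm_triangle[OF sq v(1) uE(1) z] by simp
        have 2: "q u \<le> q (v - u) + q v"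
          using seminorm_triangle[OF sq uE(1) v(1) z] seminorm_minus[OF sq uE(1) v(1)] by simp
        have "\<bar>K * q v - K * q u\<bar> = K * \<bar>q v - q u\<bar>"
          using K by (simp add: abs_mult right_diff_distrib[symmetric])
        also have "\<dots> \<le> K * q (v - u)" using 1 2 K by (intro mult_left_mono) auto
        also have "\<dots> < e" using v(2) K by (simp add: field_simps)
        finally show "\<bar>K * q v - K * q u\<bar> < e" .
      qed
      then have "{v \<in> E. q (v - u) < e / K} \<subseteq> {u \<in> topspace T. K * q u \<in> U}" by auto
      moreover have "u \<in> {v \<in> E. q (v - u) < e / K}"
        using uE e K seminorm_zero[OF sq] by simp
      ultimately show "\<exists>V. openin T V \<and> u \<in> V \<and> V \<subseteq> {u \<in> topspace T. K * q u \<in> U}"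
        using openin_ball[OF q uE(1), of "e / K"] e K by (meson divide_pos_pos)
    qed
  qed auto
qed

text \<open>Every continuous seminorm is dominated by a multiple of a generating one, and such a multiple is again
  continuous.\<close>

theorem nuclear_space_T:
  assumes "\<And>p q K. seminorm_on sc E p \<Longrightarrow> q \<in> P \<Longrightarrow> K > 0 \<Longrightarrow> (\<forall>u\<in>E. p u \<le> K * q u) \<Longrightarrow>
     \<exists>r\<in>P. \<exists>K'>0. (\<forall>u\<in>E. p u \<le> K' * r u) \<and> nuclear_linking_map sc E (\<lambda>u. K' * r u) p"
  shows "nuclear_space sc T"
  unfolding nuclear_space_def topspace_T
proof (intro conjI allI impI locally_convex_T)
  fix p assume p: "continuous_seminorm sc T p"
  then have sp: "seminorm_on sc E p" unfolding continuous_seminorm_def by simp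
  obtain q K where q: "q \<in> P" "K > 0" "\<forall>u\<in>E. p u \<le> K * q u" using continuous_seminorm_le[OF p] by blast
  obtain r K' where r: "r \<in> P" "K' > 0" "\<forall>u\<in>E. p u \<le> K' * r u"
    "nuclear_linking_map sc E (\<lambda>u. K' * r u) p"
    using assms[OF sp q] by blast
  show "\<exists>q. continuous_seminorm sc T q \<and> (\<forall>u\<in>E. p u \<le> q u) \<and> nuclear_linking_map sc E q p"
    by (rule exI[of _ "\<lambda>u. K' * r u"]) (use continuous_seminorm_scaled[OF r(1,2)] r(3,4) in auto)
qed

end

section \<open>Weight functions and their sequences\<close>

text \<open>With \<open>r = exp t\<close> this is the supremum of \<open>r ^ n * exp (- \<mu> * \<omega> r)\<close> over \<open>r \<ge> 1\<close>: see
  \<open>weight_seq_lower\<close> and \<open>weight_seq_upper\<close>.\<close>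

definition weight_seq :: "(real \<Rightarrow> real) \<Rightarrow> real \<Rightarrow> nat \<Rightarrow> real" where
  "weight_seq \<omega> \<mu> n = exp (\<mu> * young_conj \<omega> (real n / \<mu>))"

locale doubling_weight =
  fixes \<omega> :: "real \<Rightarrow> real"
  assumes weight: "weight_function \<omega>"
    and doubling: "\<exists>H>1. \<forall>t\<ge>0. 2 * \<omega> t \<le> \<omega> (H * t) + H"
begin

lemma weight_nonneg: "0 \<le> t \<Longrightarrow> 0 \<le> \<omega> t"
proof -
  have "\<forall>t\<ge>0. 0 \<le> \<omega> t" using weight unfolding weight_function_def by (rule conjunct1)
  then show "0 \<le> t \<Longrightarrow> 0 \<le> \<omega> t" by simp
qed

lemma weight_mono: "0 \<le> s \<Longrightarrow> s \<le> t \<Longrightarrow> \<omega> s \<le> \<omega> t"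
proof -
  assume st: "0 \<le> s" "s \<le> t"
  have "mono_on {0..} \<omega>" using weight unfolding weight_function_def by blast
  then show ?thesis by (rule mono_onD) (use st in simp_all)
qed

lemma doubling_iterated: "\<exists>K\<ge>1. \<exists>c. \<forall>t\<ge>0. 2 ^ j * \<omega> t \<le> \<omega> (K * t) + c"
proof (induction j)
  case 0
  show ?case by (rule exI[of _ 1]) auto
next
  case (Suc j)
  obtain H where H: "H > 1" "\<And>t. t \<ge> 0 \<Longrightarrow> 2 * \<omega> t \<le> \<omega> (H * t) + H" using doubling by auto
  obtain K c where K: "K \<ge> 1" "\<And>t. t \<ge> 0 \<Longrightarrow> 2 ^ j * \<omega> t \<le> \<omega> (K * t) + c" using Suc by auto
  have "2 ^ Suc j * \<omega> t \<le> \<omega> ((H * K) * t) + (H + 2 * c)" if "t \<ge> 0" for t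
  proof -
    have "2 * \<omega> (K * t) \<le> \<omega> (H * (K * t)) + H" using K(1) that by (intro H(2)) simp
    then show ?thesis using K(2)[OF that] unfolding power_Suc mult.assoc by linarith
  qed
  moreover have "H * K \<ge> 1" using H(1) K(1) mult_mono[of 1 H 1 K] by simp
  ultimately show ?case by blast
qed

text \<open>By condition \<open>(\<gamma>)\<close> the weight dominates some multiple of the logarithm, and each use of the
  doubling hypothesis doubles that multiple.\<close>

lemma ln_le_weight:
  assumes "\<mu> > 0" "0 \<le> k"
  shows "\<exists>C. \<forall>r\<ge>1. k * ln r \<le> \<mu> * \<omega> r + C"
proof -
  obtain a b where b: "b > 0" and ab: "\<And>t. t \<ge> 0 \<Longrightarrow> \<omega> t \<ge> a + b * ln (1 + t)"
    using weight unfolding weight_function_def by blast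
  obtain j where j: "k / (b * \<mu>) < 2 ^ j" using real_arch_pow[of 2] by auto
  obtain K c where K: "K \<ge> 1" "\<And>t. t \<ge> 0 \<Longrightarrow> 2 ^ j * \<omega> t \<le> \<omega> (K * t) + c"
    using doubling_iterated by blast
  define C where "C = \<mu> * c - \<mu> * 2 ^ j * (a - b * ln K)"
  have "k * ln r \<le> \<mu> * \<omega> r + C" if r: "r \<ge> 1" for r
  proof -
    have "ln r - ln K = ln (r / K)" using r K by (simp add: ln_div)
    also have "\<dots> \<le> ln (1 + r / K)" using r K by (subst ln_le_cancel_iff) (auto intro!: add_pos_nonneg divide_pos_pos)
    finally have "b * (ln r - ln K) \<le> b * ln (1 + r / K)"
      using b by (intro mult_left_mono) auto
    moreover have "a + b * ln (1 + r / K) \<le> \<omega> (r / K)"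
      using r K(1) by (intro ab) simp
    ultimately have "a + b * (ln r - ln K) \<le> \<omega> (r / K)" by linarith
    then have "2 ^ j * (a + b * (ln r - ln K)) \<le> 2 ^ j * \<omega> (r / K)" by simp
    also have "\<dots> \<le> \<omega> r + c" using K(2)[of "r / K"] r K by simp
    finally have "\<mu> * (2 ^ j * (a + b * (ln r - ln K))) \<le> \<mu> * (\<omega> r + c)"
      using assms by (intro mult_left_mono) auto
    then have "(2 ^ j * b * \<mu>) * ln r \<le> \<mu> * \<omega> r + C"
      unfolding C_def by (simp add: algebra_simps)
    moreover have "k * ln r \<le> (2 ^ j * b * \<mu>) * ln r"
      using j b assms r by (intro mult_right_mono) (auto simp: field_simps)
    ultimately show ?thesis by simp
  qed
  then show ?thesis by blast
qed

lemma power_le_exp_weight: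
  assumes "\<mu> > 0"
  shows "\<exists>C>0. \<forall>r\<ge>0. (1 + r) ^ k \<le> C * exp (\<mu> * \<omega> r)"
proof -
  obtain c where c: "\<And>r. r \<ge> 1 \<Longrightarrow> real k * ln r \<le> \<mu> * \<omega> r + c"
    using ln_le_weight[OF assms, of "real k"] by auto
  have "(1 + r) ^ k \<le> (2 ^ k * exp \<bar>c\<bar>) * exp (\<mu> * \<omega> r)" if r: "r \<ge> 0" for r
  proof (cases "r \<ge> 1")
    case True
    have "r ^ k = exp (real k * ln r)" using True exp_of_nat_mult[of k "ln r"] by simp
    also have "\<dots> \<le> exp \<bar>c\<bar> * exp (\<mu> * \<omega> r)"
      unfolding exp_add[symmetric] using c[OF True] by simp
    finally have rk: "r ^ k \<le> exp \<bar>c\<bar> * exp (\<mu> * \<omega> r)" .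
    have "(1 + r) ^ k \<le> (2 * r) ^ k" using True by (intro power_mono) auto
    also have "\<dots> = 2 ^ k * r ^ k" by (simp add: power_mult_distrib)
    also have "\<dots> \<le> 2 ^ k * (exp \<bar>c\<bar> * exp (\<mu> * \<omega> r))" using rk by simp
    finally show ?thesis by (simp add: mult.assoc)
  next
    case False
    have "(1 + r) ^ k \<le> 2 ^ k" using False r by (intro power_mono) auto
    also have "\<dots> \<le> 2 ^ k * (exp \<bar>c\<bar> * exp (\<mu> * \<omega> r))"
      using weight_nonneg[OF r] assms unfolding exp_add[symmetric] by simp
    finally show ?thesis by (simp add: mult.assoc)
  qed
  then show ?thesis by (intro exI[of _ "2 ^ k * exp \<bar>c\<bar>"]) auto
qed

lemma weight_seq_pos: "0 < weight_seq \<omega> \<mu> n"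
  by (simp add: weight_seq_def)

lemma young_bdd:
  assumes "0 \<le> s"
  shows "bdd_above ((\<lambda>t. t * s - \<omega> (exp t)) ` {0..})"
proof -
  obtain C where C: "\<And>r. r \<ge> 1 \<Longrightarrow> s * ln r \<le> 1 * \<omega> r + C"
    using ln_le_weight[of 1 s] assms by auto
  have "t * s - \<omega> (exp t) \<le> C" if "t \<ge> 0" for t
    using C[of "exp t"] that by (simp add: mult.commute)
  then show ?thesis by (intro bdd_aboveI2[of _ _ C]) simp
qed

lemma weight_seq_lower:
  assumes "\<mu> > 0" "r \<ge> 1"
  shows "r ^ n * exp (- \<mu> * \<omega> r) \<le> weight_seq \<omega> \<mu> n"
proof -
  have "ln r * (real n / \<mu>) - \<omega> (exp (ln r)) \<le> young_conj \<omega> (real n / \<mu>)"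
    unfolding young_conj_def using assms by (intro cSUP_upper young_bdd) auto
  then have "\<mu> * (ln r * (real n / \<mu>) - \<omega> r) \<le> \<mu> * young_conj \<omega> (real n / \<mu>)"
    using assms by (intro mult_left_mono) auto
  moreover have "\<mu> * (ln r * (real n / \<mu>) - \<omega> r) = real n * ln r + (- \<mu> * \<omega> r)"
    using assms by (simp add: field_simps)
  ultimately have "exp (real n * ln r + (- \<mu> * \<omega> r)) \<le> weight_seq \<omega> \<mu> n"
    unfolding weight_seq_def by simp
  moreover have "exp (real n * ln r) = r ^ n" using exp_of_nat_mult[of n "ln r"] assms by simp
  ultimately show ?thesis by (simp only: exp_add)
qed

lemma weight_seq_upper:
  assumes mu: "\<mu> > 0" and K: "\<And>r. r \<ge> 1 \<Longrightarrow> r ^ n * exp (- \<mu> * \<omega> r) \<le> K"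
  shows "weight_seq \<omega> \<mu> n \<le> K"
proof -
  have K0: "K > 0" by (rule less_le_trans[OF _ K[of 1]]) simp_all
  have "young_conj \<omega> (real n / \<mu>) \<le> ln K / \<mu>"
    unfolding young_conj_def
  proof (rule cSUP_least)
    fix t :: real assume t: "t \<in> {0..}"
    have "exp (real n * t + (- \<mu> * \<omega> (exp t))) = exp t ^ n * exp (- \<mu> * \<omega> (exp t))"
      by (simp only: exp_add exp_of_nat_mult)
    also have "\<dots> \<le> K" using t by (intro K) simp
    finally have "exp (real n * t + (- \<mu> * \<omega> (exp t))) \<le> K" .
    then have "real n * t - \<mu> * \<omega> (exp t) \<le> ln K"
      using K0 by (subst ln_ge_iff) auto
    then have "(real n * t - \<mu> * \<omega> (exp t)) / \<mu> \<le> ln K / \<mu>"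
      using mu by (intro divide_right_mono) auto
    then show "t * (real n / \<mu>) - \<omega> (exp t) \<le> ln K / \<mu>"
      using mu by (simp add: diff_divide_distrib mult.commute)
  qed auto
  then have "\<mu> * young_conj \<omega> (real n / \<mu>) \<le> ln K" using mu by (simp add: field_simps)
  then show ?thesis unfolding weight_seq_def using K0 by (simp add: ln_ge_iff)
qed

lemma weight_seq_lower_all:
  assumes "\<mu> > 0" "r \<ge> 0"
  shows "r ^ n * exp (- \<mu> * \<omega> r) \<le> exp (\<mu> * \<omega> 1) * weight_seq \<omega> \<mu> n"
proof (cases "r \<ge> 1")
  case True
  have "r ^ n * exp (- \<mu> * \<omega> r) \<le> 1 * weight_seq \<omega> \<mu> n"
    using weight_seq_lower[OF assms(1) True] by simp
  also have "\<dots> \<le> exp (\<mu> * \<omega> 1) * weight_seq \<omega> \<mu> n"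
    using assms weight_nonneg[of 1] weight_seq_pos[of \<mu> n] by (intro mult_right_mono) auto
  finally show ?thesis .
next
  case False
  have "r ^ n * exp (- \<mu> * \<omega> r) \<le> 1 * 1"
    using False assms weight_nonneg[of r] by (intro mult_mono power_le_one) auto
  also have "\<dots> = exp (\<mu> * \<omega> 1) * (1 ^ n * exp (- \<mu> * \<omega> 1))"
    by (simp flip: exp_add)
  also have "\<dots> \<le> exp (\<mu> * \<omega> 1) * weight_seq \<omega> \<mu> n"
    using weight_seq_lower[OF assms(1), of 1 n] by simp
  finally show ?thesis .
qed

lemma weight_seq_mono:
  assumes "\<mu> > 0" "m \<le> n"
  shows "weight_seq \<omega> \<mu> m \<le> weight_seq \<omega> \<mu> n"
proof (rule weight_seq_upper[OF assms(1)])
  fix r :: real assume r: "r \<ge> 1"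
  have "r ^ m * exp (- \<mu> * \<omega> r) \<le> r ^ n * exp (- \<mu> * \<omega> r)"
    using assms r by (intro mult_right_mono power_increasing) auto
  also have "\<dots> \<le> weight_seq \<omega> \<mu> n" by (rule weight_seq_lower[OF assms(1) r])
  finally show "r ^ m * exp (- \<mu> * \<omega> r) \<le> weight_seq \<omega> \<mu> n" .
qed

text \<open>Move both points to the larger one; the factor that is dropped is at most \<open>1\<close>.\<close>

lemma weight_seq_mult_le:
  assumes mu: "\<mu> > 0"
  shows "weight_seq \<omega> \<mu> m * weight_seq \<omega> \<mu> n \<le> weight_seq \<omega> \<mu> (m + n)"
proof -
  have *: "(r ^ m * exp (- \<mu> * \<omega> r)) * (s ^ n * exp (- \<mu> * \<omega> s)) \<le> weight_seq \<omega> \<mu> (m + n)"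
    if rs: "r \<ge> 1" "s \<ge> 1" for r s
  proof -
    define x where "x = max r s"
    have "r ^ m * s ^ n \<le> x ^ m * x ^ n"
      using rs unfolding x_def by (intro mult_mono power_mono) auto
    moreover have "exp (- \<mu> * \<omega> r) * exp (- \<mu> * \<omega> s) \<le> exp (- \<mu> * \<omega> x)"
      using rs mu weight_nonneg[of r] weight_nonneg[of s]
      unfolding x_def max_def by (simp flip: exp_add)
    ultimately have "(r ^ m * s ^ n) * (exp (- \<mu> * \<omega> r) * exp (- \<mu> * \<omega> s))
        \<le> (x ^ m * x ^ n) * exp (- \<mu> * \<omega> x)"
      by (rule mult_mono) (use rs in \<open>auto simp: x_def\<close>)
    also have "\<dots> \<le> weight_seq \<omega> \<mu> (m + n)"
      using weight_seq_lower[OF mu, of x "m + n"] rs unfolding x_def by (simp add: power_add)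
    finally show ?thesis by (simp add: mult_ac)
  qed
  have "weight_seq \<omega> \<mu> m \<le> weight_seq \<omega> \<mu> (m + n) / (s ^ n * exp (- \<mu> * \<omega> s))" if s: "s \<ge> 1" for s
  proof (rule weight_seq_upper[OF mu])
    fix r :: real assume "r \<ge> 1"
    moreover have "s ^ n * exp (- \<mu> * \<omega> s) > 0" using s by simp
    ultimately show "r ^ m * exp (- \<mu> * \<omega> r) \<le> weight_seq \<omega> \<mu> (m + n) / (s ^ n * exp (- \<mu> * \<omega> s))"
      using *[of r s] s by (simp add: pos_le_divide_eq)
  qed
  then have "weight_seq \<omega> \<mu> n \<le> weight_seq \<omega> \<mu> (m + n) / weight_seq \<omega> \<mu> m"
    using weight_seq_pos[of \<mu> m] by (intro weight_seq_upper[OF mu]) (simp add: field_simps)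
  then show ?thesis using weight_seq_pos[of \<mu> m] by (simp add: field_simps)
qed

text \<open>After a dilation by \<open>K\<close>, which costs \<open>K ^ n\<close>, iterated doubling multiplies the weight by more than
  \<open>\<nu> / \<mu>\<close>.\<close>

lemma weight_seq_equiv:
  assumes "\<mu> > 0" "\<nu> > 0"
  shows "\<exists>A\<ge>1. \<exists>C>0. \<forall>n. weight_seq \<omega> \<mu> n \<le> C * A ^ n * weight_seq \<omega> \<nu> n"
proof -
  obtain j where j: "\<nu> / \<mu> < 2 ^ j" using real_arch_pow[of 2] by auto
  obtain K c where K: "K \<ge> 1" "\<And>t. t \<ge> 0 \<Longrightarrow> 2 ^ j * \<omega> t \<le> \<omega> (K * t) + c"
    using doubling_iterated by blast
  define C where "C = exp (\<mu> * \<bar>c\<bar>) * exp (\<nu> * \<omega> 1)"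
  have "weight_seq \<omega> \<mu> n \<le> C * K ^ n * weight_seq \<omega> \<nu> n" for n
  proof (rule weight_seq_upper[OF assms(1)])
    fix r :: real assume r: "r \<ge> 1"
    define s where "s = r / K"
    have s: "s \<ge> 0" "r = K * s" using r K by (auto simp: s_def)
    have "\<nu> * \<omega> s \<le> (\<mu> * 2 ^ j) * \<omega> s"
      using j assms weight_nonneg[OF s(1)] by (intro mult_right_mono) (auto simp: field_simps)
    also have "\<dots> \<le> \<mu> * (\<omega> r + \<bar>c\<bar>)"
      using K(2)[OF s(1)] assms s(2) by (simp add: mult.assoc)
    finally have "exp (- \<mu> * \<omega> r) \<le> exp (\<mu> * \<bar>c\<bar>) * exp (- \<nu> * \<omega> s)"
      unfolding exp_add[symmetric] by (simp add: algebra_simps)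
    then have "r ^ n * exp (- \<mu> * \<omega> r) \<le> r ^ n * (exp (\<mu> * \<bar>c\<bar>) * exp (- \<nu> * \<omega> s))"
      using r by (intro mult_left_mono) auto
    also have "\<dots> = exp (\<mu> * \<bar>c\<bar>) * K ^ n * (s ^ n * exp (- \<nu> * \<omega> s))"
      unfolding s(2) by (simp add: power_mult_distrib)
    also have "\<dots> \<le> exp (\<mu> * \<bar>c\<bar>) * K ^ n * (exp (\<nu> * \<omega> 1) * weight_seq \<omega> \<nu> n)"
      using K by (intro mult_left_mono weight_seq_lower_all assms s) auto
    finally show "r ^ n * exp (- \<mu> * \<omega> r) \<le> C * K ^ n * weight_seq \<omega> \<nu> n"
      by (simp add: C_def mult_ac)
  qed
  then show ?thesis using K by (intro exI[of _ K] conjI exI[of _ C]) (auto simp: C_def)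
qed

lemma weight_dilate: "\<exists>L>0. \<forall>t\<ge>0. \<omega> (2 ^ j * t) \<le> L * (\<omega> t + 1)"
proof (induction j)
  case 0
  show ?case by (rule exI[of _ 1]) auto
next
  case (Suc j)
  obtain L where L: "L > 0" "\<And>t. t \<ge> 0 \<Longrightarrow> \<omega> (2 * t) \<le> L * (\<omega> t + 1)"
    using weight unfolding weight_function_def by blast
  obtain L' where L': "L' > 0" "\<And>t. t \<ge> 0 \<Longrightarrow> \<omega> (2 ^ j * t) \<le> L' * (\<omega> t + 1)" using Suc by auto
  have "\<omega> (2 ^ Suc j * t) \<le> (L * (L' + 1)) * (\<omega> t + 1)" if t: "t \<ge> 0" for t
  proof -
    have "\<omega> (2 ^ Suc j * t) \<le> L * (\<omega> (2 ^ j * t) + 1)"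
      using L(2)[of "2 ^ j * t"] t by (simp add: mult.assoc)
    also have "\<dots> \<le> L * (L' * (\<omega> t + 1) + (\<omega> t + 1))"
      using L L'(2)[OF t] weight_nonneg[OF t] by (intro mult_left_mono add_mono) auto
    finally show ?thesis by (simp add: algebra_simps)
  qed
  then show ?case using L L' by (intro exI[of _ "L * (L' + 1)"]) auto
qed

text \<open>Condition \<open>(\<alpha>)\<close> bounds the effect on the weight of the dilation by \<open>2 ^ j\<close>, which gains \<open>2 ^ (j * n)\<close>.\<close>

lemma weight_seq_geometric:
  assumes "\<mu> > 0"
  shows "\<exists>\<nu>>0. \<exists>C>0. \<forall>n. A ^ n * weight_seq \<omega> \<nu> n \<le> C * weight_seq \<omega> \<mu> n"
proof -
  obtain j where j: "\<bar>A\<bar> < 2 ^ j" using real_arch_pow[of 2] by auto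
  obtain L where L: "L > 0" "\<And>t. t \<ge> 0 \<Longrightarrow> \<omega> (2 ^ j * t) \<le> L * (\<omega> t + 1)"
    using weight_dilate by auto
  have "A ^ n * weight_seq \<omega> (\<mu> * L) n \<le> exp (\<mu> * L) * weight_seq \<omega> \<mu> n" for n
  proof -
    have "weight_seq \<omega> (\<mu> * L) n \<le> exp (\<mu> * L) * weight_seq \<omega> \<mu> n / (2 ^ j) ^ n"
    proof (rule weight_seq_upper)
      show "\<mu> * L > 0" using assms L by simp
      fix r :: real assume r: "r \<ge> 1"
      have "\<mu> * \<omega> (2 ^ j * r) \<le> \<mu> * (L * (\<omega> r + 1))"
        using assms L(2)[of r] r by (intro mult_left_mono) auto
      then have "exp (- (\<mu> * L) * \<omega> r) \<le> exp (\<mu> * L) * exp (- \<mu> * \<omega> (2 ^ j * r))"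
        unfolding exp_add[symmetric] by (simp add: algebra_simps)
      then have "(2 ^ j * r) ^ n * exp (- (\<mu> * L) * \<omega> r)
          \<le> exp (\<mu> * L) * ((2 ^ j * r) ^ n * exp (- \<mu> * \<omega> (2 ^ j * r)))"
        using r mult_left_mono[of _ _ "(2 ^ j * r) ^ n"] by (simp add: mult_ac)
      also have "\<dots> \<le> exp (\<mu> * L) * weight_seq \<omega> \<mu> n"
        using r by (intro mult_left_mono weight_seq_lower assms)
          (auto intro: order_trans[OF r] simp: mult_ge1_I)
      finally show "r ^ n * exp (- (\<mu> * L) * \<omega> r) \<le> exp (\<mu> * L) * weight_seq \<omega> \<mu> n / (2 ^ j) ^ n"
        by (simp add: pos_le_divide_eq power_mult_distrib mult_ac)
    qed
    then have "(2 ^ j) ^ n * weight_seq \<omega> (\<mu> * L) n \<le> exp (\<mu> * L) * weight_seq \<omega> \<mu> n"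
      by (simp add: pos_le_divide_eq mult.commute)
    moreover have "A ^ n * weight_seq \<omega> (\<mu> * L) n \<le> (2 ^ j) ^ n * weight_seq \<omega> (\<mu> * L) n"
    proof (intro mult_right_mono)
      have "A ^ n \<le> \<bar>A\<bar> ^ n" by (metis abs_ge_self power_abs)
      also have "\<dots> \<le> (2 ^ j) ^ n" using j by (intro power_mono) auto
      finally show "A ^ n \<le> (2 ^ j) ^ n" .
    qed (use weight_seq_pos[of "\<mu> * L" n] in auto)
    ultimately show ?thesis by simp
  qed
  then show ?thesis using assms L by (intro exI[of _ "\<mu> * L"] conjI exI[of _ "exp (\<mu> * L)"]) auto
qed

text \<open>Half of the weight absorbs \<open>r ^ k\<close>, and passing from \<open>\<omega> / 2\<close> back to \<open>\<omega>\<close> costs a geometric factor.\<close>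

lemma weight_seq_shift:
  "\<exists>B\<ge>1. \<exists>C>0. \<forall>n. weight_seq \<omega> 1 (n + k) \<le> C * B ^ n * weight_seq \<omega> 1 n"
proof -
  obtain B C where B: "B \<ge> 1" "C > 0" "\<And>n. weight_seq \<omega> (1/2) n \<le> C * B ^ n * weight_seq \<omega> 1 n"
    using weight_seq_equiv[of "1/2" 1] by auto
  obtain c where c: "c > 0" "\<And>r. r \<ge> 0 \<Longrightarrow> (1 + r) ^ k \<le> c * exp (1/2 * \<omega> r)"
    using power_le_exp_weight[of "1/2" k] by auto
  have "weight_seq \<omega> 1 (n + k) \<le> (c * C) * B ^ n * weight_seq \<omega> 1 n" for n
  proof (rule weight_seq_upper)
    fix r :: real assume r: "r \<ge> 1"
    have "r ^ k \<le> (1 + r) ^ k" using r by (intro power_mono) auto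
    also have "\<dots> \<le> c * exp (1/2 * \<omega> r)" using c r by simp
    finally have rk: "r ^ k \<le> c * exp (1/2 * \<omega> r)" .
    have "r ^ (n + k) * exp (- 1 * \<omega> r) = r ^ n * exp (- 1 * \<omega> r) * r ^ k" by (simp add: power_add)
    also have "\<dots> \<le> r ^ n * exp (- 1 * \<omega> r) * (c * exp (1/2 * \<omega> r))"
      using rk r by (intro mult_left_mono) auto
    also have "\<dots> = c * (r ^ n * exp (- (1/2) * \<omega> r))" by (simp flip: exp_add)
    also have "\<dots> \<le> c * weight_seq \<omega> (1/2) n"
      using c r by (intro mult_left_mono weight_seq_lower) auto
    also have "\<dots> \<le> c * (C * B ^ n * weight_seq \<omega> 1 n)" using B(3) c by (intro mult_left_mono) auto
    finally show "r ^ (n + k) * exp (- 1 * \<omega> r) \<le> (c * C) * B ^ n * weight_seq \<omega> 1 n"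
      by (simp add: mult_ac)
  qed simp
  then show ?thesis using B c by (intro exI[of _ B] conjI exI[of _ "c * C"]) auto
qed

text \<open>\<open>r ^ (2 * n) * exp (- \<omega> r)\<close> is the square of \<open>r ^ n * exp (- \<omega> r / 2)\<close>.\<close>

lemma weight_seq_double:
  "\<exists>B\<ge>1. \<exists>C>0. \<forall>n. weight_seq \<omega> 1 (2 * n) \<le> (C * B ^ n * weight_seq \<omega> 1 n)\<^sup>2"
proof -
  obtain B C where B: "B \<ge> 1" "C > 0" "\<And>n. weight_seq \<omega> (1/2) n \<le> C * B ^ n * weight_seq \<omega> 1 n"
    using weight_seq_equiv[of "1/2" 1] by auto
  have "weight_seq \<omega> 1 (2 * n) \<le> (C * B ^ n * weight_seq \<omega> 1 n)\<^sup>2" for n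
  proof (rule weight_seq_upper)
    fix r :: real assume r: "r \<ge> 1"
    have "r ^ (2 * n) * exp (- 1 * \<omega> r) = (r ^ n * exp (- (1/2) * \<omega> r))\<^sup>2"
      by (simp add: power_mult_distrib power_mult[symmetric] mult.commute flip: exp_double)
    also have "\<dots> \<le> (C * B ^ n * weight_seq \<omega> 1 n)\<^sup>2"
      using r weight_seq_lower[of "1/2" r n] B(3)[of n] by (intro power_mono) auto
    finally show "r ^ (2 * n) * exp (- 1 * \<omega> r) \<le> (C * B ^ n * weight_seq \<omega> 1 n)\<^sup>2" .
  qed simp
  then show ?thesis using B by blast
qed

text \<open>Since \<open>\<omega>(t) = o(t)\<close>, the sequence is at least a constant times the one for the weight \<open>\<eta> * t\<close>, which is
  at least \<open>(k / (\<eta> * exp 1)) ^ k\<close> for \<open>k \<ge> \<eta>\<close>.\<close>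

lemma fact_le_weight_seq:
  assumes A: "A \<ge> 1"
  shows "\<exists>C>0. \<forall>k. fact k * A ^ k \<le> C * weight_seq \<omega> 1 k"
proof -
  define \<eta> where "\<eta> = 1 / (A * exp 1)"
  have "\<eta> > 0" using A by (simp add: \<eta>_def)
  then have "eventually (\<lambda>t. norm (\<omega> t) \<le> \<eta> * norm t) at_top"
    using weight unfolding weight_function_def by (auto dest: landau_o.smallD)
  then obtain T where T: "\<And>t. t \<ge> T \<Longrightarrow> \<bar>\<omega> t\<bar> \<le> \<eta> * \<bar>t\<bar>"
    by (auto simp: eventually_at_top_linorder)
  define c where "c = \<omega> \<bar>T\<bar>"
  have wt: "\<omega> t \<le> \<eta> * t + c" if "t \<ge> 0" for t
  proof (cases "t \<ge> \<bar>T\<bar>")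
    case True
    then show ?thesis using T[of t] that weight_nonneg[of "\<bar>T\<bar>"]
      unfolding c_def by linarith
  next
    case False
    then show ?thesis using weight_mono[of t "\<bar>T\<bar>"] that \<open>\<eta> > 0\<close> by (simp add: c_def add_increasing)
  qed
  have "fact k * A ^ k \<le> (exp c + exp (\<omega> 1)) * weight_seq \<omega> 1 k" for k
  proof (cases "k = 0")
    case True
    have "exp (- \<omega> 1) \<le> weight_seq \<omega> 1 0" using weight_seq_lower[of 1 1 0] by simp
    then have "exp (\<omega> 1) * exp (- \<omega> 1) \<le> exp (\<omega> 1) * weight_seq \<omega> 1 0" by simp
    then have "1 \<le> exp (\<omega> 1) * weight_seq \<omega> 1 0" by (simp flip: exp_add)
    then show ?thesis using True weight_seq_pos[of 1 0] by (simp add: ring_distribs add_increasing)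
  next
    case False
    \<comment> \<open>The point at which \<open>\<eta> * r = k\<close>.\<close>
    define r where "r = real k * A * exp 1"
    have "1 * 1 * 1 \<le> real k * A * exp 1" using False A by (intro mult_mono) auto
    then have r: "r \<ge> 1" by (simp add: r_def)
    have "\<eta> * r = real k" using A by (simp add: \<eta>_def r_def)
    then have w: "\<omega> r \<le> real k + c" using wt[of r] r by simp
    have "fact k * A ^ k \<le> real k ^ k * A ^ k"
    proof (intro mult_right_mono)
      show "(fact k :: real) \<le> real k ^ k" using fact_le_power[of k, where 'a=real] by simp
    qed (use A in simp)
    also have "real k ^ k * A ^ k = exp c * (r ^ k * exp (- (real k + c)))"
    proof -
      have "exp (real k) = exp 1 ^ k" using exp_of_nat_mult[of k "1::real"] by simp
      moreover have "exp (- (real k + c)) = inverse (exp (real k) * exp c)"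
        by (simp only: exp_minus exp_add)
      ultimately show ?thesis unfolding r_def power_mult_distrib
        by (simp only:) (simp add: field_simps)
    qed
    also have "\<dots> \<le> exp c * (r ^ k * exp (- 1 * \<omega> r))"
      using r w by simp
    also have "\<dots> \<le> exp c * weight_seq \<omega> 1 k"
      using weight_seq_lower[OF _ r, of 1 k] by simp
    also have "\<dots> \<le> (exp c + exp (\<omega> 1)) * weight_seq \<omega> 1 k"
      using weight_seq_pos[of 1 k] by simp
    finally show ?thesis .
  qed
  then have "\<forall>k. fact k * A ^ k \<le> (exp c + exp (\<omega> 1)) * weight_seq \<omega> 1 k" ..
  moreover have "0 < exp c + exp (\<omega> 1)" by (rule add_pos_pos) simp_all
  ultimately show ?thesis by blast
qed

end

section \<open>Monomials, partial derivatives and their words\<close>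

text \<open>Multi-indices are replaced by words in the coordinates: derivatives are taken letter by letter, and the
  product rule deletes letters.\<close>

definition mono_word :: "'d list \<Rightarrow> real^'d::finite \<Rightarrow> real" where
  "mono_word js x = prod_list (map (\<lambda>j. x $ j) js)"

lemma mono_word_simps [simp]:
  "mono_word [] x = 1" "mono_word (j # js) x = x $ j * mono_word js x"
  "mono_word (js @ ks) x = mono_word js x * mono_word ks x"
  by (simp_all add: mono_word_def)

lemma continuous_on_mono_word [continuous_intros]:
  "continuous_on A f \<Longrightarrow> continuous_on A (\<lambda>x. mono_word js (f x))"
  by (induction js) (auto intro!: continuous_intros)

lemma abs_mono_word_le: "\<bar>mono_word js x\<bar> \<le> norm x ^ length js"
  by (induction js) (auto simp: abs_mult intro!: mult_mono component_le_norm_cart)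

text \<open>The words that remain after deleting one occurrence of \<open>i\<close>: the terms of the derivative of a
  monomial in direction \<open>i\<close>.\<close>

fun delete_each :: "'d \<Rightarrow> 'd list \<Rightarrow> 'd list list" where
  "delete_each i [] = []"
| "delete_each i (j # js) = (if i = j then [js] else []) @ map ((#) j) (delete_each i js)"

lemma length_delete_each: "length (delete_each i js) \<le> length js"
  by (induction js) auto

lemma length_in_delete_each: "w \<in> set (delete_each i js) \<Longrightarrow> Suc (length w) = length js"
  by (induction js arbitrary: w) (auto split: if_splits)

lemma mono_word_has_derivative:
  "((\<lambda>t. mono_word js (x + t *\<^sub>R axis i 1)) has_real_derivative
     (\<Sum>w\<leftarrow>delete_each i js. mono_word w (x + t *\<^sub>R axis i 1))) (at t)"
proof (induction js)
  case (Cons j js)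
  have a: "((\<lambda>t. (x + t *\<^sub>R axis i 1) $ j) has_real_derivative (if i = j then 1 else 0)) (at t)"
    by (auto simp: axis_def intro!: derivative_eq_intros)
  have "((\<lambda>t. (x + t *\<^sub>R axis i 1) $ j * mono_word js (x + t *\<^sub>R axis i 1)) has_real_derivative
     (if i = j then 1 else 0) * mono_word js (x + t *\<^sub>R axis i 1) +
     (\<Sum>w\<leftarrow>delete_each i js. mono_word w (x + t *\<^sub>R axis i 1)) * (x + t *\<^sub>R axis i 1) $ j) (at t)"
    by (rule DERIV_mult[OF a Cons.IH])
  moreover have "(\<Sum>w\<leftarrow>map ((#) j) ws. mono_word w y) = (\<Sum>w\<leftarrow>ws. mono_word w y) * y $ j"
    for ws and y :: "real^'a"
    by (induction ws) (simp_all add: ring_distribs mult.commute)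
  ultimately show ?case by (cases "i = j") simp_all
qed simp

lemma pderivs_simps [simp]:
  "pderivs [] u = u" "pderivs (i # is) u = pderiv_at i (pderivs is u)"
  "pderivs (is @ js) u = pderivs is (pderivs js u)"
  by (simp_all add: pderivs_def)

lemma smooth_pderivs: "smooth u \<Longrightarrow> smooth (pderivs is u)"
  unfolding smooth_def using pderivs_simps(3) by metis

lemma smooth_continuous: "smooth u \<Longrightarrow> continuous_on A (pderivs is u)"
  unfolding smooth_def using continuous_on_subset by blast

lemma smooth_measurable [measurable]: "smooth u \<Longrightarrow> pderivs is u \<in> borel_measurable borel"
  by (intro borel_measurable_continuous_onI smooth_continuous)

lemma has_vector_derivative_along_axis:
  fixes v :: "real^'d::finite \<Rightarrow> complex"
  assumes "((\<lambda>s. v ((x + t *\<^sub>R axis i 1) + s *\<^sub>R axis i 1)) has_vector_derivative y) (at 0)"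
  shows "((\<lambda>t. v (x + t *\<^sub>R axis i 1)) has_vector_derivative y) (at t)"
proof -
  define g where "g s = v ((x + t *\<^sub>R axis i 1) + s *\<^sub>R axis i 1)" for s
  have "((\<lambda>r. r - t) has_vector_derivative 1) (at t)"
    by (auto intro!: derivative_eq_intros)
  moreover have "(g has_vector_derivative y) (at (t - t))"
    using assms unfolding g_def by simp
  ultimately have "((g \<circ> (\<lambda>r. r - t)) has_vector_derivative (1 *\<^sub>R y)) (at t)"
    by (rule vector_diff_chain_at)
  moreover have "g \<circ> (\<lambda>r. r - t) = (\<lambda>r. v (x + r *\<^sub>R axis i 1))"
    by (auto simp: g_def fun_eq_iff scaleR_left_diff_distrib)
  ultimately show ?thesis by simp
qed

lemma smooth_has_derivative:
  assumes "smooth u"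
  shows "((\<lambda>t. pderivs is u (x + t *\<^sub>R axis i 1)) has_vector_derivative
    pderivs (i # is) u (x + t *\<^sub>R axis i 1)) (at t)"
proof (rule has_vector_derivative_along_axis)
  have "(\<lambda>s. pderivs is u ((x + t *\<^sub>R axis i 1) + s *\<^sub>R axis i 1)) differentiable (at 0)"
    using assms unfolding smooth_def by blast
  then show "((\<lambda>s. pderivs is u ((x + t *\<^sub>R axis i 1) + s *\<^sub>R axis i 1)) has_vector_derivative
      pderivs (i # is) u (x + t *\<^sub>R axis i 1)) (at 0)"
    unfolding pderivs_simps pderiv_at_def by (simp add: vector_derivative_works)
qed

section \<open>Differential operators with polynomial coefficients\<close>

abbreviation mono_deriv :: "'d list \<Rightarrow> 'd list \<Rightarrow> (real^'d::finite \<Rightarrow> complex) \<Rightarrow> real^'d \<Rightarrow> complex" where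
  "mono_deriv js is u x \<equiv> of_real (mono_word js x) * pderivs is u x"

abbreviation L2_square :: "'d list \<Rightarrow> 'd list \<Rightarrow> (real^'d::finite \<Rightarrow> complex) \<Rightarrow> real" where
  "L2_square js is u \<equiv> LINT x|lborel. (cmod (mono_deriv js is u x))\<^sup>2"

text \<open>A finite sum of terms \<open>x\<^bsup>js\<^esup> \<partial>\<^bsup>is\<^esup> u\<close>, given by the list of the pairs \<open>(js, is)\<close>.\<close>

definition op_sum :: "('d list \<times> 'd list) list \<Rightarrow> (real^'d::finite \<Rightarrow> complex) \<Rightarrow> real^'d \<Rightarrow> complex" where
  "op_sum ts u x = (\<Sum>(js, is)\<leftarrow>ts. of_real (mono_word js x) * pderivs is u x)"

text \<open>The terms that the product rule produces from one term.\<close>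

definition diff_term :: "'d \<Rightarrow> 'd list \<times> 'd list \<Rightarrow> ('d list \<times> 'd list) list" where
  "diff_term i t = (fst t, i # snd t) # map (\<lambda>w. (w, snd t)) (delete_each i (fst t))"

definition diff_terms :: "'d \<Rightarrow> ('d list \<times> 'd list) list \<Rightarrow> ('d list \<times> 'd list) list" where
  "diff_terms i ts = concat (map (diff_term i) ts)"

lemma op_sum_simps [simp]:
  "op_sum [] u x = 0"
  "op_sum (t # ts) u x = mono_deriv (fst t) (snd t) u x + op_sum ts u x"
  "op_sum (ts @ ts') u x = op_sum ts u x + op_sum ts' u x"
  by (auto simp: op_sum_def split: prod.splits)

lemma op_sum_has_derivative:
  assumes "smooth u"
  shows "((\<lambda>t. op_sum ts u (x + t *\<^sub>R axis i 1)) has_vector_derivative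
    op_sum (diff_terms i ts) u (x + t *\<^sub>R axis i 1)) (at t)"
proof (induction ts)
  case Nil
  show ?case by (simp add: diff_terms_def)
next
  case (Cons p ts)
  obtain js "is" where p: "p = (js, is)" by (cases p)
  define y where "y = x + t *\<^sub>R axis i 1"
  have a: "((\<lambda>t. of_real (mono_word js (x + t *\<^sub>R axis i 1)) :: complex) has_vector_derivative
     of_real (\<Sum>w\<leftarrow>delete_each i js. mono_word w y)) (at t)"
    using mono_word_has_derivative[of js x i t] unfolding y_def
    by (intro has_vector_derivative_of_real) (simp add: has_real_derivative_iff_has_vector_derivative)
  have "((\<lambda>t. of_real (mono_word js (x + t *\<^sub>R axis i 1)) * pderivs is u (x + t *\<^sub>R axis i 1))
      has_vector_derivative mono_deriv js (i # is) u y
        + of_real (\<Sum>w\<leftarrow>delete_each i js. mono_word w y) * pderivs is u y) (at t)"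
    using has_vector_derivative_mult[OF a smooth_has_derivative[OF assms, of "is" x i t]]
    unfolding y_def by simp
  moreover have "of_real (\<Sum>w\<leftarrow>ws. mono_word w y) * pderivs is u y
      = op_sum (map (\<lambda>w. (w, is)) ws) u y" for ws
    by (induction ws) (auto simp: algebra_simps)
  ultimately have b: "((\<lambda>t. of_real (mono_word js (x + t *\<^sub>R axis i 1)) * pderivs is u (x + t *\<^sub>R axis i 1))
      has_vector_derivative op_sum (diff_term i p) u y) (at t)"
    by (simp add: diff_term_def p)
  show ?case
    using has_vector_derivative_add[OF b Cons.IH] unfolding y_def[symmetric]
    by (simp add: p diff_terms_def)
qed

lemma pderiv_at_op_sum: "smooth u \<Longrightarrow> pderiv_at i (op_sum ts u) = op_sum (diff_terms i ts) u"
  unfolding pderiv_at_def fun_eq_iff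
  using op_sum_has_derivative[of u ts _ i 0] vector_derivative_at by fastforce

lemma pderivs_op_sum: "smooth u \<Longrightarrow> pderivs is (op_sum ts u) = op_sum (foldr diff_terms is ts) u"
  by (induction "is") (auto simp: pderiv_at_op_sum)

lemma continuous_on_op_sum: "smooth u \<Longrightarrow> continuous_on A (op_sum ts u)"
proof (induction ts)
  case (Cons t ts)
  then show ?case unfolding op_sum_simps[abs_def] by (auto intro!: continuous_intros smooth_continuous)
qed (simp add: op_sum_simps[abs_def])

lemma smooth_op_sum:
  assumes u: "smooth u"
  shows "smooth (op_sum ts u)"
  unfolding smooth_def[of "op_sum ts u"]
proof (intro allI conjI)
  fix "is" i x
  show "continuous_on UNIV (pderivs is (op_sum ts u))"
    unfolding pderivs_op_sum[OF u] by (rule continuous_on_op_sum[OF u])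
  show "(\<lambda>t. pderivs is (op_sum ts u) (x + t *\<^sub>R axis i 1)) differentiable (at 0)"
    unfolding pderivs_op_sum[OF u]
    by (rule differentiableI_vector[OF op_sum_has_derivative[OF u]])
qed

lemma foldr_diff_terms:
  "(js', is') \<in> set (foldr diff_terms s [(js, is)]) \<Longrightarrow>
    length js' \<le> length js \<and> length is' \<le> length is + length s \<and>
    length js + length is \<le> length js' + length is' + length s"
proof (induction s arbitrary: js' is')
  case (Cons i s)
  then obtain js0 is0 where t: "(js0, is0) \<in> set (foldr diff_terms s [(js, is)])"
    and "(js', is') \<in> set (diff_term i (js0, is0))"
    by (auto simp: diff_terms_def[of i])
  then have "(js' = js0 \<and> is' = i # is0) \<or> (Suc (length js') = length js0 \<and> is' = is0)"
    by (auto simp: diff_term_def dest: length_in_delete_each)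
  then show ?case using Cons.IH[OF t] by auto
qed auto

lemma length_concat_le: "(\<And>x. x \<in> set xs \<Longrightarrow> length (f x) \<le> k) \<Longrightarrow> length (concat (map f xs)) \<le> k * length xs"
  by (induction xs) (auto intro: add_mono)

lemma length_foldr_diff_terms:
  "length (foldr diff_terms s [(js, is)]) \<le> (1 + length js) ^ length s"
proof (induction s)
  case (Cons i s)
  have "length (diff_terms i (foldr diff_terms s [(js, is)]))
      \<le> (1 + length js) * length (foldr diff_terms s [(js, is)])"
    unfolding diff_terms_def[of i]
  proof (rule length_concat_le)
    fix t assume "t \<in> set (foldr diff_terms s [(js, is)])"
    then have "length (fst t) \<le> length js"
      using foldr_diff_terms[of "fst t" "snd t"] by simp
    then show "length (diff_term i t) \<le> 1 + length js"
      using length_delete_each[of i "fst t"] by (simp add: diff_term_def)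
  qed
  also have "\<dots> \<le> (1 + length js) * (1 + length js) ^ length s"
    by (rule mult_le_mono2[OF Cons.IH])
  finally show ?case by simp
qed simp

section \<open>Symmetry of the partial derivatives\<close>

text \<open>The mean value theorem in direction \<open>i\<close>, then in direction \<open>j\<close>.\<close>

lemma double_difference:
  fixes \<phi> :: "complex \<Rightarrow> real"
  assumes u: "smooth u" and \<phi>: "bounded_linear \<phi>" and h: "h > 0"
  shows "\<exists>s>0. \<exists>t>0. s < h \<and> t < h \<and>
    \<phi> (u (x + h *\<^sub>R axis i 1 + h *\<^sub>R axis j 1)) - \<phi> (u (x + h *\<^sub>R axis i 1))
      - \<phi> (u (x + h *\<^sub>R axis j 1)) + \<phi> (u x)
    = h\<^sup>2 * \<phi> (pderivs [j, i] u (x + s *\<^sub>R axis i 1 + t *\<^sub>R axis j 1))"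
proof -
  have d: "((\<lambda>t. \<phi> (pderivs is u (y + t *\<^sub>R axis k 1))) has_real_derivative
      \<phi> (pderivs (k # is) u (y + t *\<^sub>R axis k 1))) (at t)" for y k t "is"
    unfolding has_real_derivative_iff_has_vector_derivative
    by (rule bounded_linear.has_vector_derivative[OF \<phi> smooth_has_derivative[OF u]])
  \<comment> \<open>The double difference is \<open>G h - G 0\<close>.\<close>
  define G where "G s = \<phi> (u ((x + h *\<^sub>R axis j 1) + s *\<^sub>R axis i 1)) - \<phi> (u (x + s *\<^sub>R axis i 1))" for s
  have "DERIV G s :> \<phi> (pderivs [i] u ((x + h *\<^sub>R axis j 1) + s *\<^sub>R axis i 1))
      - \<phi> (pderivs [i] u (x + s *\<^sub>R axis i 1))" for s
    unfolding G_def using d[of "[]" "x + h *\<^sub>R axis j 1" i s] d[of "[]" x i s]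
    by (intro DERIV_diff) simp_all
  from MVT2[OF h this] obtain s where s: "0 < s" "s < h"
    and G: "G h - G 0 = h * (\<phi> (pderivs [i] u ((x + h *\<^sub>R axis j 1) + s *\<^sub>R axis i 1))
      - \<phi> (pderivs [i] u (x + s *\<^sub>R axis i 1)))"
    by auto
  define F where "F t = \<phi> (pderivs [i] u ((x + s *\<^sub>R axis i 1) + t *\<^sub>R axis j 1))" for t
  have "DERIV F t :> \<phi> (pderivs [j, i] u ((x + s *\<^sub>R axis i 1) + t *\<^sub>R axis j 1))" for t
    unfolding F_def by (rule d)
  from MVT2[OF h this] obtain t where t: "0 < t" "t < h"
    and F: "F h - F 0 = h * \<phi> (pderivs [j, i] u ((x + s *\<^sub>R axis i 1) + t *\<^sub>R axis j 1))"
    by auto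
  have "G h - G 0 = h * (F h - F 0)" unfolding G F_def by (simp add: algebra_simps)
  also have "\<dots> = h\<^sup>2 * \<phi> (pderivs [j, i] u ((x + s *\<^sub>R axis i 1) + t *\<^sub>R axis j 1))"
    unfolding F by (simp add: power2_eq_square)
  finally show ?thesis using s t unfolding G_def by (auto simp: algebra_simps)
qed

text \<open>Both mixed derivatives are limits of the same double difference quotient.\<close>

lemma pderivs_swap:
  fixes u :: "real^'d::finite \<Rightarrow> complex"
  assumes u: "smooth u"
  shows "pderivs [i, j] u x = pderivs [j, i] u x"
proof -
  have eq: "\<phi> (pderivs [i, j] u x) = \<phi> (pderivs [j, i] u x)"
    if \<phi>: "bounded_linear \<phi>" for \<phi> :: "complex \<Rightarrow> real"
  proof (rule ccontr)
    assume ne: "\<phi> (pderivs [i, j] u x) \<noteq> \<phi> (pderivs [j, i] u x)"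
    define e where "e = \<bar>\<phi> (pderivs [i, j] u x) - \<phi> (pderivs [j, i] u x)\<bar> / 2"
    have e: "e > 0" using ne by (simp add: e_def)
    have cont: "continuous_on UNIV (\<lambda>y. \<phi> (pderivs is u y))" for "is"
      by (intro bounded_linear.continuous_on[OF \<phi>] smooth_continuous u)
    have near: "\<exists>d>0. \<forall>y. norm (y - x) < d \<longrightarrow> \<bar>\<phi> (pderivs is u y) - \<phi> (pderivs is u x)\<bar> < e" for "is"
      using cont[of "is"] e unfolding continuous_on_iff dist_norm real_norm_def by auto
    obtain d1 where d1: "d1 > 0" "\<And>y. norm (y - x) < d1 \<Longrightarrow>
        \<bar>\<phi> (pderivs [i, j] u y) - \<phi> (pderivs [i, j] u x)\<bar> < e" using near by blast
    obtain d2 where d2: "d2 > 0" "\<And>y. norm (y - x) < d2 \<Longrightarrow>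
        \<bar>\<phi> (pderivs [j, i] u y) - \<phi> (pderivs [j, i] u x)\<bar> < e" using near by blast
    define h where "h = min d1 d2 / 2"
    have h: "h > 0" "2 * h \<le> d1" "2 * h \<le> d2" using d1 d2 by (auto simp: h_def)
    obtain s t where st: "s > 0" "t > 0" "s < h" "t < h" and 1:
      "\<phi> (u (x + h *\<^sub>R axis i 1 + h *\<^sub>R axis j 1)) - \<phi> (u (x + h *\<^sub>R axis i 1))
      - \<phi> (u (x + h *\<^sub>R axis j 1)) + \<phi> (u x)
      = h\<^sup>2 * \<phi> (pderivs [j, i] u (x + s *\<^sub>R axis i 1 + t *\<^sub>R axis j 1))"
      using double_difference[OF u \<phi> h(1)] by blast
    obtain s' t' where st': "s' > 0" "t' > 0" "s' < h" "t' < h" and 2: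
      "\<phi> (u (x + h *\<^sub>R axis j 1 + h *\<^sub>R axis i 1)) - \<phi> (u (x + h *\<^sub>R axis j 1))
      - \<phi> (u (x + h *\<^sub>R axis i 1)) + \<phi> (u x)
      = h\<^sup>2 * \<phi> (pderivs [i, j] u (x + s' *\<^sub>R axis j 1 + t' *\<^sub>R axis i 1))"
      using double_difference[OF u \<phi> h(1)] by blast
    have comm: "x + h *\<^sub>R axis j 1 + h *\<^sub>R axis i 1 = x + h *\<^sub>R axis i 1 + h *\<^sub>R (axis j 1 :: real^'d)"
      by (simp add: algebra_simps)
    have "h\<^sup>2 * \<phi> (pderivs [j, i] u (x + s *\<^sub>R axis i 1 + t *\<^sub>R axis j 1))
        = h\<^sup>2 * \<phi> (pderivs [i, j] u (x + s' *\<^sub>R axis j 1 + t' *\<^sub>R axis i 1))"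
      using 1 2[unfolded comm] by linarith
    then have same: "\<phi> (pderivs [j, i] u (x + s *\<^sub>R axis i 1 + t *\<^sub>R axis j 1))
        = \<phi> (pderivs [i, j] u (x + s' *\<^sub>R axis j 1 + t' *\<^sub>R axis i 1))"
      using h(1) by simp
    have small: "norm ((x + a *\<^sub>R axis k 1 + b *\<^sub>R axis l 1) - x) < 2 * h"
      if "a > 0" "b > 0" "a < h" "b < h" for a b and k l :: 'd
    proof -
      have "norm ((x + a *\<^sub>R axis k 1 + b *\<^sub>R axis l 1) - x)
          \<le> norm (a *\<^sub>R axis k 1 :: real^'d) + norm (b *\<^sub>R axis l 1 :: real^'d)"
        using norm_triangle_ineq[of "a *\<^sub>R axis k 1 :: real^'d" "b *\<^sub>R axis l 1"]
        by (simp add: algebra_simps)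
      then show ?thesis using that by simp
    qed
    have A: "\<bar>\<phi> (pderivs [j, i] u (x + s *\<^sub>R axis i 1 + t *\<^sub>R axis j 1)) - \<phi> (pderivs [j, i] u x)\<bar> < e"
      by (intro d2 less_le_trans[OF small[OF st]] h)
    have B: "\<bar>\<phi> (pderivs [i, j] u (x + s' *\<^sub>R axis j 1 + t' *\<^sub>R axis i 1)) - \<phi> (pderivs [i, j] u x)\<bar> < e"
      by (intro d1 less_le_trans[OF small[OF st']] h)
    have "2 * e = \<bar>\<phi> (pderivs [i, j] u x) - \<phi> (pderivs [j, i] u x)\<bar>" by (simp add: e_def)
    then show False using A B unfolding same by linarith
  qed
  show ?thesis using eq[OF bounded_linear_Re] eq[OF bounded_linear_Im] by (rule complex_eqI)
qed

lemma pderivs_move: "smooth u \<Longrightarrow> pderivs (xs @ i # ys) u = pderivs (i # xs @ ys) u"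
proof (induction xs)
  case (Cons j xs)
  have "pderivs (j # xs @ i # ys) u = pderiv_at j (pderivs (i # xs @ ys) u)"
    using Cons by simp
  also have "\<dots> = pderivs [j, i] (pderivs (xs @ ys) u)" by simp
  also have "\<dots> = pderivs [i, j] (pderivs (xs @ ys) u)"
    using pderivs_swap[OF smooth_pderivs[OF Cons.prems]] by blast
  finally show ?case by simp
qed simp

text \<open>\<open>D\<close> fixes one word for each multi-index. This lemma transfers the conditions on \<open>D \<alpha> u\<close> to all words,
  in particular to those that arise by prolonging a word.\<close>

lemma pderivs_cong_mset:
  assumes "smooth u" "mset is = mset js"
  shows "pderivs is u = pderivs js u"
  using assms(2)
proof (induction "is" arbitrary: js)
  case (Cons i "is")
  then have "i \<in> set js" by (metis list.set_intros(1) mset_eq_setD)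
  then obtain xs ys where js: "js = xs @ i # ys" by (meson split_list)
  have "mset is = mset (xs @ ys)" using Cons.prems js by simp
  then have "pderivs is u = pderivs (xs @ ys) u" by (rule Cons.IH)
  then have "pderivs (i # is) u = pderivs (i # xs @ ys) u" by simp
  then show ?case using pderivs_move[OF assms(1), of xs i ys] js by simp
qed simp

section \<open>Multi-indices and words\<close>

lemma ex_word_of_multiindex: "\<exists>is. \<forall>i. count_list is i = \<alpha> i" for \<alpha> :: "'d::finite \<Rightarrow> nat"
proof -
  obtain xs :: "'d list" where xs: "set xs = UNIV" "distinct xs"
    using finite_distinct_list[OF finite] by blast
  have rep: "count_list (replicate n k) i = (if i = k then n else 0)" for n and k i :: 'd
    by (induction n) auto
  have "count_list (concat (map (\<lambda>k. replicate (\<alpha> k) k) ys)) i = (if i \<in> set ys then \<alpha> i else 0)"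
    if "distinct ys" for i and ys :: "'d list"
    using that by (induction ys) (auto simp: rep)
  then show ?thesis using xs by (intro exI[of _ "concat (map (\<lambda>k. replicate (\<alpha> k) k) xs)"]) auto
qed

lemma cmod_D_eq:
  assumes "smooth u" "\<And>i. count_list is i = \<alpha> i"
  shows "cmod (D \<alpha> u x) = cmod (pderivs is u x)"
proof -
  define js where "js = (SOME is. \<forall>i. count_list is i = \<alpha> i)"
  have "\<forall>i. count_list js i = \<alpha> i"
    unfolding js_def by (rule someI_ex[OF ex_word_of_multiindex])
  then have "mset js = mset is" using assms(2) by (intro multiset_eqI) (simp add: count_mset)
  then have "pderivs js u = pderivs is u" by (rule pderivs_cong_mset[OF assms(1)])
  then show ?thesis unfolding D_def js_def by (simp add: norm_mult norm_power)
qed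

lemma mi_size_eq_length: "(\<And>i. count_list is i = \<alpha> i) \<Longrightarrow> mi_size \<alpha> = length is"
  unfolding mi_size_def using sum_count_set[of "is" UNIV] by simp

lemma mono_word_eq:
  "(\<And>i. count_list js i = \<beta> i) \<Longrightarrow> (\<Prod>i\<in>UNIV. (x $ i) ^ \<beta> i) = mono_word js x"
proof (induction js arbitrary: \<beta>)
  case Nil
  have "\<beta> = (\<lambda>_. 0)" using Nil by (simp add: fun_eq_iff)
  then show ?case by simp
next
  case (Cons j js)
  have "(\<Prod>i\<in>UNIV. (x $ i) ^ \<beta> i) = (\<Prod>i\<in>UNIV. (x $ i) ^ count_list js i * (if i = j then x $ j else 1))"
    using Cons.prems by (intro prod.cong refl) (auto simp flip: Cons.prems)
  also have "\<dots> = mono_word js x * x $ j"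
    unfolding prod.distrib using Cons.IH[of "count_list js"] by simp
  finally show ?case by simp
qed

lemma pderivs_linear_combination:
  fixes u v :: "real^'d::finite \<Rightarrow> complex"
  assumes "smooth u" "smooth v"
  shows "pderivs is (\<lambda>x. a * u x + b * v x) = (\<lambda>x. a * pderivs is u x + b * pderivs is v x)"
    and "smooth (\<lambda>x. a * u x + b * v x)"
proof -
  have d: "((\<lambda>t. a * pderivs is u (x + t *\<^sub>R axis i 1) + b * pderivs is v (x + t *\<^sub>R axis i 1))
      has_vector_derivative a * pderivs (i # is) u x + b * pderivs (i # is) v x) (at 0)" for i "is" x
    using smooth_has_derivative[OF assms(1), of "is" x i 0] smooth_has_derivative[OF assms(2), of "is" x i 0]
    by (intro has_vector_derivative_add has_vector_derivative_mult_right) simp_all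
  show *: "pderivs is (\<lambda>x. a * u x + b * v x) = (\<lambda>x. a * pderivs is u x + b * pderivs is v x)" for "is"
  proof (induction "is")
    case (Cons i "is")
    then show ?case using vector_derivative_at[OF d[of "is" _ i]] by (simp add: pderiv_at_def fun_eq_iff)
  qed simp
  show "smooth (\<lambda>x. a * u x + b * v x)"
    unfolding smooth_def *
    by (intro allI conjI continuous_intros smooth_continuous assms differentiableI_vector[OF d])
qed

section \<open>Integrals on \<open>\<real>\<^sup>d\<close>\<close>

lemma
  fixes f :: "'d::finite \<Rightarrow> real \<Rightarrow> 'b::{real_normed_field,banach,second_countable_topology}"
  assumes f: "\<And>i. integrable lborel (f i)"
  shows integrable_vec_prod: "integrable lborel (\<lambda>x::real^'d. \<Prod>i\<in>UNIV. f i (x $ i))"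
    and integral_vec_prod: "(LINT x|lborel. (\<Prod>i\<in>UNIV. f i ((x::real^'d) $ i))) = (\<Prod>i\<in>UNIV. (LINT s|lborel. f i s))"
proof -
  interpret product_sigma_finite "\<lambda>_. lborel :: real measure"
    by standard
  define ix :: "real^'d \<Rightarrow> 'd" where "ix = inv (\<lambda>i. axis i 1)"
  have inj: "inj (\<lambda>i::'d. axis i (1::real))" by (auto simp: inj_on_def axis_eq_axis)
  have ix [simp]: "ix (axis i 1) = i" for i unfolding ix_def by (rule inv_f_f[OF inj])
  have Basis: "(Basis :: (real^'d) set) = (\<lambda>i. axis i 1) ` UNIV"
    by (auto simp: Basis_vec_def)
  define T where "T g = (\<Sum>b\<in>Basis. g b *\<^sub>R b)" for g :: "real^'d \<Rightarrow> real"
  have T: "T g $ i = g (axis i 1)" for g i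
  proof -
    have "T g $ i = T g \<bullet> axis i 1" by (simp add: cart_eq_inner_axis)
    also have "\<dots> = (\<Sum>b\<in>Basis. g b * (b \<bullet> axis i 1))" by (simp add: T_def inner_sum_left)
    also have "\<dots> = (\<Sum>b\<in>Basis. if b = axis i 1 then g b else 0)"
      by (intro sum.cong refl) (auto simp: inner_Basis axis_in_Basis_iff)
    finally show ?thesis by (simp add: axis_in_Basis_iff)
  qed
  have prod: "(\<Prod>i\<in>UNIV. F i (g (axis i 1))) = (\<Prod>b\<in>Basis. F (ix b) (g b))"
    for g :: "real^'d \<Rightarrow> 'c" and F :: "'d \<Rightarrow> 'c \<Rightarrow> 'b"
    unfolding Basis by (subst prod.reindex[OF inj]) simp
  have leb: "(lborel :: (real^'d) measure) = distr (\<Pi>\<^sub>M b\<in>Basis. lborel) borel T"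
    unfolding T_def by (rule lborel_eq)
  have [measurable]: "T \<in> (\<Pi>\<^sub>M b\<in>Basis. lborel) \<rightarrow>\<^sub>M borel"
    unfolding T_def by measurable
  have [measurable]: "f i \<in> borel_measurable borel" for i
    using borel_measurable_integrable[OF f] by simp
  have meas: "(\<lambda>x::real^'d. \<Prod>i\<in>UNIV. f i (x $ i)) \<in> borel_measurable borel" by measurable
  have "integrable (\<Pi>\<^sub>M b\<in>Basis. lborel) (\<lambda>g. \<Prod>i\<in>UNIV. f i (T g $ i))"
    unfolding T prod[of f] by (rule product_integrable_prod) (auto intro: f)
  then show "integrable lborel (\<lambda>x::real^'d. \<Prod>i\<in>UNIV. f i (x $ i))"
    unfolding leb by (subst integrable_distr_eq) (use meas in auto)
  have "(LINT x|lborel. (\<Prod>i\<in>UNIV. f i ((x::real^'d) $ i)))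
      = (LINT g|(\<Pi>\<^sub>M b\<in>Basis. lborel). (\<Prod>i\<in>UNIV. f i (T g $ i)))"
    unfolding leb by (subst integral_distr) (use meas in auto)
  also have "\<dots> = (\<Prod>b\<in>Basis. (LINT s|lborel. f (ix b) s))"
    unfolding T prod[of f] by (rule product_integral_prod) (auto intro: f)
  also have "\<dots> = (\<Prod>i\<in>UNIV. (LINT s|lborel. f i s))"
    unfolding Basis by (subst prod.reindex[OF inj]) simp
  finally show "(LINT x|lborel. (\<Prod>i\<in>UNIV. f i ((x::real^'d) $ i))) = (\<Prod>i\<in>UNIV. (LINT s|lborel. f i s))" .
qed

lemma
  fixes f :: "'a::euclidean_space \<Rightarrow> 'b::{banach,second_countable_topology}"
  assumes f: "integrable lborel f" and c: "c \<noteq> 0"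
  shows integrable_affine: "integrable lborel (\<lambda>x. f (t + c *\<^sub>R x))"
    and integral_affine: "(LINT x|lborel. f x) = \<bar>c\<bar> ^ DIM('a) *\<^sub>R (LINT x|lborel. f (t + c *\<^sub>R x))"
proof -
  have [measurable]: "f \<in> borel_measurable borel" using borel_measurable_integrable[OF f] by simp
  let ?D = "distr lborel borel (\<lambda>x. t + c *\<^sub>R x)"
  have leb: "(lborel :: 'a measure) = density ?D (\<lambda>_. ennreal (\<bar>c\<bar> ^ DIM('a)))"
    using lborel_affine[OF c, of t] by (simp add: ennreal_power)
  have "integrable (density ?D (\<lambda>_. ennreal (\<bar>c\<bar> ^ DIM('a)))) f" using f leb by simp
  then have "integrable ?D (\<lambda>x. \<bar>c\<bar> ^ DIM('a) *\<^sub>R f x)"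
    by (subst (asm) integrable_density) auto
  then have "integrable ?D (\<lambda>x. (1 / \<bar>c\<bar> ^ DIM('a)) *\<^sub>R (\<bar>c\<bar> ^ DIM('a) *\<^sub>R f x))"
    by (rule integrable_scaleR_right)
  then have "integrable ?D f" using c by simp
  then show "integrable lborel (\<lambda>x. f (t + c *\<^sub>R x))"
    by (subst (asm) integrable_distr_eq) auto
  have "(LINT x|lborel. f x) = (LINT x|density ?D (\<lambda>_. ennreal (\<bar>c\<bar> ^ DIM('a))). f x)"
    using leb by simp
  also have "\<dots> = \<bar>c\<bar> ^ DIM('a) *\<^sub>R (LINT x|?D. f x)"
    by (subst integral_density) auto
  also have "(LINT x|?D. f x) = (LINT x|lborel. f (t + c *\<^sub>R x))"
    by (subst integral_distr) auto
  finally show "(LINT x|lborel. f x) = \<bar>c\<bar> ^ DIM('a) *\<^sub>R (LINT x|lborel. f (t + c *\<^sub>R x))" .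
qed

text \<open>Its inverse is integrable and it is itself a sum of monomials, so bounds on products with monomials
  yield integrability.\<close>

definition poly_weight :: "real^'d::finite \<Rightarrow> real" where
  "poly_weight x = (\<Prod>i\<in>UNIV. 1 + (x $ i)\<^sup>2)"

lemma poly_weight_ge_1: "1 \<le> poly_weight x"
  unfolding poly_weight_def by (rule prod_ge_1) simp

lemma poly_weight_pos: "0 < poly_weight x"
  using poly_weight_ge_1[of x] by linarith

lemma continuous_on_poly_weight [continuous_intros]: "continuous_on A poly_weight"
  unfolding poly_weight_def by (intro continuous_intros)

lemma poly_weight_measurable [measurable]: "poly_weight \<in> borel_measurable borel"
  by (intro borel_measurable_continuous_onI continuous_on_poly_weight)

lemma integrable_inverse_poly_weight: "integrable lborel (\<lambda>x::real^'d::finite. 1 / poly_weight x)"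
proof -
  have "integrable lborel (\<lambda>s::real. inverse (1 + s\<^sup>2))"
    using integrable_inverse_1_plus_square
    by (simp add: set_integrable_def)
  then have "integrable lborel (\<lambda>x::real^'d. \<Prod>i\<in>UNIV. inverse (1 + (x $ i)\<^sup>2))"
    by (rule integrable_vec_prod)
  then show ?thesis unfolding poly_weight_def by (simp add: divide_inverse prod_inversef[symmetric] comp_def)
qed

lemma integrable_poly_weight_bound:
  fixes f :: "real^'d::finite \<Rightarrow> 'b::{banach,second_countable_topology}"
  assumes "f \<in> borel_measurable borel" "\<And>x. norm (f x) \<le> C / poly_weight x"
  shows "integrable lborel f"
proof (rule Bochner_Integration.integrable_bound)
  show "integrable lborel (\<lambda>x::real^'d. C * (1 / poly_weight x))"
    by (intro integrable_mult_right integrable_inverse_poly_weight)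
  show "AE x in lborel. norm (f x) \<le> norm (C * (1 / poly_weight x))"
  proof (rule AE_I2)
    fix x
    have "norm (f x) \<le> C * (1 / poly_weight x)" using assms(2)[of x] by simp
    then show "norm (f x) \<le> norm (C * (1 / poly_weight x))"
      using abs_ge_self order_trans unfolding real_norm_def by blast
  qed
qed (use assms in simp)

lemma poly_weight_words:
  obtains W :: "'d::finite list list" where "\<And>w. w \<in> set W \<Longrightarrow> length w \<le> 2 * CARD('d)"
    and "\<And>x. poly_weight x = (\<Sum>w\<leftarrow>W. mono_word w x)"
proof -
  have "\<exists>W. (\<forall>w\<in>set W. length w \<le> 2 * card A) \<and>
      (\<forall>x::real^'d. (\<Prod>i\<in>A. 1 + (x $ i)\<^sup>2) = (\<Sum>w\<leftarrow>W. mono_word w x))" for A :: "'d set"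
  proof (induction A rule: infinite_finite_induct)
    case (insert i A)
    then obtain W where W: "\<forall>w\<in>set W. length w \<le> 2 * card A"
      "\<And>x::real^'d. (\<Prod>i\<in>A. 1 + (x $ i)\<^sup>2) = (\<Sum>w\<leftarrow>W. mono_word w x)" by auto
    have "(\<Sum>w\<leftarrow>map (\<lambda>w. i # i # w) V. mono_word w x) = (x $ i)\<^sup>2 * (\<Sum>w\<leftarrow>V. mono_word w x)"
      for V and x :: "real^'d"
      by (induction V) (auto simp: algebra_simps power2_eq_square)
    then have "\<forall>x::real^'d. (\<Prod>i\<in>insert i A. 1 + (x $ i)\<^sup>2)
        = (\<Sum>w\<leftarrow>W @ map (\<lambda>w. i # i # w) W. mono_word w x)"
      using insert.hyps by (simp add: W(2) algebra_simps)
    moreover have "\<forall>w\<in>set (W @ map (\<lambda>w. i # i # w) W). length w \<le> 2 * card (insert i A)"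
      using W(1) insert.hyps by auto
    ultimately show ?case by blast
  qed (auto intro: exI[of _ "[[]]"])
  from this[of UNIV] that show ?thesis unfolding poly_weight_def by blast
qed

text \<open>This makes a bound on a derivative dominate the difference quotients.\<close>

lemma poly_weight_shift:
  fixes x :: "real^'d::finite"
  assumes "\<bar>s\<bar> \<le> 1"
  shows "poly_weight x \<le> 4 * poly_weight (x + s *\<^sub>R axis i 1)"
proof -
  define y where "y = x + s *\<^sub>R axis i 1"
  have y: "y $ j = (if j = i then x $ i + s else x $ j)" for j
    by (auto simp: y_def axis_def)
  have pw: "poly_weight z = (1 + (z $ i)\<^sup>2) * (\<Prod>j\<in>UNIV - {i}. 1 + (z $ j)\<^sup>2)" for z :: "real^'d"
    unfolding poly_weight_def by (rule prod.remove) auto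
  have "(x $ i)\<^sup>2 = ((x $ i + s) - s)\<^sup>2" by simp
  also have "\<dots> \<le> 2 * (x $ i + s)\<^sup>2 + 2 * s\<^sup>2"
    using zero_le_power2[of "(x $ i + s) + s"] by (simp add: power2_eq_square algebra_simps)
  also have "\<dots> \<le> 2 * (x $ i + s)\<^sup>2 + 2" using assms by (simp add: abs_square_le_1)
  finally have "(x $ i)\<^sup>2 \<le> 2 * (x $ i + s)\<^sup>2 + 2" .
  moreover have "1 + a \<le> 4 * (1 + q)" if "a \<le> 2 * q + 2" "0 \<le> q" for a q :: real
    using that by simp
  ultimately have "1 + (x $ i)\<^sup>2 \<le> 4 * (1 + (x $ i + s)\<^sup>2)" using zero_le_power2 by blast
  then have "poly_weight x \<le> (4 * (1 + (x $ i + s)\<^sup>2)) * (\<Prod>j\<in>UNIV - {i}. 1 + (x $ j)\<^sup>2)"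
    unfolding pw by (intro mult_right_mono prod_nonneg) auto
  also have "\<dots> = 4 * poly_weight y"
  proof -
    have "(\<Prod>j\<in>UNIV - {i}. 1 + (y $ j)\<^sup>2) = (\<Prod>j\<in>UNIV - {i}. 1 + (x $ j)\<^sup>2)"
      by (intro prod.cong refl) (simp add: y)
    then show ?thesis unfolding pw[of y] by (simp add: y)
  qed
  finally show ?thesis unfolding y_def .
qed

text \<open>Integration by parts is the invariance of the integral under translations, passed to the limit
  in the difference quotient.\<close>

lemma integral_derivative_eq_0:
  fixes w w' :: "real^'d::finite \<Rightarrow> complex"
  assumes deriv: "\<And>x t. ((\<lambda>t. w (x + t *\<^sub>R axis i 1)) has_vector_derivative w' (x + t *\<^sub>R axis i 1)) (at t)"
    and w: "integrable lborel w" and w': "\<And>x. cmod (w' x) \<le> C / poly_weight x"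
    and [measurable]: "w' \<in> borel_measurable borel"
  shows "(LINT x|lborel. w' x) = 0"
proof -
  have [measurable]: "w \<in> borel_measurable borel" using borel_measurable_integrable[OF w] by simp
  define h where "h n = inverse (real (Suc n))" for n
  have h: "h n > 0" "h n \<le> 1" for n by (auto simp: h_def inverse_le_1_iff)
  define s where "s n x = (w (x + h n *\<^sub>R axis i 1) - w x) / of_real (h n)" for n x
  have w_shift: "integrable lborel (\<lambda>x. w (x + a))" "(LINT x|lborel. w (x + a)) = (LINT x|lborel. w x)" for a
    using integrable_affine[OF w, of 1 a] integral_affine[OF w, of 1 a] by (simp_all add: add.commute)
  have "0 \<le> C / poly_weight (0 :: real^'d)" using w'[of 0] norm_ge_zero order_trans by blast
  then have C0: "0 \<le> C" using poly_weight_pos[of "0 :: real^'d"] by (simp add: zero_le_divide_iff)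
  have "(\<lambda>n. LINT x|lborel. s n x) \<longlonglongrightarrow> (LINT x|lborel. w' x)"
  proof (rule integral_dominated_convergence[where w="\<lambda>x. 4 * C * (1 / poly_weight x)"])
    show "integrable lborel (\<lambda>x::real^'d. 4 * C * (1 / poly_weight x))"
      by (intro integrable_mult_right integrable_inverse_poly_weight)
    show "AE x in lborel. (\<lambda>n. s n x) \<longlonglongrightarrow> w' x"
    proof (rule AE_I2)
      fix x
      have "((\<lambda>t. w (x + t *\<^sub>R axis i 1)) has_derivative (\<lambda>t. t *\<^sub>R w' x)) (at 0)"
        using deriv[of x 0] unfolding has_vector_derivative_def by simp
      then have "((\<lambda>t. cmod (w (x + t *\<^sub>R axis i 1) - w x - t *\<^sub>R w' x) / norm t) \<longlongrightarrow> 0) (at 0)"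
        unfolding has_derivative_at by simp
      moreover have "filterlim h (at 0) sequentially"
        unfolding filterlim_at
      proof (intro conjI always_eventually allI)
        show "h n \<in> UNIV" "h n \<noteq> 0" for n using h(1)[of n] by auto
        show "h \<longlonglongrightarrow> 0" unfolding h_def[abs_def] by (rule LIMSEQ_inverse_real_of_nat)
      qed
      ultimately have "(\<lambda>n. cmod (w (x + h n *\<^sub>R axis i 1) - w x - h n *\<^sub>R w' x) / norm (h n)) \<longlonglongrightarrow> 0"
        by (rule filterlim_compose)
      moreover have "cmod (w (x + h n *\<^sub>R axis i 1) - w x - h n *\<^sub>R w' x) / norm (h n) = cmod (s n x - w' x)" for n
      proof -
        have "s n x - w' x = (w (x + h n *\<^sub>R axis i 1) - w x - h n *\<^sub>R w' x) / of_real (h n)"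
          using h(1)[of n] by (simp add: s_def diff_divide_distrib scaleR_conv_of_real)
        then show ?thesis by (simp add: norm_divide)
      qed
      ultimately have "(\<lambda>n. cmod (s n x - w' x)) \<longlonglongrightarrow> 0" by simp
      then show "(\<lambda>n. s n x) \<longlonglongrightarrow> w' x" using LIM_zero_iff tendsto_norm_zero_iff by blast
    qed
    show "AE x in lborel. norm (s n x) \<le> 4 * C * (1 / poly_weight x)" for n
    proof (rule AE_I2)
      fix x
      define g where "g t = w (x + t *\<^sub>R axis i 1)" for t
      have g: "(g has_derivative (\<lambda>t. t *\<^sub>R w' (x + r *\<^sub>R axis i 1))) (at r)" for r
        using deriv[of x r] unfolding g_def has_vector_derivative_def .
      have "\<exists>r\<in>{0<..<h n}. norm (g (h n) - g 0) \<le> norm ((h n - 0) *\<^sub>R w' (x + r *\<^sub>R axis i 1))"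
        using g h[of n] by (intro mvt_general)
          (auto intro!: continuous_at_imp_continuous_on has_derivative_continuous)
      then obtain r where r: "0 < r" "r < h n"
        and le: "cmod (g (h n) - g 0) \<le> h n * cmod (w' (x + r *\<^sub>R axis i 1))"
        using h(1)[of n] by auto
      have "cmod (w' (x + r *\<^sub>R axis i 1)) \<le> C / poly_weight (x + r *\<^sub>R axis i 1)" by (rule w')
      also have "\<dots> \<le> C / (poly_weight x / 4)"
        using poly_weight_shift[of r x i] r h(2)[of n] C0 poly_weight_pos[of x]
        by (intro divide_left_mono) (auto intro!: mult_pos_pos poly_weight_pos)
      finally have "cmod (w' (x + r *\<^sub>R axis i 1)) \<le> 4 * C * (1 / poly_weight x)"
        by (simp add: mult.commute)
      then have "cmod (g (h n) - g 0) \<le> h n * (4 * C * (1 / poly_weight x))"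
        using le h(1)[of n] by (intro order_trans[OF le] mult_left_mono) auto
      then show "norm (s n x) \<le> 4 * C * (1 / poly_weight x)"
        using h(1)[of n] unfolding s_def g_def by (simp add: norm_divide field_simps)
    qed
    show "s n \<in> borel_measurable lborel" for n unfolding s_def by measurable
  qed (simp)
  moreover have "(LINT x|lborel. s n x) = 0" for n
    unfolding s_def using w_shift w by simp
  ultimately show ?thesis using LIMSEQ_unique[OF _ tendsto_const[of 0]] by simp
qed


section \<open>Rapidly decreasing functions and the Fourier transform\<close>

text \<open>The Schwartz space.\<close>

definition rapid :: "(real^'d::finite \<Rightarrow> complex) \<Rightarrow> bool" where
  "rapid u \<longleftrightarrow> smooth u \<and>
     (\<forall>is js. \<exists>C. \<forall>x. cmod (mono_deriv js is u x) \<le> C)"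

lemma rapid_smooth: "rapid u \<Longrightarrow> smooth u" by (simp add: rapid_def)

lemma poly_weight_cmod_le:
  assumes "\<And>x. poly_weight x = (\<Sum>w\<leftarrow>W. mono_word w x)"
  shows "poly_weight x * cmod z \<le> (\<Sum>w\<leftarrow>W. cmod (of_real (mono_word w x) * z))"
proof -
  have "cmod (\<Sum>w\<leftarrow>V. of_real (mono_word w x) * z) \<le> (\<Sum>w\<leftarrow>V. cmod (of_real (mono_word w x) * z))" for V
    by (induction V) (auto intro: order_trans[OF norm_triangle_ineq])
  moreover have "(\<Sum>w\<leftarrow>V. of_real (mono_word w x) * z) = of_real (\<Sum>w\<leftarrow>V. mono_word w x) * z" for V
    by (induction V) (auto simp: algebra_simps)
  ultimately have "cmod (of_real (poly_weight x) * z) \<le> (\<Sum>w\<leftarrow>W. cmod (of_real (mono_word w x) * z))"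
    unfolding assms by metis
  then show ?thesis using poly_weight_pos[of x] by (simp add: norm_mult)
qed

lemma sum_list_le_const:
  fixes f :: "'a \<Rightarrow> real"
  assumes "\<And>w. w \<in> set W \<Longrightarrow> f w \<le> C"
  shows "(\<Sum>w\<leftarrow>W. f w) \<le> real (length W) * C"
  using assms by (induction W) (auto simp: algebra_simps add_mono)

lemma rapid_bound:
  assumes "rapid u"
  obtains C where "C > 0" "\<And>x. cmod (mono_deriv js is u x) \<le> C / poly_weight x"
proof -
  obtain W where W: "\<And>x::real^'a. poly_weight x = (\<Sum>w\<leftarrow>W. mono_word w x)"
    using poly_weight_words by metis
  have "\<exists>C. \<forall>w\<in>set V. \<forall>x. cmod (of_real (mono_word w x) * (mono_deriv js is u x)) \<le> C" for V
  proof (induction V)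
    case (Cons w V)
    then obtain C where C: "\<And>w x. w \<in> set V \<Longrightarrow> cmod (of_real (mono_word w x) * (mono_deriv js is u x)) \<le> C"
      by blast
    obtain C' where C': "\<And>x. cmod (mono_deriv (w @ js) is u x) \<le> C'"
      using assms unfolding rapid_def by blast
    have "cmod (of_real (mono_word v x) * (mono_deriv js is u x)) \<le> max C C'"
      if "v \<in> set (w # V)" for v x
      using that C[of v x] C'[of x] by (auto simp: mult.assoc)
    then show ?case by blast
  qed simp
  then obtain C where C: "\<And>w x. w \<in> set W \<Longrightarrow> cmod (of_real (mono_word w x) * (mono_deriv js is u x)) \<le> C"
    by blast
  define K where "K = \<bar>real (length W) * C\<bar> + 1"
  have "cmod (mono_deriv js is u x) \<le> K / poly_weight x" for x
  proof -
    have "poly_weight x * cmod (mono_deriv js is u x) \<le> real (length W) * C"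
      by (rule order_trans[OF poly_weight_cmod_le[OF W] sum_list_le_const[OF C]])
    also have "\<dots> \<le> K" by (simp add: K_def)
    finally show ?thesis using poly_weight_pos[of x] by (simp add: pos_le_divide_eq mult.commute)
  qed
  moreover have "K > 0" by (simp add: K_def)
  ultimately show ?thesis using that by blast
qed

lemma op_sum_bound:
  assumes "rapid u"
  obtains C where "C > 0" "\<And>x. cmod (op_sum ts u x) \<le> C / poly_weight x"
proof -
  have "\<exists>C>0. \<forall>x. cmod (op_sum ts u x) \<le> C / poly_weight x"
  proof (induction ts)
    case Nil
    show ?case by (intro exI[of _ 1]) (auto simp: less_imp_le[OF poly_weight_pos])
  next
    case (Cons t ts)
    then obtain C where C: "C > 0" "\<And>x. cmod (op_sum ts u x) \<le> C / poly_weight x" by auto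
    obtain C' where C': "C' > 0"
      "\<And>x. cmod (mono_deriv (fst t) (snd t) u x) \<le> C' / poly_weight x"
      using rapid_bound[OF assms] by metis
    have "cmod (op_sum (t # ts) u x) \<le> (C' + C) / poly_weight x" for x
      using norm_triangle_le[OF add_mono[OF C'(2)[of x] C(2)[of x]]] by (simp add: add_divide_distrib)
    then show ?case using C C' by (intro exI[of _ "C' + C"]) auto
  qed
  then show ?thesis using that by blast
qed

lemma mono_word_op_sum: "of_real (mono_word js x) * op_sum ts u x = op_sum (map (\<lambda>(ks, is). (js @ ks, is)) ts) u x"
  by (induction ts) (auto simp: algebra_simps)

lemma rapid_op_sum:
  assumes "rapid u"
  shows "rapid (op_sum ts u)"
  unfolding rapid_def
proof (intro conjI allI)
  show "smooth (op_sum ts u)" by (intro smooth_op_sum rapid_smooth assms)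
  fix "is" js
  define ts' where "ts' = map (\<lambda>(ks, is). (js @ ks, is)) (foldr diff_terms is ts)"
  obtain C where C: "C > 0" "\<And>x. cmod (op_sum ts' u x) \<le> C / poly_weight x"
    using op_sum_bound[OF assms] by metis
  have "cmod (of_real (mono_word js x) * pderivs is (op_sum ts u) x) \<le> C" for x
  proof -
    have "cmod (op_sum ts' u x) \<le> C / poly_weight x" by (rule C)
    also have "\<dots> \<le> C / 1" using C poly_weight_ge_1[of x] by (intro divide_left_mono) auto
    finally show ?thesis
      unfolding ts'_def pderivs_op_sum[OF rapid_smooth[OF assms]] mono_word_op_sum[symmetric] by simp
  qed
  then show "\<exists>C. \<forall>x. cmod (of_real (mono_word js x) * pderivs is (op_sum ts u) x) \<le> C" by blast
qed

lemma pderivs_eq_op_sum: "pderivs is u = op_sum [([], is)] u"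
  by (simp add: fun_eq_iff)

lemma rapid_pderivs: "rapid u \<Longrightarrow> rapid (pderivs is u)"
  unfolding pderivs_eq_op_sum by (rule rapid_op_sum)

lemma smooth_imp_measurable: "smooth u \<Longrightarrow> u \<in> borel_measurable borel"
  using smooth_measurable[of u "[]"] by simp

lemma rapid_integrable: "rapid u \<Longrightarrow> integrable lborel u"
proof -
  assume u: "rapid u"
  obtain C where "\<And>x. cmod (mono_deriv [] [] u x) \<le> C / poly_weight x"
    using rapid_bound[OF u] by metis
  then show ?thesis
    using smooth_imp_measurable[OF rapid_smooth[OF u]] by (intro integrable_poly_weight_bound[of u C]) auto
qed

lemma fourier_pderiv_at:
  assumes u: "rapid u"
  shows "fourier (pderiv_at i u) \<xi> = \<i> * of_real (\<xi> $ i) * fourier u \<xi>"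
proof -
  define e where "e x = exp (- (\<i> * of_real (x \<bullet> \<xi>)))" for x
  have norm_e: "cmod (e x) = 1" for x by (simp add: e_def norm_exp_eq_Re)
  have [measurable]: "e \<in> borel_measurable borel"
    unfolding e_def by (intro borel_measurable_continuous_onI continuous_intros)
  have [measurable]: "u \<in> borel_measurable borel" "pderiv_at i u \<in> borel_measurable borel"
    using smooth_imp_measurable[OF rapid_smooth[OF u]] smooth_measurable[OF rapid_smooth[OF u], of "[i]"] by auto
  have int: "integrable lborel (\<lambda>x. e x * v x)" if "integrable lborel v" for v :: "_ \<Rightarrow> complex"
    using borel_measurable_integrable[OF that]
    by (intro Bochner_Integration.integrable_bound[OF that]) (auto simp: norm_mult norm_e)
  have iu: "integrable lborel u" "integrable lborel (pderiv_at i u)"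
    using rapid_integrable[OF u] rapid_integrable[OF rapid_pderivs[OF u, of "[i]"]] by auto
  define w' where "w' x = e x * pderiv_at i u x + (- \<i> * of_real (\<xi> $ i)) * (e x * u x)" for x
  have der_e: "((\<lambda>t. e (x + t *\<^sub>R axis i 1)) has_vector_derivative
      (- \<i> * of_real (\<xi> $ i)) * e (x + t *\<^sub>R axis i 1)) (at t)" for x t
  proof -
    have eq: "(x + t *\<^sub>R axis i 1) \<bullet> \<xi> = x \<bullet> \<xi> + t * \<xi> $ i" for t
      by (simp add: inner_add_right cart_eq_inner_axis inner_commute)
    define F where "F z = exp (- (\<i> * (of_real (x \<bullet> \<xi>) + z * of_real (\<xi> $ i))))" for z
    have "(F has_field_derivative (- \<i> * of_real (\<xi> $ i)) * F (of_real t)) (at (of_real t))"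
      unfolding F_def by (auto intro!: derivative_eq_intros)
    from has_vector_derivative_real_field[OF this, of UNIV]
    show ?thesis unfolding e_def eq F_def by simp
  qed
  obtain C where C: "\<And>x. cmod (mono_deriv [] [i] u x) \<le> C / poly_weight x"
      using rapid_bound[OF u] by metis
  obtain C' where C': "\<And>x. cmod (mono_deriv [] [] u x) \<le> C' / poly_weight x"
      using rapid_bound[OF u] by metis
  have "(LINT x|lborel. w' x) = 0"
  proof (rule integral_derivative_eq_0[where C="C + \<bar>\<xi> $ i\<bar> * C'"])
    show "((\<lambda>t. e (x + t *\<^sub>R axis i 1) * u (x + t *\<^sub>R axis i 1)) has_vector_derivative
        w' (x + t *\<^sub>R axis i 1)) (at t)" for x t
      using has_vector_derivative_mult[OF der_e smooth_has_derivative[OF rapid_smooth[OF u], of "[]" x i t]]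
      by (simp add: w'_def algebra_simps)
    show "integrable lborel (\<lambda>x. e x * u x)" by (rule int[OF iu(1)])
    show "cmod (w' x) \<le> (C + \<bar>\<xi> $ i\<bar> * C') / poly_weight x" for x
    proof -
      have "cmod (w' x) \<le> cmod (pderiv_at i u x) + \<bar>\<xi> $ i\<bar> * cmod (u x)"
        unfolding w'_def by (rule order_trans[OF norm_triangle_ineq]) (simp add: norm_mult norm_e)
      also have "\<dots> \<le> C / poly_weight x + \<bar>\<xi> $ i\<bar> * (C' / poly_weight x)"
        using C[of x] C'[of x] by (intro add_mono mult_left_mono) auto
      finally show ?thesis by (simp add: add_divide_distrib)
    qed
    show "w' \<in> borel_measurable borel" unfolding w'_def by measurable
  qed
  moreover have "(LINT x|lborel. w' x) = fourier (pderiv_at i u) \<xi> + (- \<i> * of_real (\<xi> $ i)) * fourier u \<xi>"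
    unfolding w'_def fourier_def e_def[symmetric]
    unfolding Bochner_Integration.integral_add[OF int[OF iu(2)] integrable_mult_right[OF int[OF iu(1)]]]
      integral_mult_right_zero ..
  ultimately have "fourier (pderiv_at i u) \<xi> - \<i> * of_real (\<xi> $ i) * fourier u \<xi> = 0" by simp
  then show ?thesis by (simp only: eq_iff_diff_eq_0[symmetric])
qed

lemma fourier_pderivs:
  "rapid u \<Longrightarrow> fourier (pderivs is u) \<xi> = \<i> ^ length is * of_real (mono_word is \<xi>) * fourier u \<xi>"
  by (induction "is") (simp_all add: fourier_pderiv_at rapid_pderivs)

lemma cmod_fourier_le: "cmod (fourier u \<xi>) \<le> (LINT x|lborel. cmod (u x))"
  unfolding fourier_def
  by (rule order_trans[OF Bochner_Integration.integral_norm_bound]) (simp add: norm_mult norm_exp_eq_Re)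

lemma fourier_measurable [measurable]:
  assumes [measurable]: "u \<in> borel_measurable borel"
  shows "fourier u \<in> borel_measurable borel"
proof -
  have "(\<lambda>(\<xi>, x). exp (- (\<i> * of_real (x \<bullet> \<xi>)))) \<in> borel_measurable (borel \<Otimes>\<^sub>M (borel :: (real^'a) measure))"
    unfolding borel_prod case_prod_beta
    by (intro borel_measurable_continuous_onI continuous_intros)
  then have "(\<lambda>p. (case p of (\<xi>, x) \<Rightarrow> exp (- (\<i> * of_real (x \<bullet> \<xi>)))) * u (snd p))
      \<in> borel_measurable (borel \<Otimes>\<^sub>M lborel)"
    by simp
  then have "(\<lambda>(\<xi>, x). exp (- (\<i> * of_real (x \<bullet> \<xi>))) * u x) \<in> borel_measurable (borel \<Otimes>\<^sub>M lborel)"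
    by (simp add: case_prod_beta)
  then show ?thesis unfolding fourier_def[abs_def]
    by (rule lborel.borel_measurable_lebesgue_integral)
qed

section \<open>Fourier inversion and a Sobolev inequality\<close>

lemma gaussian_transform_1d:
  "(LINT s|lborel. of_real (std_normal_density s) * exp (\<i> * of_real (s * t))) = complex_of_real (exp (- t\<^sup>2 / 2))"
proof -
  have "char std_normal_distribution t = (LINT s|lborel. std_normal_density s *\<^sub>R iexp (t * s))"
    unfolding char_def by (subst integral_density) (auto simp: normal_density_nonneg)
  then show ?thesis by (simp add: char_std_normal_distribution scaleR_conv_of_real mult_ac)
qed

definition gaussian :: "real^'d::finite \<Rightarrow> real" where
  "gaussian x = (\<Prod>i\<in>UNIV. exp (- (x $ i)\<^sup>2 / 2))"

lemma continuous_on_gaussian: "continuous_on A gaussian"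
  unfolding gaussian_def by (intro continuous_intros) auto

lemma gaussian_measurable [measurable]: "gaussian \<in> borel_measurable borel"
  by (intro borel_measurable_continuous_onI continuous_on_gaussian)

lemma gaussian_nonneg: "0 \<le> gaussian x"
  unfolding gaussian_def by (intro prod_nonneg) auto

lemma gaussian_le_1: "gaussian x \<le> 1"
  unfolding gaussian_def by (intro prod_le_1) auto

lemma exp_eq_std_normal_density: "exp (- s\<^sup>2 / 2) = sqrt (2 * pi) * std_normal_density s"
  by (simp add: std_normal_density_def)

lemma integrable_gaussian: "integrable lborel (gaussian :: real^'d::finite \<Rightarrow> real)"
  and integral_gaussian_pos: "0 < (LINT x|lborel. gaussian (x :: real^'d::finite))"
proof -
  have 1: "integrable lborel (\<lambda>s::real. exp (- s\<^sup>2 / 2))"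
    unfolding exp_eq_std_normal_density by (intro integrable_mult_right integrable_normal_density) simp
  show "integrable lborel (gaussian :: real^'d::finite \<Rightarrow> real)"
    unfolding gaussian_def[abs_def] by (rule integrable_vec_prod[OF 1])
  have "(LINT s|lborel. exp (- s\<^sup>2 / 2)) = sqrt (2 * pi)"
    unfolding exp_eq_std_normal_density by (subst integral_mult_right_zero) simp
  then show "0 < (LINT x|lborel. gaussian (x :: real^'d::finite))"
    unfolding gaussian_def integral_vec_prod[OF 1] by simp
qed

lemma gaussian_transform:
  fixes z :: "real^'d::finite"
  shows "(LINT \<eta>|lborel. of_real (gaussian \<eta>) * exp (\<i> * of_real (\<eta> \<bullet> z)))
    = of_real (sqrt (2 * pi) ^ CARD('d)) * complex_of_real (gaussian z)"
proof -
  have prod: "of_real (gaussian \<eta>) * exp (\<i> * of_real (\<eta> \<bullet> z))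
      = (\<Prod>i\<in>UNIV. of_real (sqrt (2 * pi)) * (of_real (std_normal_density (\<eta> $ i)) * exp (\<i> * of_real (\<eta> $ i * z $ i))))"
    for \<eta> :: "real^'d"
  proof -
    have "exp (\<i> * of_real (\<eta> \<bullet> z)) = (\<Prod>i\<in>UNIV. exp (\<i> * of_real (\<eta> $ i * z $ i)))"
      by (simp add: inner_vec_def sum_distrib_left exp_sum)
    then show ?thesis
      unfolding gaussian_def exp_eq_std_normal_density of_real_prod
      by (simp only: prod.distrib[symmetric] of_real_mult mult.assoc)
  qed
  have int: "integrable lborel (\<lambda>s. of_real (sqrt (2 * pi)) * (of_real (std_normal_density s) * exp (\<i> * of_real (s * t))))"
    for t :: real
  proof (intro integrable_mult_right Bochner_Integration.integrable_bound[OF integrable_normal_density[of 1 0]])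
    have "(\<lambda>s. complex_of_real (1 / sqrt (2 * pi) * exp (- s\<^sup>2 / 2)) * exp (\<i> * of_real (s * t)))
        \<in> borel_measurable borel"
      by (intro borel_measurable_continuous_onI continuous_intros) auto
    then show "(\<lambda>s. complex_of_real (std_normal_density s) * exp (\<i> * of_real (s * t))) \<in> borel_measurable lborel"
      unfolding std_normal_density_def by simp
  qed (auto simp: norm_mult norm_exp_eq_Re)
  have "(LINT \<eta>|lborel. of_real (gaussian \<eta>) * exp (\<i> * of_real (\<eta> \<bullet> z)))
      = (\<Prod>i\<in>UNIV. (LINT s|lborel. of_real (sqrt (2 * pi)) *
          (of_real (std_normal_density s) * exp (\<i> * of_real (s * z $ i)))))"
    unfolding prod by (rule integral_vec_prod[OF int])
  also have "\<dots> = (\<Prod>i\<in>UNIV. of_real (sqrt (2 * pi)) * complex_of_real (exp (- (z $ i)\<^sup>2 / 2)))"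
    by (simp only: integral_mult_right_zero gaussian_transform_1d)
  finally show ?thesis by (simp add: prod.distrib gaussian_def)
qed

text \<open>Fourier inversion, in the form of an estimate: convolve \<open>v\<close> with a narrow Gaussian, write the
  Gaussian as a Fourier integral, exchange the integrals, and let the width tend to \<open>0\<close>.\<close>

lemma cmod_le_integral_fourier:
  fixes v :: "real^'d::finite \<Rightarrow> complex"
  assumes cont: "continuous_on UNIV v" and bound: "\<And>x. cmod (v x) \<le> C / poly_weight x"
    and int: "integrable lborel (fourier v)"
  shows "cmod (v x) * (LINT z|lborel. gaussian (z :: real^'d))
    \<le> (LINT \<xi>|lborel. cmod (fourier v \<xi>)) / sqrt (2 * pi) ^ CARD('d)"
proof -
  let ?D = "CARD('d)" and ?k = "sqrt (2 * pi) ^ CARD('d)"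
  have [measurable]: "v \<in> borel_measurable borel" by (intro borel_measurable_continuous_onI cont)
  have vint: "integrable lborel v" by (rule integrable_poly_weight_bound[OF _ bound]) simp
  have C0: "0 \<le> C"
  proof -
    have "0 \<le> C / poly_weight (0 :: real^'d)" using bound[of 0] norm_ge_zero order_trans by blast
    then show ?thesis using poly_weight_pos[of "0 :: real^'d"] by (simp add: zero_le_divide_iff)
  qed
  have vC: "cmod (v y) \<le> C" for y
  proof -
    have "C / poly_weight y \<le> C / 1" using C0 poly_weight_ge_1[of y] by (intro divide_left_mono) auto
    then show ?thesis using bound[of y] by simp
  qed
  define A where "A \<epsilon> = (LINT z|lborel. v (x + (- \<epsilon>) *\<^sub>R z) * of_real (gaussian z))" for \<epsilon>
  have A_le: "cmod (A \<epsilon>) \<le> (LINT \<xi>|lborel. cmod (fourier v \<xi>)) / ?k" if \<epsilon>: "\<epsilon> > 0" for \<epsilon>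
  proof -
    define F where "F z \<eta> = v (x + (- \<epsilon>) *\<^sub>R z) * (of_real (gaussian \<eta>) * exp (\<i> * of_real (\<eta> \<bullet> z)))" for z \<eta>
    have ne: "- \<epsilon> \<noteq> 0" using \<epsilon> by simp
    have vs: "integrable lborel (\<lambda>z. v (x + (- \<epsilon>) *\<^sub>R z))" by (rule integrable_affine[OF vint ne])
    have ipair: "(\<lambda>p. exp (\<i> * of_real (snd p \<bullet> fst p))) \<in> borel_measurable (borel \<Otimes>\<^sub>M (borel :: (real^'d) measure))"
      unfolding borel_prod by (intro borel_measurable_continuous_onI continuous_intros)
    have gint: "integrable lborel (\<lambda>\<eta>. of_real (gaussian \<eta>) * exp (\<i> * of_real (\<eta> \<bullet> z)))" for z :: "real^'d"
    proof (rule Bochner_Integration.integrable_bound[OF integrable_gaussian])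
      have "(\<lambda>\<eta>. exp (\<i> * of_real (\<eta> \<bullet> z))) \<in> borel_measurable borel"
        by (intro borel_measurable_continuous_onI continuous_intros)
      then show "(\<lambda>\<eta>. of_real (gaussian \<eta>) * exp (\<i> * of_real (\<eta> \<bullet> z))) \<in> borel_measurable lborel"
        by simp
    qed (auto simp: norm_mult norm_exp_eq_Re)
    have Fint: "integrable (lborel \<Otimes>\<^sub>M lborel) (case_prod F)"
    proof (rule lborel_pair.Fubini_integrable)
      have "(\<lambda>p. v (x + (- \<epsilon>) *\<^sub>R fst p) * (of_real (gaussian (snd p)) * exp (\<i> * of_real (snd p \<bullet> fst p))))
          \<in> borel_measurable (borel \<Otimes>\<^sub>M borel)"
        using ipair by measurable
      then show "case_prod F \<in> borel_measurable (lborel \<Otimes>\<^sub>M lborel)"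
        by (simp add: F_def case_prod_beta' cong: measurable_cong_sets)
      have "(LINT \<eta>|lborel. norm (case (z, \<eta>) of (a, b) \<Rightarrow> F a b))
          = cmod (v (x + (- \<epsilon>) *\<^sub>R z)) * (LINT \<eta>|lborel. gaussian (\<eta> :: real^'d))" for z
        by (simp add: F_def norm_mult norm_exp_eq_Re abs_of_nonneg[OF gaussian_nonneg])
      then show "integrable lborel (\<lambda>z. LINT \<eta>|lborel. norm (case (z, \<eta>) of (a, b) \<Rightarrow> F a b))"
        using vs by (simp only:) (intro integrable_mult_left integrable_norm)
      show "AE z in lborel. integrable lborel (\<lambda>\<eta>. case (z, \<eta>) of (a, b) \<Rightarrow> F a b)"
        unfolding F_def prod.case by (intro AE_I2 integrable_mult_right gint)
    qed
    have inner: "cmod (LINT z|lborel. F z \<eta>) \<le> cmod (fourier v (0 + (1 / \<epsilon>) *\<^sub>R \<eta>)) / \<epsilon> ^ ?D" for \<eta>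
    proof -
      \<comment> \<open>The \<open>z\<close>-integral is, after the substitution \<open>y = x - \<epsilon> z\<close>, the transform of \<open>v\<close> at \<open>\<eta> / \<epsilon>\<close>.\<close>
      define f where "f y = v y * exp (\<i> * of_real (\<eta> \<bullet> ((1 / \<epsilon>) *\<^sub>R (x - y))))" for y
      have "(\<lambda>y. exp (\<i> * of_real (\<eta> \<bullet> ((1 / \<epsilon>) *\<^sub>R (x - y))))) \<in> borel_measurable borel"
        by (intro borel_measurable_continuous_onI continuous_intros)
      then have fm: "f \<in> borel_measurable borel" unfolding f_def by simp
      have fint: "integrable lborel f"
        by (rule Bochner_Integration.integrable_bound[OF vint])
          (use fm in \<open>auto simp: f_def norm_mult norm_exp_eq_Re\<close>)
      have fz: "f (x + (- \<epsilon>) *\<^sub>R z) = v (x + (- \<epsilon>) *\<^sub>R z) * exp (\<i> * of_real (\<eta> \<bullet> z))" for z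
        using \<epsilon> by (simp add: f_def)
      have fF: "f y = exp (\<i> * of_real (\<eta> \<bullet> ((1 / \<epsilon>) *\<^sub>R x))) * (exp (- (\<i> * of_real (y \<bullet> ((1 / \<epsilon>) *\<^sub>R \<eta>)))) * v y)" for y
      proof -
        have "\<eta> \<bullet> ((1 / \<epsilon>) *\<^sub>R (x - y)) = \<eta> \<bullet> ((1 / \<epsilon>) *\<^sub>R x) + - (y \<bullet> ((1 / \<epsilon>) *\<^sub>R \<eta>))"
          by (simp add: inner_diff_right inner_commute diff_divide_distrib)
        then show ?thesis unfolding f_def by (simp only: of_real_add of_real_minus distrib_left exp_add) simp
      qed
      have "cmod (LINT y|lborel. f y) = cmod (fourier v ((1 / \<epsilon>) *\<^sub>R \<eta>))"
        unfolding fF integral_mult_right_zero fourier_def by (simp add: norm_mult norm_exp_eq_Re)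
      moreover have "(LINT y|lborel. f y) = \<epsilon> ^ ?D *\<^sub>R (LINT z|lborel. f (x + (- \<epsilon>) *\<^sub>R z))"
        using integral_affine[OF fint ne, of x] \<epsilon> by simp
      ultimately have 1: "\<epsilon> ^ ?D * cmod (LINT z|lborel. f (x + (- \<epsilon>) *\<^sub>R z)) = cmod (fourier v ((1 / \<epsilon>) *\<^sub>R \<eta>))"
        using \<epsilon> by simp
      have "(LINT z|lborel. F z \<eta>) = (LINT z|lborel. of_real (gaussian \<eta>) * f (x + (- \<epsilon>) *\<^sub>R z))"
        unfolding F_def fz by (intro Bochner_Integration.integral_cong refl) (simp only: mult_ac)
      then have "cmod (LINT z|lborel. F z \<eta>) = gaussian \<eta> * cmod (LINT z|lborel. f (x + (- \<epsilon>) *\<^sub>R z))"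
        unfolding integral_mult_right_zero by (simp add: norm_mult gaussian_nonneg)
      also have "\<dots> \<le> 1 * cmod (LINT z|lborel. f (x + (- \<epsilon>) *\<^sub>R z))"
        by (intro mult_right_mono gaussian_le_1) simp
      also have "\<dots> = cmod (fourier v (0 + (1 / \<epsilon>) *\<^sub>R \<eta>)) / \<epsilon> ^ ?D"
        using 1 \<epsilon> by (simp add: field_simps)
      finally show ?thesis .
    qed
    have absint: "integrable lborel (\<lambda>\<xi>. cmod (fourier v \<xi>))" using int by simp
    have e1: "1 / \<epsilon> \<noteq> 0" using \<epsilon> by simp
    have "A \<epsilon> = (LINT z|lborel. (LINT \<eta>|lborel. F z \<eta>)) / of_real ?k"
    proof -
      have "(LINT \<eta>|lborel. F z \<eta>) = v (x + (- \<epsilon>) *\<^sub>R z) * of_real (gaussian z) * of_real ?k" for z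
        unfolding F_def integral_mult_right_zero gaussian_transform by (simp only: mult_ac)
      then show ?thesis unfolding A_def by simp
    qed
    also have "(LINT z|lborel. (LINT \<eta>|lborel. F z \<eta>)) = (LINT \<eta>|lborel. (LINT z|lborel. F z \<eta>))"
      by (rule lborel_pair.Fubini_integral[OF Fint, symmetric])
    finally have "cmod (A \<epsilon>) = cmod (LINT \<eta>|lborel. (LINT z|lborel. F z \<eta>)) / ?k"
      by (simp add: norm_divide norm_power)
    moreover have "cmod (LINT \<eta>|lborel. (LINT z|lborel. F z \<eta>))
        \<le> (LINT \<eta>|lborel. cmod (fourier v (0 + (1 / \<epsilon>) *\<^sub>R \<eta>)) / \<epsilon> ^ ?D)"
    proof (rule order_trans[OF Bochner_Integration.integral_norm_bound])
      show "(LINT \<eta>|lborel. cmod (LINT z|lborel. F z \<eta>)) \<le> (LINT \<eta>|lborel. cmod (fourier v (0 + (1 / \<epsilon>) *\<^sub>R \<eta>)) / \<epsilon> ^ ?D)"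
      proof (rule Bochner_Integration.integral_mono')
        show "integrable lborel (\<lambda>\<eta>. cmod (fourier v (0 + (1 / \<epsilon>) *\<^sub>R \<eta>)) / \<epsilon> ^ ?D)"
          by (intro integrable_divide integrable_affine[OF absint e1])
      qed (use inner \<epsilon> in auto)
    qed
    moreover have "(LINT \<eta>|lborel. cmod (fourier v (0 + (1 / \<epsilon>) *\<^sub>R \<eta>)) / \<epsilon> ^ ?D) = (LINT \<xi>|lborel. cmod (fourier v \<xi>))"
      using integral_affine[OF absint e1, of 0] \<epsilon> by (simp add: power_divide)
    ultimately show ?thesis by (simp add: divide_right_mono)
  qed
  have "(\<lambda>n. A (inverse (real (Suc n)))) \<longlonglongrightarrow> (LINT z|lborel. v x * of_real (gaussian (z :: real^'d)))"
    unfolding A_def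
  proof (rule integral_dominated_convergence[where w="\<lambda>z. C * gaussian z"])
    show "integrable lborel (\<lambda>z::real^'d. C * gaussian z)"
      by (intro integrable_mult_right integrable_gaussian)
    show "AE z in lborel. (\<lambda>n. v (x + (- inverse (real (Suc n))) *\<^sub>R z) * of_real (gaussian z)) \<longlonglongrightarrow> v x * of_real (gaussian z)"
    proof (rule AE_I2)
      fix z :: "real^'d"
      have "(\<lambda>n. x + (- inverse (real (Suc n))) *\<^sub>R z) \<longlonglongrightarrow> x + (- 0) *\<^sub>R z"
        by (intro tendsto_intros LIMSEQ_inverse_real_of_nat)
      then have "(\<lambda>n. v (x + (- inverse (real (Suc n))) *\<^sub>R z)) \<longlonglongrightarrow> v x"
        using continuous_on_tendsto_compose[OF cont] by simp
      then show "(\<lambda>n. v (x + (- inverse (real (Suc n))) *\<^sub>R z) * of_real (gaussian z)) \<longlonglongrightarrow> v x * of_real (gaussian z)"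
        by (intro tendsto_mult tendsto_const)
    qed
    show "AE z in lborel. norm (v (x + (- inverse (real (Suc n))) *\<^sub>R z) * of_real (gaussian z)) \<le> C * gaussian z" for n
      using vC by (intro AE_I2) (simp add: norm_mult mult_right_mono gaussian_nonneg abs_of_nonneg[OF gaussian_nonneg])
  qed simp_all
  then have lim: "(\<lambda>n. cmod (A (inverse (real (Suc n))))) \<longlonglongrightarrow> cmod (LINT z|lborel. v x * of_real (gaussian (z :: real^'d)))"
    by (rule tendsto_norm)
  have "cmod (LINT z|lborel. v x * of_real (gaussian (z :: real^'d))) \<le> (LINT \<xi>|lborel. cmod (fourier v \<xi>)) / ?k"
    by (rule LIMSEQ_le_const2[OF lim]) (auto intro!: A_le)
  moreover have "cmod (LINT z|lborel. v x * of_real (gaussian (z :: real^'d))) = cmod (v x) * (LINT z|lborel. gaussian (z :: real^'d))"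
    unfolding integral_mult_right_zero integral_complex_of_real
    using integral_gaussian_pos[where 'd='d] by (simp add: norm_mult)
  ultimately show ?thesis by simp
qed

lemma cmod_le_fourier_L1:
  obtains c where "c > 0" and "\<And>(v :: real^'d::finite \<Rightarrow> complex) C x. continuous_on UNIV v \<Longrightarrow>
    (\<And>x. cmod (v x) \<le> C / poly_weight x) \<Longrightarrow> integrable lborel (fourier v) \<Longrightarrow>
    cmod (v x) \<le> c * (LINT \<xi>|lborel. cmod (fourier v \<xi>))"
proof -
  define g where "g = (LINT z|lborel. gaussian (z :: real^'d)) * sqrt (2 * pi) ^ CARD('d)"
  have g: "g > 0" unfolding g_def using integral_gaussian_pos[where 'd='d] by simp
  have main: "cmod (v x) \<le> (1 / g) * (LINT \<xi>|lborel. cmod (fourier v \<xi>))"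
    if "continuous_on UNIV v" "\<And>x. cmod (v x) \<le> C / poly_weight x" "integrable lborel (fourier v)"
    for v :: "real^'d \<Rightarrow> complex" and C x
  proof -
    have "cmod (v x) * g \<le> (LINT \<xi>|lborel. cmod (fourier v \<xi>))"
      using cmod_le_integral_fourier[OF that, of x] unfolding g_def
      by (simp add: pos_le_divide_eq mult.assoc)
    then show ?thesis using g by (simp add: pos_le_divide_eq)
  qed
  show ?thesis by (rule that[OF _ main]) (use g in simp)
qed


lemma integrable_square_op:
  assumes "rapid u"
  shows "integrable lborel (\<lambda>x. (cmod (mono_deriv js is u x))\<^sup>2)"
proof -
  obtain C where C: "C > 0" "\<And>x. cmod (mono_deriv js is u x) \<le> C / poly_weight x"
    using rapid_bound[OF assms] by metis
  have m: "(\<lambda>x. mono_deriv js is u x) \<in> borel_measurable borel"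
    by (intro borel_measurable_continuous_onI continuous_intros smooth_continuous rapid_smooth assms)
  show ?thesis
  proof (rule integrable_poly_weight_bound[where C="C\<^sup>2"])
    show "(\<lambda>x. (cmod (mono_deriv js is u x))\<^sup>2) \<in> borel_measurable borel"
      using m by simp
    fix x
    have "(cmod (mono_deriv js is u x))\<^sup>2 \<le> (C / poly_weight x)\<^sup>2"
      by (intro power_mono C) simp
    also have "\<dots> = C\<^sup>2 / poly_weight x / poly_weight x" by (simp add: power2_eq_square)
    also have "\<dots> \<le> C\<^sup>2 / poly_weight x / 1"
      using poly_weight_ge_1[of x] poly_weight_pos[of x] by (intro divide_left_mono) auto
    finally show "norm ((cmod (mono_deriv js is u x))\<^sup>2) \<le> C\<^sup>2 / poly_weight x"
      by simp
  qed
qed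

text \<open>Cauchy-Schwarz in additive form: \<open>h \<le> B + h\<^sup>2 / B\<close> for \<open>h = poly_weight x * cmod (f x)\<close>.\<close>

lemma integral_le_sqrt_bound:
  fixes f :: "real^'d::finite \<Rightarrow> complex"
  assumes B: "B > 0" and [measurable]: "f \<in> borel_measurable borel"
    and int: "integrable lborel (\<lambda>x. (cmod (of_real (poly_weight x) * f x))\<^sup>2)"
    and le: "(LINT x|lborel. (cmod (of_real (poly_weight x) * f x))\<^sup>2) \<le> B\<^sup>2"
  shows "integrable lborel f"
    and "(LINT x|lborel. cmod (f x)) \<le> B * ((LINT x|lborel. 1 / poly_weight (x :: real^'d)) + 1)"
proof -
  let ?h = "\<lambda>x. cmod (of_real (poly_weight x) * f x)"
  let ?g = "\<lambda>x. B * (1 / poly_weight x) + (1 / B) * (?h x)\<^sup>2"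
  have g: "integrable lborel ?g"
    by (intro Bochner_Integration.integrable_add integrable_mult_right int integrable_inverse_poly_weight)
  have fg: "cmod (f x) \<le> ?g x" for x
  proof -
    have pw: "poly_weight x \<ge> 1" by (rule poly_weight_ge_1)
    have "2 * (B * ?h x) \<le> B\<^sup>2 + (?h x)\<^sup>2"
      using zero_le_power2[of "B - ?h x"] by (simp add: power2_diff)
    then have "B * ?h x \<le> B\<^sup>2 + (?h x)\<^sup>2"
    proof -
      have "0 \<le> B * ?h x" using B by simp
      then show ?thesis using \<open>2 * (B * ?h x) \<le> B\<^sup>2 + (?h x)\<^sup>2\<close> by linarith
    qed
    then have "?h x \<le> B + (1 / B) * (?h x)\<^sup>2"
      using B by (simp add: field_simps power2_eq_square)
    then have "poly_weight x * cmod (f x) \<le> B + (1 / B) * (?h x)\<^sup>2"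
      using pw by (simp add: norm_mult)
    then have "cmod (f x) \<le> (B + (1 / B) * (?h x)\<^sup>2) / poly_weight x"
      using pw by (simp add: pos_le_divide_eq mult.commute)
    also have "\<dots> \<le> B * (1 / poly_weight x) + (1 / B) * (?h x)\<^sup>2 / 1"
      unfolding add_divide_distrib using pw B by (intro add_mono divide_left_mono) auto
    finally show ?thesis by simp
  qed
  have g0: "0 \<le> ?g x" for x using fg[of x] norm_ge_zero order_trans by blast
  show "integrable lborel f"
    by (rule Bochner_Integration.integrable_bound[OF g]) (use fg in \<open>auto intro: order_trans[OF _ abs_ge_self]\<close>)
  have "(LINT x|lborel. cmod (f x)) \<le> (LINT x|lborel. ?g x)"
    by (rule Bochner_Integration.integral_mono'[OF g fg g0])
  also have "\<dots> = B * (LINT x|lborel. 1 / poly_weight (x :: real^'d)) + (1 / B) * (LINT x|lborel. (?h x)\<^sup>2)"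
    unfolding Bochner_Integration.integral_add[OF integrable_mult_right[OF integrable_inverse_poly_weight]
      integrable_mult_right[OF int]] integral_mult_right_zero ..
  also have "(1 / B) * (LINT x|lborel. (?h x)\<^sup>2) \<le> (1 / B) * B\<^sup>2"
    using B le by (intro mult_left_mono) auto
  also have "(1 / B) * B\<^sup>2 = B" using B by (simp add: power2_eq_square)
  finally show "(LINT x|lborel. cmod (f x)) \<le> B * ((LINT x|lborel. 1 / poly_weight (x :: real^'d)) + 1)"
    by (simp add: algebra_simps)
qed


text \<open>A Sobolev inequality: the value at a point is bounded by the \<open>L\<^sup>1\<close>-norm of the Fourier transform.
  Derivatives make the transform integrable, at the price of \<open>L\<^sup>1\<close>-norms, and monomials turn these into
  \<open>L\<^sup>2\<close>-norms. The product rule produces at most \<open>(1 + length js) ^ (2 * CARD('d))\<close> terms.\<close>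

lemma sobolev:
  obtains C where "C > 0" and
    "\<And>(u :: real^'d::finite \<Rightarrow> complex) js is B x. rapid u \<Longrightarrow> B > 0 \<Longrightarrow>
      (\<And>js' is'. length js + length is \<le> length js' + length is' + 2 * CARD('d) \<Longrightarrow>
         length js' + length is' \<le> length js + length is + 4 * CARD('d) \<Longrightarrow>
         (L2_square js' is' u) \<le> B\<^sup>2) \<Longrightarrow>
      cmod (mono_deriv js is u x) \<le> C * (1 + real (length js)) ^ (2 * CARD('d)) * B"
proof -
  let ?N = "2 * CARD('d)"
  obtain W :: "'d list list" where W: "\<And>w. w \<in> set W \<Longrightarrow> length w \<le> ?N"
    "\<And>x::real^'d. poly_weight x = (\<Sum>w\<leftarrow>W. mono_word w x)"
    using poly_weight_words by metis
  obtain c where c: "c > 0" "\<And>(v :: real^'d \<Rightarrow> complex) C x. continuous_on UNIV v \<Longrightarrow>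
    (\<And>x. cmod (v x) \<le> C / poly_weight x) \<Longrightarrow> integrable lborel (fourier v) \<Longrightarrow>
    cmod (v x) \<le> c * (LINT \<xi>|lborel. cmod (fourier v \<xi>))"
    using cmod_le_fourier_L1[where 'd='d] by metis
  define J where "J = (LINT x|lborel. 1 / poly_weight (x :: real^'d))"
  have J0: "J \<ge> 0" unfolding J_def
    by (intro integral_nonneg_AE AE_I2) (auto simp: less_imp_le[OF poly_weight_pos])
  define n where "n = real (length W)"
  define K where "K = c * (n * ((n + 1) * (J + 1))) * J + 1"
  have main: "cmod (mono_deriv js is u x) \<le> K * (1 + real (length js)) ^ ?N * B"
    if u: "rapid u" and B: "B > 0" and L2: "\<And>js' is'. length js + length is \<le> length js' + length is' + ?N \<Longrightarrow>
         length js' + length is' \<le> length js + length is + 4 * CARD('d) \<Longrightarrow>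
         (L2_square js' is' u) \<le> B\<^sup>2"
    for u :: "real^'d \<Rightarrow> complex" and js "is" B x
  proof -
    have sm: "smooth u" by (rule rapid_smooth[OF u])
    define v where "v = op_sum [(js, is)] u"
    have v: "rapid v" unfolding v_def by (rule rapid_op_sum[OF u])
    define p where "p = (1 + real (length js)) ^ ?N"
    have p1: "p \<ge> 1" unfolding p_def by simp
    \<comment> \<open>The factor \<open>poly_weight\<close> that turns \<open>L\<^sup>2\<close> into \<open>L\<^sup>1\<close> lengthens the words by at most \<open>?N\<close>, and so
      do the derivatives taken below; hence the \<open>4 * CARD('d)\<close>.\<close>
    have term_le: "integrable lborel (\<lambda>x. mono_deriv js' is' u x) \<and>
        (LINT x|lborel. cmod (mono_deriv js' is' u x)) \<le> (n + 1) * B * (J + 1)"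
      if t: "length js + length is \<le> length js' + length is' + ?N"
        "length js' + length is' \<le> length js + length is + ?N" for js' is'
    proof -
      let ?f = "\<lambda>x. mono_deriv js' is' u x"
      have fm: "?f \<in> borel_measurable borel"
        by (intro borel_measurable_continuous_onI continuous_intros smooth_continuous sm)
      have pf: "of_real (poly_weight x) * ?f x = op_sum (map (\<lambda>w. (w @ js', is')) W) u x" for x
      proof -
        have "of_real (\<Sum>w\<leftarrow>V. mono_word w x) * ?f x = op_sum (map (\<lambda>w. (w @ js', is')) V) u x" for V
          by (induction V) (auto simp: algebra_simps)
        then show ?thesis unfolding W(2) .
      qed
      have sq: "(cmod (op_sum (map (\<lambda>w. (w @ js', is')) V) u x))\<^sup>2
          \<le> real (length V) * (\<Sum>w\<leftarrow>V. (cmod (mono_deriv (w @ js') is' u x))\<^sup>2)" for V x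
      proof (induction V)
        case (Cons w V)
        define a b where "a = cmod (mono_deriv (w @ js') is' u x)"
          and "b = cmod (op_sum (map (\<lambda>w. (w @ js', is')) V) u x)"
        define S where "S = (\<Sum>w\<leftarrow>V. (cmod (mono_deriv (w @ js') is' u x))\<^sup>2)"
        have S0: "S \<ge> 0" unfolding S_def by (intro sum_list_nonneg) auto
        have IH: "b\<^sup>2 \<le> real (length V) * S" using Cons unfolding b_def S_def .
        have "cmod (op_sum (map (\<lambda>w. (w @ js', is')) (w # V)) u x) \<le> a + b"
          unfolding a_def b_def by (simp add: norm_triangle_ineq)
        then have "(cmod (op_sum (map (\<lambda>w. (w @ js', is')) (w # V)) u x))\<^sup>2 \<le> (a + b)\<^sup>2"
          by (intro power_mono) auto
        also have "(a + b)\<^sup>2 \<le> real (length (w # V)) * (a\<^sup>2 + S)"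
        proof (cases "V = []")
          case True
          then show ?thesis by (simp add: b_def S_def)
        next
          case False
          define l where "l = real (length V)"
          have l: "l \<ge> 1" using False by (cases V) (auto simp: l_def)
          have "2 * (l * a) * b \<le> (l * a)\<^sup>2 + b\<^sup>2"
            using zero_le_power2[of "l * a - b"] by (simp add: power2_diff)
          also have "\<dots> \<le> (l * a)\<^sup>2 + l * S" using IH by (simp add: l_def)
          finally have "l * (2 * a * b) \<le> l * (l * a\<^sup>2 + S)"
            by (simp add: algebra_simps power2_eq_square)
          then have "2 * a * b \<le> l * a\<^sup>2 + S" using l by simp
          then show ?thesis using IH unfolding l_def[symmetric]
            by (simp add: l_def[symmetric] power2_sum algebra_simps)
        qed
        finally show ?case unfolding a_def S_def by simp
      qed simp
      have L2w: "(LINT x|lborel. (cmod (mono_deriv (w @ js') is' u x))\<^sup>2) \<le> B\<^sup>2"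
        if "w \<in> set W" for w
        using W(1)[OF that] t by (intro L2) auto
      have isq: "integrable lborel (\<lambda>x. \<Sum>w\<leftarrow>V. (cmod (mono_deriv (w @ js') is' u x))\<^sup>2)" for V
        by (induction V) (simp_all del: mono_word_simps add: integrable_square_op[OF u] Bochner_Integration.integrable_add)
      have Lsum: "(LINT x|lborel. (\<Sum>w\<leftarrow>V. (cmod (mono_deriv (w @ js') is' u x))\<^sup>2)) \<le> real (length V) * B\<^sup>2"
        if "set V \<subseteq> set W" for V
        using that
      proof (induction V)
        case (Cons w V)
        have "(LINT x|lborel. (cmod (mono_deriv (w @ js') is' u x))\<^sup>2 +
            (\<Sum>w\<leftarrow>V. (cmod (mono_deriv (w @ js') is' u x))\<^sup>2)) \<le> B\<^sup>2 + real (length V) * B\<^sup>2"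
          using Cons L2w by (subst Bochner_Integration.integral_add[OF integrable_square_op[OF u] isq]) (intro add_mono, auto)
        then show ?case by (simp add: algebra_simps)
      qed simp
      have om: "op_sum (map (\<lambda>w. (w @ js', is')) W) u \<in> borel_measurable borel"
        by (intro borel_measurable_continuous_onI continuous_on_op_sum sm)
      have i2: "integrable lborel (\<lambda>x. (cmod (of_real (poly_weight x) * ?f x))\<^sup>2)"
        unfolding pf
      proof (rule Bochner_Integration.integrable_bound[OF integrable_mult_right[OF isq[of W], of "real (length W)"]])
        show "(\<lambda>x. (cmod (op_sum (map (\<lambda>w. (w @ js', is')) W) u x))\<^sup>2) \<in> borel_measurable lborel"
          using om by simp
        show "AE x in lborel. norm ((cmod (op_sum (map (\<lambda>w. (w @ js', is')) W) u x))\<^sup>2)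
            \<le> norm (real (length W) * (\<Sum>w\<leftarrow>W. (cmod (mono_deriv (w @ js') is' u x))\<^sup>2))"
          using order_trans[OF sq[of W] abs_ge_self] by (intro AE_I2) simp
      qed
      have "(LINT x|lborel. (cmod (of_real (poly_weight x) * ?f x))\<^sup>2)
          \<le> (LINT x|lborel. real (length W) * (\<Sum>w\<leftarrow>W. (cmod (mono_deriv (w @ js') is' u x))\<^sup>2))"
        using i2 unfolding pf by (intro Bochner_Integration.integral_mono sq integrable_mult_right isq) auto
      also have "\<dots> \<le> n * (n * B\<^sup>2)"
        unfolding integral_mult_right_zero n_def using Lsum[of W] by (intro mult_left_mono) auto
      also have "\<dots> \<le> ((n + 1) * B)\<^sup>2"
      proof -
        have "n * n \<le> (n + 1) * (n + 1)" by (intro mult_mono) (auto simp: n_def)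
        then have "(n * n) * B\<^sup>2 \<le> ((n + 1) * (n + 1)) * B\<^sup>2" by (intro mult_right_mono) auto
        then show ?thesis by (simp add: power_mult_distrib power2_eq_square mult_ac)
      qed
      finally have le: "(LINT x|lborel. (cmod (of_real (poly_weight x) * ?f x))\<^sup>2) \<le> ((n + 1) * B)\<^sup>2" .
      have nB: "(n + 1) * B > 0" using B by (simp add: n_def add_nonneg_pos)
      show ?thesis
        using integral_le_sqrt_bound[OF nB fm i2 le] unfolding J_def by simp
    qed
    have deriv_le: "integrable lborel (pderivs s v) \<and>
        (LINT x|lborel. cmod (pderivs s v x)) \<le> p * ((n + 1) * B * (J + 1))" if s: "length s \<le> ?N" for s
    proof -
      define ts where "ts = foldr diff_terms s [(js, is)]"
      have ts: "pderivs s v = op_sum ts u" unfolding v_def ts_def by (rule pderivs_op_sum[OF sm])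
      have "integrable lborel (op_sum V u) \<and>
          (LINT x|lborel. cmod (op_sum V u x)) \<le> real (length V) * ((n + 1) * B * (J + 1))"
        if "set V \<subseteq> set ts" for V
        using that
      proof (induction V)
        case (Cons t V)
        have tin: "(fst t, snd t) \<in> set (foldr diff_terms s [(js, is)])"
          using Cons.prems by (auto simp: ts_def)
        have t: "integrable lborel (\<lambda>x. mono_deriv (fst t) (snd t) u x)"
          "(LINT x|lborel. cmod (mono_deriv (fst t) (snd t) u x)) \<le> (n + 1) * B * (J + 1)"
          using term_le[of "fst t" "snd t"] foldr_diff_terms[OF tin] s by auto
        have V: "integrable lborel (op_sum V u)"
          "(LINT x|lborel. cmod (op_sum V u x)) \<le> real (length V) * ((n + 1) * B * (J + 1))"
          using Cons by auto
        have eq: "op_sum (t # V) u = (\<lambda>x. mono_deriv (fst t) (snd t) u x + op_sum V u x)"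
          by (rule ext) simp
        have i: "integrable lborel (op_sum (t # V) u)"
          unfolding eq by (rule Bochner_Integration.integrable_add[OF t(1) V(1)])
        have "(LINT x|lborel. cmod (op_sum (t # V) u x))
            \<le> (LINT x|lborel. cmod (mono_deriv (fst t) (snd t) u x) + cmod (op_sum V u x))"
          unfolding eq using i[unfolded eq] t(1) V(1)
          by (intro Bochner_Integration.integral_mono norm_triangle_ineq
              Bochner_Integration.integrable_add integrable_norm)
        also have "\<dots> = (LINT x|lborel. cmod (mono_deriv (fst t) (snd t) u x))
            + (LINT x|lborel. cmod (op_sum V u x))"
          by (rule Bochner_Integration.integral_add[OF integrable_norm[OF t(1)] integrable_norm[OF V(1)]])
        finally show ?case using t V i by (simp add: algebra_simps)
      qed (simp add: op_sum_simps[abs_def])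
      then have 1: "integrable lborel (op_sum ts u)"
        "(LINT x|lborel. cmod (op_sum ts u x)) \<le> real (length ts) * ((n + 1) * B * (J + 1))" by auto
      have "length ts \<le> (1 + length js) ^ length s" unfolding ts_def by (rule length_foldr_diff_terms)
      also have "\<dots> \<le> (1 + length js) ^ ?N" using s by (intro power_increasing) auto
      finally have "real (length ts) \<le> real ((1 + length js) ^ ?N)" by (rule of_nat_mono)
      then have "real (length ts) \<le> p" by (simp add: p_def)
      then have "real (length ts) * ((n + 1) * B * (J + 1)) \<le> p * ((n + 1) * B * (J + 1))"
        using B J0 by (intro mult_right_mono) (auto simp: n_def)
      then show ?thesis using 1 unfolding ts by simp
    qed
    define M where "M = n * (p * ((n + 1) * B * (J + 1)))"
    have F_le: "cmod (fourier v \<xi>) \<le> M * (1 / poly_weight \<xi>)" for \<xi>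
    proof -
      have "poly_weight \<xi> * cmod (fourier v \<xi>) \<le> (\<Sum>w\<leftarrow>W. cmod (of_real (mono_word w \<xi>) * fourier v \<xi>))"
        by (rule poly_weight_cmod_le[OF W(2)])
      also have "\<dots> \<le> real (length W) * (p * ((n + 1) * B * (J + 1)))"
      proof (rule sum_list_le_const)
        fix w assume w: "w \<in> set W"
        have "cmod (of_real (mono_word w \<xi>) * fourier v \<xi>) = cmod (fourier (pderivs w v) \<xi>)"
          unfolding fourier_pderivs[OF v] by (simp add: norm_mult norm_power)
        also have "\<dots> \<le> (LINT x|lborel. cmod (pderivs w v x))" by (rule cmod_fourier_le)
        also have "\<dots> \<le> p * ((n + 1) * B * (J + 1))" using deriv_le[OF W(1)[OF w]] by simp
        finally show "cmod (of_real (mono_word w \<xi>) * fourier v \<xi>) \<le> p * ((n + 1) * B * (J + 1))" .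
      qed
      finally show ?thesis using poly_weight_pos[of \<xi>] by (simp add: M_def n_def pos_le_divide_eq mult.commute)
    qed
    have vc: "continuous_on UNIV v" unfolding v_def by (rule continuous_on_op_sum[OF sm])
    have Fm: "fourier v \<in> borel_measurable borel"
      by (intro fourier_measurable borel_measurable_continuous_onI vc)
    have Fi: "integrable lborel (fourier v)"
      by (rule integrable_poly_weight_bound[OF Fm, of M]) (use F_le in simp)
    obtain C' where C': "\<And>x. cmod (op_sum [(js, is)] u x) \<le> C' / poly_weight x"
      using op_sum_bound[OF u] by metis
    have "cmod (v x) \<le> c * (LINT \<xi>|lborel. cmod (fourier v \<xi>))"
      by (rule c(2)[OF vc C'[folded v_def] Fi])
    also have "\<dots> \<le> c * (LINT \<xi>|lborel. M * (1 / poly_weight (\<xi> :: real^'d)))"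
      using c(1) by (intro mult_left_mono Bochner_Integration.integral_mono F_le integrable_norm Fi
          integrable_mult_right integrable_inverse_poly_weight) auto
    also have "\<dots> = c * (M * J)" unfolding integral_mult_right_zero J_def ..
    also have "\<dots> = (K - 1) * p * B" by (simp add: M_def K_def)
    also have "\<dots> \<le> K * p * B" using p1 B by (intro mult_right_mono) auto
    finally show ?thesis unfolding v_def p_def by simp
  qed
  have "K > 0" unfolding K_def using c(1) J0 by (intro add_nonneg_pos mult_nonneg_nonneg) (auto simp: n_def)
  then show ?thesis by (rule that[OF _ main])
qed

section \<open>Estimates in \<open>L\<^sup>2\<close> by integration by parts\<close>

definition mixed_integral :: "'d list \<Rightarrow> 'd list \<Rightarrow> 'd list \<Rightarrow> (real^'d::finite \<Rightarrow> complex) \<Rightarrow> complex" where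
  "mixed_integral is js is' u =
     (LINT x|lborel. mono_deriv js is u x * cnj (pderivs is' u x))"

lemma mixed_integrand_bound:
  assumes "rapid u"
  obtains C where "C > 0"
    "\<And>x. cmod (mono_deriv js is u x * cnj (pderivs is' u x)) \<le> C / poly_weight x"
proof -
  obtain C1 where C1: "C1 > 0" "\<And>x. cmod (mono_deriv js is u x) \<le> C1 / poly_weight x"
    using rapid_bound[OF assms] by metis
  obtain C2 where C2: "C2 > 0" "\<And>x. cmod (mono_deriv [] is' u x) \<le> C2 / poly_weight x"
    using rapid_bound[OF assms] by metis
  have "cmod (mono_deriv js is u x * cnj (pderivs is' u x)) \<le> (C1 * C2) / poly_weight x" for x
  proof -
    have "C2 / poly_weight x \<le> C2 / 1"
      using C2(1) poly_weight_ge_1[of x] by (intro divide_left_mono) auto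
    then have "cmod (pderivs is' u x) \<le> C2" using C2(2)[of x] by simp
    then have "cmod (mono_deriv js is u x) * cmod (pderivs is' u x) \<le> C1 / poly_weight x * C2"
      using C1(1) by (intro mult_mono C1(2)) (auto simp: less_imp_le[OF poly_weight_pos])
    then show ?thesis by (simp add: norm_mult mult_ac)
  qed
  then show ?thesis using that[of "C1 * C2"] C1(1) C2(1) by simp
qed

lemma continuous_mixed:
  "smooth u \<Longrightarrow> continuous_on UNIV (\<lambda>x. mono_deriv js is u x * cnj (pderivs is' u x))"
  by (intro continuous_intros smooth_continuous)

lemma mixed_integrable:
  assumes "rapid u"
  shows "integrable lborel (\<lambda>x. mono_deriv js is u x * cnj (pderivs is' u x))"
proof -
  obtain C where "\<And>x. cmod (mono_deriv js is u x * cnj (pderivs is' u x)) \<le> C / poly_weight x"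
    using mixed_integrand_bound[OF assms] by metis
  then show ?thesis
    by (intro integrable_poly_weight_bound borel_measurable_continuous_onI continuous_mixed rapid_smooth assms)
qed

text \<open>The derivative of the integrand in direction \<open>i\<close> has integral \<open>0\<close>.\<close>

lemma mixed_integral_parts:
  assumes u: "rapid u"
  shows "mixed_integral (i # is) js is' u
    = - mixed_integral is js (i # is') u - (\<Sum>w\<leftarrow>delete_each i js. mixed_integral is w is' u)"
proof -
  define f where "f js is is' x = mono_deriv js is u x * cnj (pderivs is' u x)" for js "is" is' x
  have sm: "smooth u" by (rule rapid_smooth[OF u])
  have fi: "integrable lborel (f js is is')" for js "is" is'
    unfolding f_def by (rule mixed_integrable[OF u])
  have fm: "f js is is' \<in> borel_measurable borel" for js "is" is'
    unfolding f_def by (intro borel_measurable_continuous_onI continuous_mixed sm)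
  define g where "g V x = (\<Sum>w\<leftarrow>V. f w is is' x)" for V x
  have g: "integrable lborel (g V) \<and> (LINT x|lborel. g V x) = (\<Sum>w\<leftarrow>V. mixed_integral is w is' u)
      \<and> g V \<in> borel_measurable borel \<and> (\<exists>C>0. \<forall>x. cmod (g V x) \<le> C / poly_weight x)" for V
  proof (induction V)
    case Nil
    show ?case by (auto simp: g_def less_imp_le[OF poly_weight_pos] intro!: exI[of _ 1])
  next
    case (Cons w V)
    have eq: "g (w # V) = (\<lambda>x. f w is is' x + g V x)" by (simp add: g_def fun_eq_iff)
    obtain C where C: "C > 0" "\<And>x. cmod (g V x) \<le> C / poly_weight x" using Cons by auto
    obtain C' where C': "C' > 0" "\<And>x. cmod (f w is is' x) \<le> C' / poly_weight x"
      using mixed_integrand_bound[OF u] unfolding f_def by metis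
    have "cmod (g (w # V) x) \<le> (C' + C) / poly_weight x" for x
      unfolding eq using norm_triangle_le[OF add_mono[OF C'(2)[of x] C(2)[of x]]]
      by (simp add: add_divide_distrib)
    then have "\<exists>C>0. \<forall>x. cmod (g (w # V) x) \<le> C / poly_weight x"
      using C C' by (intro exI[of _ "C' + C"]) auto
    moreover have "g (w # V) \<in> borel_measurable borel" unfolding eq using Cons fm by auto
    moreover have "integrable lborel (g (w # V))" unfolding eq using Cons fi by auto
    moreover have "(LINT x|lborel. g (w # V) x) = mixed_integral is w is' u + (LINT x|lborel. g V x)"
      unfolding eq mixed_integral_def f_def[symmetric] using Cons fi
      by (intro Bochner_Integration.integral_add) auto
    ultimately show ?case using Cons by simp
  qed
  define V where "V = delete_each i js"
  define w' where "w' x = f js (i # is) is' x + (f js is (i # is') x + g V x)" for x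
  obtain C1 where C1: "\<And>x. cmod (f js (i # is) is' x) \<le> C1 / poly_weight x"
    using mixed_integrand_bound[OF u] unfolding f_def by metis
  obtain C2 where C2: "\<And>x. cmod (f js is (i # is') x) \<le> C2 / poly_weight x"
    using mixed_integrand_bound[OF u] unfolding f_def by metis
  obtain C3 where C3: "\<And>x. cmod (g V x) \<le> C3 / poly_weight x" using g by metis
  have "(LINT x|lborel. w' x) = 0"
  proof (rule integral_derivative_eq_0[where C="C1 + (C2 + C3)"])
    fix x :: "real^'a" and t :: real
    define y where "y = x + t *\<^sub>R axis i 1"
    have a: "((\<lambda>t. of_real (mono_word js (x + t *\<^sub>R axis i 1)) :: complex) has_vector_derivative
       of_real (\<Sum>w\<leftarrow>V. mono_word w y)) (at t)"
      using mono_word_has_derivative[of js x i t] unfolding y_def V_def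
      by (rule has_vector_derivative_of_real)
    have b: "((\<lambda>t. pderivs is u (x + t *\<^sub>R axis i 1)) has_vector_derivative pderivs (i # is) u y) (at t)"
      unfolding y_def by (rule smooth_has_derivative[OF sm])
    have c: "((\<lambda>t. cnj (pderivs is' u (x + t *\<^sub>R axis i 1))) has_vector_derivative cnj (pderivs (i # is') u y)) (at t)"
      unfolding y_def
      by (rule bounded_linear.has_vector_derivative[OF bounded_linear_cnj smooth_has_derivative[OF sm]])
    have "of_real (\<Sum>w\<leftarrow>V. mono_word w y) * pderivs is u y * cnj (pderivs is' u y) = g V y" for V
      unfolding g_def f_def by (induction V) (auto simp: algebra_simps)
    then have "mono_deriv js is u y * cnj (pderivs (i # is') u y)
        + (mono_deriv js (i # is) u y + of_real (\<Sum>w\<leftarrow>V. mono_word w y) * pderivs is u y)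
          * cnj (pderivs is' u y) = w' y"
      unfolding w'_def f_def by (simp add: algebra_simps)
    then show "((\<lambda>t. f js is is' (x + t *\<^sub>R axis i 1)) has_vector_derivative w' (x + t *\<^sub>R axis i 1)) (at t)"
      using has_vector_derivative_mult[OF has_vector_derivative_mult[OF a b] c]
      unfolding f_def y_def[symmetric] by simp
  next
    show "integrable lborel (f js is is')" by (rule fi)
    show "cmod (w' x) \<le> (C1 + (C2 + C3)) / poly_weight x" for x
      unfolding w'_def add_divide_distrib
      by (intro norm_triangle_le[OF add_mono] C1 C2 C3)
    show "w' \<in> borel_measurable borel" unfolding w'_def using fm g[of V] by auto
  qed
  moreover have "(LINT x|lborel. w' x) = mixed_integral (i # is) js is' u
      + (mixed_integral is js (i # is') u + (\<Sum>w\<leftarrow>V. mixed_integral is w is' u))"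
  proof -
    have gi: "integrable lborel (g V)" using g by blast
    have "(LINT x|lborel. w' x) = (LINT x|lborel. f js (i # is) is' x)
        + ((LINT x|lborel. f js is (i # is') x) + (LINT x|lborel. g V x))"
      unfolding w'_def
      unfolding Bochner_Integration.integral_add[OF fi Bochner_Integration.integrable_add[OF fi gi]]
        Bochner_Integration.integral_add[OF fi gi] ..
    then show ?thesis using g[of V] unfolding mixed_integral_def f_def by simp
  qed
  ultimately have "mixed_integral (i # is) js is' u
      + (mixed_integral is js (i # is') u + (\<Sum>w\<leftarrow>V. mixed_integral is w is' u)) = 0" by simp
  then show ?thesis unfolding V_def by (simp add: add_eq_0_iff2)
qed

text \<open>Each integration by parts moves a derivative across, or consumes it together with one factor of the
  monomial. The second case shortens the words by two letters and offers a choice of at most \<open>length js\<close>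
  factors; hence the growth condition on \<open>G\<close>.\<close>

lemma mixed_integral_le:
  assumes u: "rapid u"
    and base: "\<And>js is'. cmod (mixed_integral [] js is' u) \<le> C * G (length js + length is')"
    and C: "0 \<le> C" and G0: "\<And>n. 0 \<le> G n" and G: "\<And>n. real (Suc n) * G n \<le> G (Suc n)"
  shows "cmod (mixed_integral is js is' u) \<le> C * 2 ^ length is * G (length is + length js + length is')"
proof (induction "is" arbitrary: js is')
  case Nil
  then show ?case using base[of js is'] by simp
next
  case (Cons i "is")
  let ?N = "length is + length js + length is'"
  have mono: "G n \<le> G (Suc n)" for n
    using G[of n] mult_right_mono[OF _ G0[of n], of 1 "real (Suc n)"] by simp
  have w_le: "cmod (mixed_integral is w is' u) \<le> C * 2 ^ length is * G (?N - 1)"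
    if "w \<in> set (delete_each i js)" for w
  proof -
    have "length is + length w + length is' = ?N - 1" using length_in_delete_each[OF that] by simp
    then show ?thesis using Cons.IH[of w is'] by simp
  qed
  have "cmod (\<Sum>w\<leftarrow>V. mixed_integral is w is' u) \<le> (\<Sum>w\<leftarrow>V. cmod (mixed_integral is w is' u))" for V
    by (induction V) (auto intro: order_trans[OF norm_triangle_ineq])
  then have "cmod (\<Sum>w\<leftarrow>delete_each i js. mixed_integral is w is' u)
      \<le> real (length (delete_each i js)) * (C * 2 ^ length is * G (?N - 1))"
    by (rule order_trans[OF _ sum_list_le_const[OF w_le]])
  also have "\<dots> \<le> C * 2 ^ length is * G (Suc ?N)"
  proof (cases "js = []")
    case True
    then show ?thesis using C G0 by simp
  next
    case False
    then obtain k where k: "?N = Suc k" by (cases js) auto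
    have "real (length (delete_each i js)) * G k \<le> real (Suc k) * G k"
      using length_delete_each[of i js] k by (intro mult_right_mono G0) auto
    also have "\<dots> \<le> G (Suc k)" by (rule G)
    also have "\<dots> \<le> G (Suc ?N)" using mono k by simp
    finally have "(C * 2 ^ length is) * (real (length (delete_each i js)) * G k) \<le> (C * 2 ^ length is) * G (Suc ?N)"
      using C by (intro mult_left_mono) auto
    then show ?thesis using k by (simp add: mult_ac)
  qed
  finally have 1: "cmod (\<Sum>w\<leftarrow>delete_each i js. mixed_integral is w is' u) \<le> C * 2 ^ length is * G (Suc ?N)" .
  have 2: "cmod (mixed_integral is js (i # is') u) \<le> C * 2 ^ length is * G (Suc ?N)"
    using Cons.IH[of js "i # is'"] by simp
  have "cmod (mixed_integral (i # is) js is' u)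
      \<le> cmod (mixed_integral is js (i # is') u) + cmod (\<Sum>w\<leftarrow>delete_each i js. mixed_integral is w is' u)"
    unfolding mixed_integral_parts[OF u] using norm_triangle_ineq4[of "- mixed_integral is js (i # is') u"] by simp
  then show ?case using 1 2 by simp
qed

lemma integral_square_eq_mixed:
  "complex_of_real (L2_square js is u)
    = mixed_integral is (js @ js) is u"
  unfolding mixed_integral_def integral_complex_of_real[symmetric] complex_norm_square
  by (intro Bochner_Integration.integral_cong refl) (simp add: mult_ac)

section \<open>The elements of \<open>S_omega\<close>\<close>

context doubling_weight
begin

abbreviation M :: "nat \<Rightarrow> real" where "M \<equiv> weight_seq \<omega> 1"

text \<open>\<open>H\<close> bounds the norm of \<open>u\<close> at the scale \<open>A\<close>, in three versions: with the \<open>L\<^sup>2\<close>-norm, with the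
  supremum, and with the supremum weighted by \<open>poly_weight\<close>.\<close>

definition L2_bounded :: "real \<Rightarrow> real \<Rightarrow> (real^'d::finite \<Rightarrow> complex) \<Rightarrow> bool" where
  "L2_bounded A H u \<longleftrightarrow> (\<forall>js is. (L2_square js is u)
     \<le> (H * M (length js + length is) / A ^ (length js + length is))\<^sup>2)"

definition sup_bounded :: "real \<Rightarrow> real \<Rightarrow> (real^'d::finite \<Rightarrow> complex) \<Rightarrow> bool" where
  "sup_bounded A H u \<longleftrightarrow> (\<forall>js is x. cmod (mono_deriv js is u x)
     \<le> H * M (length js + length is) / A ^ (length js + length is))"

definition weighted_sup_bounded :: "real \<Rightarrow> real \<Rightarrow> (real^'d::finite \<Rightarrow> complex) \<Rightarrow> bool" where
  "weighted_sup_bounded A H u \<longleftrightarrow> (\<forall>js is x. cmod (mono_deriv js is u x)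
     \<le> H * M (length js + length is) / A ^ (length js + length is) * (1 / poly_weight x))"

lemma S_omega_smooth: "u \<in> S_omega \<omega> \<Longrightarrow> smooth u"
  by (simp add: S_omega_def)

lemma le_exp_minus: "exp a * c \<le> K \<Longrightarrow> c \<le> K * exp (- a)" for a c K :: real
  by (simp add: exp_minus field_simps)

lemma S_omega_decay:
  assumes "u \<in> S_omega \<omega>" "\<mu> > 0"
  obtains C where "C > 0" "\<And>x. cmod (pderivs is u x) \<le> C * exp (- \<mu> * \<omega> (norm x))"
proof -
  have "bdd_above (range (\<lambda>x. exp (\<mu> * \<omega> (norm x)) * cmod (D (count_list is) u x)))"
  proof -
    have "\<forall>\<mu>>0. \<forall>\<alpha>. bdd_above (range (\<lambda>x. exp (\<mu> * \<omega> (norm x)) * cmod (D \<alpha> u x)))"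
      using assms(1) by (simp add: S_omega_def)
    from this[rule_format, OF assms(2)] show ?thesis .
  qed
  then obtain C where C: "\<And>x. exp (\<mu> * \<omega> (norm x)) * cmod (D (count_list is) u x) \<le> C"
    by (auto simp: bdd_above_def)
  have "cmod (pderivs is u x) \<le> (\<bar>C\<bar> + 1) * exp (- \<mu> * \<omega> (norm x))" for x
  proof -
    have "exp (\<mu> * \<omega> (norm x)) * cmod (pderivs is u x) \<le> \<bar>C\<bar> + 1"
      using C[of x] cmod_D_eq[OF S_omega_smooth[OF assms(1)], of "is" "count_list is" x] by simp
    then show ?thesis unfolding mult_minus_left by (rule le_exp_minus)
  qed
  then show ?thesis using that[of "\<bar>C\<bar> + 1"] by simp
qed

lemma S_omega_fourier_decay:
  assumes "u \<in> S_omega \<omega>" "\<mu> > 0"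
  obtains C where "C > 0" "\<And>\<xi>. cmod (fourier u \<xi>) \<le> C * exp (- \<mu> * \<omega> (norm \<xi>))"
proof -
  have "bdd_above (range (\<lambda>x. exp (\<mu> * \<omega> (norm x)) * cmod (D (count_list []) (fourier u) x)))"
  proof -
    have "\<forall>\<mu>>0. \<forall>\<alpha>. bdd_above (range (\<lambda>x. exp (\<mu> * \<omega> (norm x)) * cmod (D \<alpha> (fourier u) x)))"
      using assms(1) by (simp add: S_omega_def)
    from this[rule_format, OF assms(2)] show ?thesis .
  qed
  then obtain C where C: "\<And>x. exp (\<mu> * \<omega> (norm x)) * cmod (D (count_list []) (fourier u) x) \<le> C"
    by (auto simp: bdd_above_def)
  have sm: "smooth (fourier u)" using assms by (simp add: S_omega_def)
  have "cmod (fourier u x) \<le> (\<bar>C\<bar> + 1) * exp (- \<mu> * \<omega> (norm x))" for x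
  proof -
    have "exp (\<mu> * \<omega> (norm x)) * cmod (fourier u x) \<le> \<bar>C\<bar> + 1"
      using C[of x] cmod_D_eq[OF sm, of "[]" "count_list []" x] by simp
    then show ?thesis unfolding mult_minus_left by (rule le_exp_minus)
  qed
  then show ?thesis using that[of "\<bar>C\<bar> + 1"] by simp
qed

lemma S_omega_rapid:
  assumes "u \<in> S_omega \<omega>"
  shows "rapid u"
  unfolding rapid_def
proof (intro conjI allI S_omega_smooth[OF assms])
  fix "is" js :: "'a list"
  obtain C where C: "C > 0" "\<And>x. cmod (pderivs is u x) \<le> C * exp (- 1 * \<omega> (norm x))"
    using S_omega_decay[OF assms zero_less_one] by metis
  obtain c where c: "c > 0" "\<And>r. r \<ge> 0 \<Longrightarrow> (1 + r) ^ length js \<le> c * exp (1 * \<omega> r)"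
    using power_le_exp_weight[OF zero_less_one] by metis
  have "cmod (mono_deriv js is u x) \<le> c * C" for x
  proof -
    have "\<bar>mono_word js x\<bar> \<le> (1 + norm x) ^ length js"
      by (rule order_trans[OF abs_mono_word_le]) (intro power_mono, auto)
    also have "\<dots> \<le> c * exp (1 * \<omega> (norm x))" by (rule c) simp
    finally have "\<bar>mono_word js x\<bar> * cmod (pderivs is u x)
        \<le> (c * exp (1 * \<omega> (norm x))) * (C * exp (- 1 * \<omega> (norm x)))"
      using c by (intro mult_mono C) auto
    also have "\<dots> = c * C * (exp (1 * \<omega> (norm x)) * exp (- 1 * \<omega> (norm x)))" by (simp only: mult_ac)
    also have "exp (1 * \<omega> (norm x)) * exp (- 1 * \<omega> (norm x)) = 1" by (simp flip: exp_add)
    finally show ?thesis by (simp add: norm_mult)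
  qed
  then show "\<exists>C. \<forall>x. cmod (mono_deriv js is u x) \<le> C" by blast
qed

lemma exp_weight_le_poly_weight:
  obtains c where "c > 0" "\<And>x::real^'d::finite. exp (- \<omega> (norm x)) \<le> c / poly_weight x"
proof -
  obtain c where c: "c > 0" "\<And>r. r \<ge> 0 \<Longrightarrow> (1 + r) ^ (2 * CARD('d)) \<le> c * exp (1 * \<omega> r)"
    using power_le_exp_weight[OF zero_less_one] by metis
  have "exp (- \<omega> (norm x)) \<le> c / poly_weight x" for x :: "real^'d"
  proof -
    have "poly_weight x \<le> (\<Prod>i\<in>(UNIV::'d set). (1 + norm x)\<^sup>2)"
      unfolding poly_weight_def
    proof (intro prod_mono conjI)
      fix i
      have "(x $ i)\<^sup>2 \<le> (norm x)\<^sup>2"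
        using component_le_norm_cart[of x i] by (metis abs_le_square_iff abs_norm_cancel)
      then show "1 + (x $ i)\<^sup>2 \<le> (1 + norm x)\<^sup>2"
        using add_mono[of "(x $ i)\<^sup>2" "(norm x)\<^sup>2" 0 "2 * norm x"] by (simp add: power2_sum)
    qed auto
    also have "\<dots> = (1 + norm x) ^ (2 * CARD('d))" by (simp add: power_mult)
    also have "\<dots> \<le> c * exp (\<omega> (norm x))" using c(2)[of "norm x"] by simp
    finally have "exp (- \<omega> (norm x)) * poly_weight x \<le> exp (- \<omega> (norm x)) * (c * exp (\<omega> (norm x)))"
      by (intro mult_left_mono) auto
    also have "\<dots> = c" by (simp add: exp_minus)
    finally show ?thesis using poly_weight_pos[of x] by (simp add: pos_le_divide_eq)
  qed
  then show ?thesis using that c(1) by blast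
qed

text \<open>One unit of \<open>\<omega>\<close> in the exponent is set aside to produce an integrable factor.\<close>

lemma monomial_exp_weight_bound:
  assumes "\<nu> > 0" and c: "\<And>x::real^'d::finite. exp (- \<omega> (norm x)) \<le> c / poly_weight x"
  shows "\<bar>mono_word js (x::real^'d)\<bar> * exp (- (\<nu> + 1) * \<omega> (norm x))
    \<le> exp (\<nu> * \<omega> 1) * weight_seq \<omega> \<nu> (length js) * c / poly_weight x"
proof -
  have "\<bar>mono_word js x\<bar> * exp (- (\<nu> + 1) * \<omega> (norm x))
      = (\<bar>mono_word js x\<bar> * exp (- \<nu> * \<omega> (norm x))) * exp (- \<omega> (norm x))"
    by (simp add: mult.assoc algebra_simps flip: exp_add)
  also have "\<dots> \<le> (norm x ^ length js * exp (- \<nu> * \<omega> (norm x))) * (c / poly_weight x)"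
    by (intro mult_mono c mult_right_mono abs_mono_word_le) auto
  also have "\<dots> \<le> (exp (\<nu> * \<omega> 1) * weight_seq \<omega> \<nu> (length js)) * (c / poly_weight x)"
  proof (intro mult_right_mono weight_seq_lower_all assms)
    have "0 \<le> exp (- \<omega> (norm x))" by simp
    then show "0 \<le> c / poly_weight x" using c order_trans by blast
  qed simp
  finally show ?thesis by simp
qed

text \<open>By Fourier inversion, \<open>cmod (pderivs is u x)\<close> is at most a constant times the integral of
  \<open>\<bar>mono_word is \<xi>\<bar> * cmod (fourier u \<xi>)\<close>, and the decay of the transform turns the monomial into \<open>weight_seq\<close>.\<close>

lemma pderivs_bound:
  fixes u :: "real^'d::finite \<Rightarrow> complex"
  assumes u: "u \<in> S_omega \<omega>" and A: "A \<ge> 1"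
  obtains C where "C > 0" "\<And>is x. cmod (pderivs is u x) * A ^ length is \<le> C * M (length is)"
proof -
  obtain \<nu> C1 where \<nu>: "\<nu> > 0" "C1 > 0" "\<And>n. A ^ n * weight_seq \<omega> \<nu> n \<le> C1 * M n"
    using weight_seq_geometric[OF zero_less_one, of A] by blast
  obtain c where c: "c > 0" "\<And>x::real^'d. exp (- \<omega> (norm x)) \<le> c / poly_weight x"
    using exp_weight_le_poly_weight by metis
  have n1: "\<nu> + 1 > 0" using \<nu> by simp
  obtain C2 where C2: "C2 > 0" "\<And>\<xi>. cmod (fourier u \<xi>) \<le> C2 * exp (- (\<nu> + 1) * \<omega> (norm \<xi>))"
    using S_omega_fourier_decay[OF u n1] by metis
  obtain c' where c': "c' > 0" "\<And>(v :: real^'d \<Rightarrow> complex) C x. continuous_on UNIV v \<Longrightarrow>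
    (\<And>x. cmod (v x) \<le> C / poly_weight x) \<Longrightarrow> integrable lborel (fourier v) \<Longrightarrow>
    cmod (v x) \<le> c' * (LINT \<xi>|lborel. cmod (fourier v \<xi>))"
    using cmod_le_fourier_L1[where 'd='d] by metis
  define J where "J = (LINT x|lborel. 1 / poly_weight (x :: real^'d))"
  have J0: "J \<ge> 0" unfolding J_def
    by (intro integral_nonneg_AE AE_I2) (auto simp: less_imp_le[OF poly_weight_pos])
  define K where "K = exp (\<nu> * \<omega> 1) * c * C2"
  have K: "K > 0" using c C2 by (simp add: K_def)
  have r: "rapid u" by (rule S_omega_rapid[OF u])
  have main: "cmod (pderivs is u x) * A ^ length is \<le> (c' * K * J * C1 + 1) * M (length is)" for "is" x
  proof -
    define v where "v = pderivs is u"
    have rv: "rapid v" unfolding v_def by (rule rapid_pderivs[OF r])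
    have vc: "continuous_on UNIV v" using smooth_continuous[OF rapid_smooth[OF rv], of UNIV "[]"] by simp
    have F: "cmod (fourier v \<xi>) \<le> (K * weight_seq \<omega> \<nu> (length is)) * (1 / poly_weight \<xi>)" for \<xi>
    proof -
      have "cmod (fourier v \<xi>) = \<bar>mono_word is \<xi>\<bar> * cmod (fourier u \<xi>)"
        unfolding v_def fourier_pderivs[OF r] by (simp add: norm_mult norm_power)
      also have "\<dots> \<le> \<bar>mono_word is \<xi>\<bar> * (C2 * exp (- (\<nu> + 1) * \<omega> (norm \<xi>)))"
        by (intro mult_left_mono C2) auto
      also have "\<dots> = C2 * (\<bar>mono_word is \<xi>\<bar> * exp (- (\<nu> + 1) * \<omega> (norm \<xi>)))" by (simp only: mult_ac)
      also have "\<dots> \<le> C2 * (exp (\<nu> * \<omega> 1) * weight_seq \<omega> \<nu> (length is) * c / poly_weight \<xi>)"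
        using C2 by (intro mult_left_mono monomial_exp_weight_bound \<nu> c) auto
      finally show ?thesis by (simp add: K_def mult_ac)
    qed
    have Fm: "fourier v \<in> borel_measurable borel"
      by (intro fourier_measurable borel_measurable_continuous_onI vc)
    have Fi: "integrable lborel (fourier v)"
      by (rule integrable_poly_weight_bound[OF Fm]) (use F in simp)
    obtain C where C: "\<And>x. cmod (mono_deriv [] is u x) \<le> C / poly_weight x"
      using rapid_bound[OF r] by metis
    have "cmod (v x) \<le> c' * (LINT \<xi>|lborel. cmod (fourier v \<xi>))"
      by (rule c'(2)[OF vc _ Fi, of C]) (use C in \<open>simp add: v_def\<close>)
    also have "\<dots> \<le> c' * (LINT \<xi>|lborel. (K * weight_seq \<omega> \<nu> (length is)) * (1 / poly_weight (\<xi>::real^'d)))"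
      using c'(1) by (intro mult_left_mono Bochner_Integration.integral_mono F integrable_norm Fi
          integrable_mult_right integrable_inverse_poly_weight) auto
    also have "\<dots> = c' * ((K * weight_seq \<omega> \<nu> (length is)) * J)" unfolding integral_mult_right_zero J_def ..
    finally have "cmod (v x) * A ^ length is \<le> (c' * ((K * weight_seq \<omega> \<nu> (length is)) * J)) * A ^ length is"
      using A by (intro mult_right_mono) auto
    also have "\<dots> = (c' * K * J) * (A ^ length is * weight_seq \<omega> \<nu> (length is))" by (simp only: mult_ac)
    also have "\<dots> \<le> (c' * K * J) * (C1 * M (length is))"
      using c'(1) K J0 by (intro mult_left_mono \<nu>(3)) auto
    also have "\<dots> \<le> (c' * K * J * C1 + 1) * M (length is)"
      using weight_seq_pos[of 1 "length is"] by (simp add: algebra_simps)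
    finally show ?thesis unfolding v_def .
  qed
  have "c' * K * J * C1 + 1 > 0" using c'(1) K J0 \<nu>(2) by (intro add_nonneg_pos) auto
  then show ?thesis using main by (rule that)
qed

lemma mono_word_bound:
  fixes u :: "real^'d::finite \<Rightarrow> complex"
  assumes u: "u \<in> S_omega \<omega>" and A: "A \<ge> 1"
  obtains C where "C > 0"
    "\<And>js x. cmod (of_real (mono_word js x) * u x) * A ^ length js \<le> C * M (length js) * (1 / poly_weight x)"
proof -
  obtain \<nu> C1 where \<nu>: "\<nu> > 0" "C1 > 0" "\<And>n. A ^ n * weight_seq \<omega> \<nu> n \<le> C1 * M n"
    using weight_seq_geometric[OF zero_less_one, of A] by blast
  obtain c where c: "c > 0" "\<And>x::real^'d. exp (- \<omega> (norm x)) \<le> c / poly_weight x"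
    using exp_weight_le_poly_weight by metis
  have n1: "\<nu> + 1 > 0" using \<nu> by simp
  obtain C2 where C2: "C2 > 0" "\<And>x. cmod (pderivs [] u x) \<le> C2 * exp (- (\<nu> + 1) * \<omega> (norm x))"
    using S_omega_decay[OF u n1] by metis
  define K where "K = exp (\<nu> * \<omega> 1) * c * C2"
  have K: "K > 0" using c C2 by (simp add: K_def)
  have "cmod (of_real (mono_word js x) * u x) * A ^ length js \<le> (K * C1) * M (length js) * (1 / poly_weight x)" for js x
  proof -
    have "cmod (of_real (mono_word js x) * u x) \<le> \<bar>mono_word js x\<bar> * (C2 * exp (- (\<nu> + 1) * \<omega> (norm x)))"
      using mult_left_mono[OF C2(2)[of x], of "\<bar>mono_word js x\<bar>"] by (simp add: norm_mult)
    also have "\<dots> = C2 * (\<bar>mono_word js x\<bar> * exp (- (\<nu> + 1) * \<omega> (norm x)))" by (simp only: mult_ac)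
    also have "\<dots> \<le> C2 * (exp (\<nu> * \<omega> 1) * weight_seq \<omega> \<nu> (length js) * c / poly_weight x)"
      using C2 by (intro mult_left_mono monomial_exp_weight_bound \<nu> c) auto
    also have "\<dots> = K * weight_seq \<omega> \<nu> (length js) * (1 / poly_weight x)" by (simp add: K_def mult_ac)
    finally have "cmod (of_real (mono_word js x) * u x) * A ^ length js
        \<le> (K * weight_seq \<omega> \<nu> (length js) * (1 / poly_weight x)) * A ^ length js"
      using A by (intro mult_right_mono) auto
    also have "\<dots> = (K * (1 / poly_weight x)) * (A ^ length js * weight_seq \<omega> \<nu> (length js))" by (simp only: mult_ac)
    also have "\<dots> \<le> (K * (1 / poly_weight x)) * (C1 * M (length js))"
      using K less_imp_le[OF poly_weight_pos[of x]] by (intro mult_left_mono \<nu>(3)) auto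
    finally show ?thesis by (simp add: mult_ac)
  qed
  then show ?thesis using that[of "K * C1"] K \<nu>(2) by simp
qed


text \<open>Integration by parts in \<open>mixed_integral is (js @ js) is u\<close> leads back to \<open>pderivs_bound\<close> and
  \<open>mono_word_bound\<close>. The sequence \<open>G\<close> satisfies \<open>G (Suc n) = Suc n * G n + m (Suc n)\<close>, so that it is a
  majorant of \<open>m\<close> to which \<open>mixed_integral_le\<close> applies; it exceeds \<open>m\<close> only by a geometric factor, because the
  factorials in it are dominated by \<open>m\<close>.\<close>

lemma S_omega_L2_bound:
  fixes u :: "real^'d::finite \<Rightarrow> complex"
  assumes u: "u \<in> S_omega \<omega>" and A: "A \<ge> 1"
  shows "\<exists>C>0. L2_bounded A C u"
proof -
  obtain b Cb where b: "b \<ge> 1" "Cb > 0" "\<And>n. M (2 * n) \<le> (Cb * b ^ n * M n)\<^sup>2"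
    using weight_seq_double by blast
  \<comment> \<open>The factors \<open>2 ^ n\<close> and \<open>4 ^ (2 * n)\<close> from \<open>T\<close> and \<open>G_le\<close> multiply to \<open>32 ^ n \<le> (6 ^ n)\<^sup>2\<close>.\<close>
  define a where "a = 6 * b * A"
  have "6 * 1 * 1 \<le> 6 * b * A" using A b(1) by (intro mult_mono) auto
  then have a: "a \<ge> 1" unfolding a_def by linarith
  have r: "rapid u" by (rule S_omega_rapid[OF u])
  obtain C1 where C1: "C1 > 0" "\<And>is x. cmod (pderivs is u x) * a ^ length is \<le> C1 * M (length is)"
    using pderivs_bound[OF u a] by metis
  obtain C2 where C2: "C2 > 0"
    "\<And>js x. cmod (of_real (mono_word js x) * u x) * a ^ length js \<le> C2 * M (length js) * (1 / poly_weight x)"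
    using mono_word_bound[OF u a] by metis
  obtain C3 where C3: "C3 > 0" "\<And>k. fact k * a ^ k \<le> C3 * M k"
    using fact_le_weight_seq[OF a] by blast
  define m where "m n = M n / a ^ n" for n
  have m0: "0 < m n" for n using weight_seq_pos[of 1 n] a by (simp add: m_def)
  have m_mult: "m k * m l \<le> m (k + l)" for k l
    using weight_seq_mult_le[of 1 k l] a unfolding m_def by (simp add: power_add divide_right_mono)
  define G where "G n = (\<Sum>k\<le>n. fact n / fact k * m k)" for n
  have G_Suc: "G (Suc n) = real (Suc n) * G n + m (Suc n)" for n
    unfolding G_def by (simp add: sum_distrib_left mult_ac)
  have G0: "0 \<le> G n" for n unfolding G_def using m0 by (intro sum_nonneg) (simp add: less_imp_le)
  have mG: "m n \<le> G n" for n
    unfolding G_def using m0 member_le_sum[of n "{..n}" "\<lambda>k. fact n / fact k * m k"] by (simp add: less_imp_le)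
  have G_le: "G n \<le> C3 * 4 ^ n * m n" for n
  proof -
    have "fact n / fact k * m k \<le> C3 * 2 ^ n * m n" if k: "k \<le> n" for k
    proof -
      have "fact n / fact k = real (n choose k) * fact (n - k)"
        using binomial_fact[OF k, where 'a=real] by simp
      also have "\<dots> \<le> 2 ^ n * fact (n - k)"
        using of_nat_mono[OF binomial_le_pow2[of n k], where 'a=real] by (intro mult_right_mono) auto
      also have "\<dots> \<le> 2 ^ n * (C3 * m (n - k))"
        using C3(2)[of "n - k"] a by (intro mult_left_mono) (auto simp: m_def pos_le_divide_eq)
      finally have "fact n / fact k * m k \<le> 2 ^ n * (C3 * m (n - k)) * m k"
        using m0[of k] by (intro mult_right_mono) auto
      also have "\<dots> = C3 * 2 ^ n * (m (n - k) * m k)" by (simp only: mult_ac)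
      also have "\<dots> \<le> C3 * 2 ^ n * m n"
        using m_mult[of "n - k" k] k C3(1) by (intro mult_left_mono) auto
      finally show ?thesis .
    qed
    then have "G n \<le> (\<Sum>k\<le>n. C3 * 2 ^ n * m n)" unfolding G_def by (intro sum_mono) auto
    also have "\<dots> = real (Suc n) * (C3 * 2 ^ n * m n)" by simp
    also have "\<dots> \<le> 2 ^ n * (C3 * 2 ^ n * m n)"
    proof (intro mult_right_mono)
      have "Suc n \<le> 2 ^ n" by (simp add: Suc_leI)
      then have "real (Suc n) \<le> real (2 ^ n)" by (rule of_nat_mono)
      then show "real (Suc n) \<le> 2 ^ n" by simp
    qed (use C3 m0[of n] in auto)
    also have "\<dots> = C3 * 4 ^ n * m n"
      using power_mult_distrib[of "2::real" 2 n] by simp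
    finally show ?thesis .
  qed
  define J where "J = (LINT x|lborel. 1 / poly_weight (x :: real^'d))"
  have J0: "J \<ge> 0" unfolding J_def
    by (intro integral_nonneg_AE AE_I2) (auto simp: less_imp_le[OF poly_weight_pos])
  define C0 where "C0 = C1 * C2 * J"
  have C0: "C0 \<ge> 0" using C1 C2 J0 by (simp add: C0_def)
  have base: "cmod (mixed_integral [] js is' u) \<le> C0 * G (length js + length is')" for js is'
  proof -
    have pt: "cmod (mono_deriv js [] u x * cnj (pderivs is' u x))
        \<le> (C2 * m (length js)) * (C1 * m (length is')) * (1 / poly_weight x)" for x
    proof -
      have 1: "cmod (of_real (mono_word js x) * u x) \<le> C2 * m (length js) * (1 / poly_weight x)"
      proof -
        have "cmod (of_real (mono_word js x) * u x) * a ^ length js / a ^ length js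
            \<le> C2 * M (length js) * (1 / poly_weight x) / a ^ length js"
          using a by (intro divide_right_mono C2) auto
        then show ?thesis using a unfolding m_def by (simp add: mult.commute)
      qed
      have 2: "cmod (pderivs is' u x) \<le> C1 * m (length is')"
        using C1(2)[of is' x] a unfolding m_def by (simp add: pos_le_divide_eq)
      have "cmod (of_real (mono_word js x) * u x) * cmod (pderivs is' u x)
          \<le> (C2 * m (length js) * (1 / poly_weight x)) * (C1 * m (length is'))"
        using C2(1) less_imp_le[OF m0] less_imp_le[OF poly_weight_pos[of x]] by (intro mult_mono 1 2) auto
      then show ?thesis by (simp add: norm_mult mult_ac)
    qed
    have "cmod (mixed_integral [] js is' u)
        \<le> (LINT x|lborel. (C2 * m (length js)) * (C1 * m (length is')) * (1 / poly_weight (x::real^'d)))"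
      unfolding mixed_integral_def
      by (rule order_trans[OF Bochner_Integration.integral_norm_bound],
          intro Bochner_Integration.integral_mono pt integrable_norm mixed_integrable r
            integrable_mult_right integrable_inverse_poly_weight)
    also have "\<dots> = C0 * (m (length js) * m (length is'))"
      unfolding integral_mult_right_zero C0_def J_def by (simp only: mult_ac)
    also have "\<dots> \<le> C0 * G (length js + length is')"
      using C0 order_trans[OF m_mult mG] by (intro mult_left_mono) auto
    finally show ?thesis .
  qed
  have T: "cmod (mixed_integral is js is' u) \<le> C0 * 2 ^ length is * G (length is + length js + length is')" for "is" js is'
    by (rule mixed_integral_le[OF r base C0 G0]) (use G_Suc m0 in \<open>simp add: less_imp_le\<close>)
  define K where "K = sqrt (C0 * C3) * Cb + 1"
  have "(L2_square js is u)
    \<le> (K * M (length js + length is) / A ^ (length js + length is))\<^sup>2" for js "is"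
  proof -
    define n where "n = length js + length is"
    let ?I = "LINT x|lborel. (cmod (mono_deriv js is u x))\<^sup>2"
    have len: "length is + length (js @ js) + length is = 2 * n" by (simp add: n_def)
    have "?I \<le> cmod (complex_of_real ?I)" by simp
    also have "\<dots> \<le> C0 * 2 ^ length is * G (2 * n)"
      unfolding integral_square_eq_mixed using T[of "is" "js @ js" "is"] unfolding len .
    also have "\<dots> \<le> C0 * 2 ^ n * (C3 * 4 ^ (2 * n) * m (2 * n))"
      using C0 G0 G_le[of "2 * n"] by (intro mult_mono power_increasing) (auto simp: n_def)
    also have "\<dots> = (C0 * C3) * 32 ^ n * (M (2 * n) / a ^ (2 * n))"
      by (simp add: m_def power_mult flip: power_mult_distrib)
    also have "\<dots> \<le> (C0 * C3) * 36 ^ n * ((Cb * b ^ n * M n)\<^sup>2 / a ^ (2 * n))"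
      using C0 C3 b(3)[of n] a weight_seq_pos[of 1 "2 * n"]
      by (intro mult_mono divide_right_mono power_mono) (auto simp: less_imp_le)
    also have "\<dots> = (sqrt (C0 * C3) * Cb * M n / A ^ n)\<^sup>2"
    proof -
      have "a ^ (2 * n) = 36 ^ n * (b ^ n)\<^sup>2 * (A ^ n)\<^sup>2"
        unfolding a_def power_mult_distrib power_even_eq[of b] power_even_eq[of A]
        by (simp add: power_mult[of 6 2 n])
      moreover have "b \<noteq> 0" "A \<noteq> 0" using b A by auto
      ultimately show ?thesis using C0 C3(1) by (simp add: power_mult_distrib power_divide)
    qed
    also have "\<dots> \<le> (K * M n / A ^ n)\<^sup>2"
    proof (intro power_mono divide_right_mono mult_right_mono)
      show "0 \<le> sqrt (C0 * C3) * Cb * M n / A ^ n"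
        using C0 C3(1) b(2) A weight_seq_pos[of 1 n] by (intro divide_nonneg_nonneg mult_nonneg_nonneg) auto
    qed (use A weight_seq_pos[of 1 n] in \<open>auto simp: K_def\<close>)
    finally show ?thesis unfolding n_def .
  qed
  then have "L2_bounded A K u" unfolding L2_bounded_def by blast
  moreover have "K > 0" unfolding K_def using C0 C3(1) b(2) by (intro add_nonneg_pos mult_nonneg_nonneg) auto
  ultimately show ?thesis by blast
qed

text \<open>The loss in passing from \<open>L\<^sup>2\<close>-norms to suprema is geometric, with a ratio \<open>\<kappa>\<close> that does not
  depend on the scale \<open>A\<close>.\<close>

lemma sup_le_L2:
  "\<exists>\<kappa>\<ge>1. \<forall>A\<ge>1. \<exists>C>0. \<forall>(u :: real^'d::finite \<Rightarrow> complex) H.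
     rapid u \<longrightarrow> H \<ge> 0 \<longrightarrow> L2_bounded (\<kappa> * A) H u \<longrightarrow> sup_bounded A (C * H) u"
proof -
  let ?N = "2 * CARD('d)"
  obtain K where K: "K > 0" and sob: "\<And>(u :: real^'d \<Rightarrow> complex) js is B x. rapid u \<Longrightarrow> B > 0 \<Longrightarrow>
      (\<And>js' is'. length js + length is \<le> length js' + length is' + ?N \<Longrightarrow>
         length js' + length is' \<le> length js + length is + 4 * CARD('d) \<Longrightarrow>
         (L2_square js' is' u) \<le> B\<^sup>2) \<Longrightarrow>
      cmod (mono_deriv js is u x) \<le> K * (1 + real (length js)) ^ ?N * B"
    by (rule sobolev[where 'd='d]) blast
  obtain b Cb where b: "b \<ge> 1" "Cb > 0" "\<And>n. M (n + 4 * CARD('d)) \<le> Cb * b ^ n * M n"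
    using weight_seq_shift[of "4 * CARD('d)"] by blast
  define \<kappa> where "\<kappa> = 2 ^ ?N * b"
  have \<kappa>: "\<kappa> \<ge> 1" using b(1) mult_mono[of 1 "2 ^ ?N" 1 b] by (simp add: \<kappa>_def)
  have "\<exists>C>0. \<forall>(u :: real^'d \<Rightarrow> complex) H.
     rapid u \<longrightarrow> H \<ge> 0 \<longrightarrow> L2_bounded (\<kappa> * A) H u \<longrightarrow> sup_bounded A (C * H) u" if A: "A \<ge> 1" for A
  proof -
    define a where "a = \<kappa> * A"
    have a: "a \<ge> 1" using \<kappa> A mult_mono[of 1 \<kappa> 1 A] by (simp add: a_def)
    define C where "C = K * Cb * a ^ ?N"
    have C: "C > 0" using K b a by (simp add: C_def)
    have pos_case: "cmod (mono_deriv js is u x)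
        \<le> C * H * M (length js + length is) / A ^ (length js + length is)"
      if u: "rapid u" and H: "H > 0" and L2: "\<And>js is. (L2_square js is u)
        \<le> (H * M (length js + length is) / a ^ (length js + length is))\<^sup>2"
      for u :: "real^'d \<Rightarrow> complex" and H js "is" x
    proof -
      define n where "n = length js + length is"
      define B where "B = H * (Cb * b ^ n * M n) * a ^ ?N / a ^ n"
      have B: "B > 0" unfolding B_def using H b a weight_seq_pos[of 1 n] by simp
      have "cmod (mono_deriv js is u x) \<le> K * (1 + real (length js)) ^ ?N * B"
      proof (rule sob[OF u B])
        fix js' is' :: "'d list"
        define n' where "n' = length js' + length is'"
        assume l: "length js + length is \<le> length js' + length is' + ?N"
          "length js' + length is' \<le> length js + length is + 4 * CARD('d)"
        have "M n' \<le> M (n + 4 * CARD('d))" using l by (intro weight_seq_mono) (auto simp: n_def n'_def)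
        also have "\<dots> \<le> Cb * b ^ n * M n" by (rule b)
        finally have Mn: "M n' \<le> Cb * b ^ n * M n" .
        have "a ^ n \<le> a ^ (n' + ?N)" using a l by (intro power_increasing) (auto simp: n_def n'_def)
        then have "1 / a ^ n' \<le> a ^ ?N / a ^ n"
          using a by (simp add: power_add field_simps)
        then have "(H * M n') * (1 / a ^ n') \<le> (H * (Cb * b ^ n * M n)) * (a ^ ?N / a ^ n)"
          using H Mn weight_seq_pos[of 1 n'] b a weight_seq_pos[of 1 n] by (intro mult_mono) auto
        then have le: "H * M n' / a ^ n' \<le> B" by (simp add: B_def)
        have "(L2_square js' is' u) \<le> (H * M n' / a ^ n')\<^sup>2"
          unfolding n'_def by (rule L2)
        also have "\<dots> \<le> B\<^sup>2" using le H a weight_seq_pos[of 1 n'] by (intro power_mono) auto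
        finally show "(L2_square js' is' u) \<le> B\<^sup>2" .
      qed
      also have "\<dots> \<le> K * (2 ^ ?N) ^ n * B"
      proof -
        have "Suc n \<le> 2 ^ n" by (simp add: Suc_leI)
        then have "real (Suc n) \<le> real (2 ^ n)" by (rule of_nat_mono)
        then have "1 + real (length js) \<le> 2 ^ n" by (simp add: n_def)
        then have "(1 + real (length js)) ^ ?N \<le> (2 ^ n) ^ ?N" by (intro power_mono) auto
        also have "(2 ^ n) ^ ?N = ((2::real) ^ ?N) ^ n" by (simp only: power_mult[symmetric] mult.commute)
        finally show ?thesis using K B by (intro mult_right_mono mult_left_mono) auto
      qed
      also have "\<dots> = C * H * M n * ((2 ^ ?N * b) ^ n / a ^ n)"
        unfolding power_mult_distrib[of "2 ^ ?N" b n] by (simp add: B_def C_def)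
      also have "(2 ^ ?N * b) ^ n / a ^ n = 1 / A ^ n"
        using \<kappa> unfolding a_def \<kappa>_def[symmetric] by (simp add: power_mult_distrib)
      finally show ?thesis unfolding n_def by simp
    qed
    have "cmod (mono_deriv js is u x)
        \<le> C * H * M (length js + length is) / A ^ (length js + length is)"
      if u: "rapid u" and H: "H \<ge> 0" and L2: "\<And>js is. (L2_square js is u)
        \<le> (H * M (length js + length is) / a ^ (length js + length is))\<^sup>2"
      for u :: "real^'d \<Rightarrow> complex" and H js "is" x
    proof (rule field_le_epsilon)
      fix e :: real assume e: "e > 0"
      define n where "n = length js + length is"
      define k where "k = C * M n / A ^ n"
      have k: "k > 0" using C A weight_seq_pos[of 1 n] by (simp add: k_def)
      have He: "H + e / k > 0" using H e k by (intro add_nonneg_pos) auto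
      have "cmod (mono_deriv js is u x) \<le> C * (H + e / k) * M n / A ^ n"
        unfolding n_def
      proof (rule pos_case[OF u He])
        fix js' is' :: "'d list"
        define n' where "n' = length js' + length is'"
        have "(L2_square js' is' u) \<le> (H * M n' / a ^ n')\<^sup>2"
          unfolding n'_def by (rule L2)
        also have "\<dots> \<le> ((H + e / k) * M n' / a ^ n')\<^sup>2"
          using H e k a weight_seq_pos[of 1 n'] by (intro power_mono divide_right_mono mult_right_mono) auto
        finally show "(L2_square js' is' u)
          \<le> ((H + e / k) * M (length js' + length is') / a ^ (length js' + length is'))\<^sup>2"
          unfolding n'_def .
      qed
      also have "\<dots> = (H + e / k) * k" by (simp add: k_def)
      also have "\<dots> = H * k + e" using k by (simp add: distrib_right)
      also have "H * k = C * H * M n / A ^ n" by (simp add: k_def)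
      finally show "cmod (mono_deriv js is u x)
        \<le> C * H * M (length js + length is) / A ^ (length js + length is) + e" unfolding n_def .
    qed
    then have "rapid u \<longrightarrow> H \<ge> 0 \<longrightarrow> L2_bounded (\<kappa> * A) H u \<longrightarrow> sup_bounded A (C * H) u"
      for u :: "real^'d \<Rightarrow> complex" and H
      unfolding L2_bounded_def sup_bounded_def a_def[symmetric] by blast
    with C show ?thesis by blast
  qed
  with \<kappa> show ?thesis by blast
qed

text \<open>Multiplication by \<open>poly_weight\<close> adds a bounded number of letters to the words.\<close>

lemma weighted_sup_le:
  "\<exists>\<kappa>\<ge>1. \<forall>A\<ge>1. \<exists>C>0. \<forall>(u :: real^'d::finite \<Rightarrow> complex) H.
     H \<ge> 0 \<longrightarrow> sup_bounded (\<kappa> * A) H u \<longrightarrow> weighted_sup_bounded A (C * H) u"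
proof -
  let ?N = "2 * CARD('d)"
  obtain W :: "'d list list" where W: "\<And>w. w \<in> set W \<Longrightarrow> length w \<le> ?N"
    "\<And>x::real^'d. poly_weight x = (\<Sum>w\<leftarrow>W. mono_word w x)"
    using poly_weight_words by metis
  obtain b Cb where b: "b \<ge> 1" "Cb > 0" "\<And>n. M (n + ?N) \<le> Cb * b ^ n * M n"
    using weight_seq_shift[of ?N] by blast
  have "\<exists>C>0. \<forall>(u :: real^'d \<Rightarrow> complex) H.
     H \<ge> 0 \<longrightarrow> sup_bounded (b * A) H u \<longrightarrow> weighted_sup_bounded A (C * H) u" if A: "A \<ge> 1" for A
  proof -
    have bA: "b * A \<ge> 1" using b(1) A mult_mono[of 1 b 1 A] by simp
    define C where "C = real (length W) * Cb + 1"
    have "cmod (mono_deriv js is u x)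
        \<le> C * H * M (length js + length is) / A ^ (length js + length is) * (1 / poly_weight x)"
      if H: "H \<ge> 0" and le: "\<And>js is x. cmod (mono_deriv js is u x)
        \<le> H * M (length js + length is) / (b * A) ^ (length js + length is)"
      for u :: "real^'d \<Rightarrow> complex" and H js "is" x
    proof -
      define n where "n = length js + length is"
      define z where "z = mono_deriv js is u x"
      have "poly_weight x * cmod z \<le> (\<Sum>w\<leftarrow>W. cmod (of_real (mono_word w x) * z))"
        by (rule poly_weight_cmod_le[OF W(2)])
      also have "\<dots> \<le> real (length W) * (Cb * (H * M n / A ^ n))"
      proof (rule sum_list_le_const)
        fix w assume w: "w \<in> set W"
        define n' where "n' = length (w @ js) + length is"
        have n': "n \<le> n'" "n' \<le> n + ?N" using W(1)[OF w] by (auto simp: n_def n'_def)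
        have "M n' \<le> M (n + ?N)" using n' by (intro weight_seq_mono) auto
        also have "\<dots> \<le> Cb * b ^ n * M n" by (rule b)
        finally have Mn: "M n' \<le> Cb * b ^ n * M n" .
        have "cmod (of_real (mono_word w x) * z) \<le> H * M n' / (b * A) ^ n'"
          using le[of "w @ js" x "is"] unfolding z_def n'_def by (simp add: mult.assoc)
        also have "\<dots> \<le> H * (Cb * b ^ n * M n) / (b * A) ^ n"
          using H Mn n' bA weight_seq_pos[of 1 n] weight_seq_pos[of 1 n'] b
          by (intro frac_le mult_left_mono power_increasing) auto
        also have "\<dots> = Cb * (H * M n / A ^ n)" using b(1) by (simp add: power_mult_distrib)
        finally show "cmod (of_real (mono_word w x) * z) \<le> Cb * (H * M n / A ^ n)" .
      qed
      also have "\<dots> \<le> C * (H * M n / A ^ n)"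
      proof -
        have "0 \<le> H * M n / A ^ n" using H A weight_seq_pos[of 1 n] by simp
        then show ?thesis unfolding C_def distrib_right mult.assoc by linarith
      qed
      finally have "cmod z \<le> C * (H * M n / A ^ n) / poly_weight x"
        using poly_weight_pos[of x] by (simp only: pos_le_divide_eq mult.commute)
      then show ?thesis unfolding z_def n_def by simp
    qed
    then have "H \<ge> 0 \<longrightarrow> sup_bounded (b * A) H u \<longrightarrow> weighted_sup_bounded A (C * H) u"
      for u :: "real^'d \<Rightarrow> complex" and H
      unfolding sup_bounded_def weighted_sup_bounded_def by blast
    moreover have "C > 0" using b(2) by (simp add: C_def add_nonneg_pos)
    ultimately show ?thesis by blast
  qed
  with b(1) show ?thesis by blast
qed

lemma S_omega_bound:
  fixes u :: "real^'d::finite \<Rightarrow> complex"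
  assumes u: "u \<in> S_omega \<omega>" and A: "A \<ge> 1"
  shows "\<exists>C>0. sup_bounded A C u"
proof -
  obtain \<kappa> where \<kappa>: "\<kappa> \<ge> 1" and *: "\<forall>A\<ge>1. \<exists>C>0. \<forall>(u :: real^'d \<Rightarrow> complex) H.
     rapid u \<longrightarrow> H \<ge> 0 \<longrightarrow> L2_bounded (\<kappa> * A) H u \<longrightarrow> sup_bounded A (C * H) u"
    using sup_le_L2[where 'd='d] by blast
  have kA: "\<kappa> * A \<ge> 1" using \<kappa> A mult_mono[of 1 \<kappa> 1 A] by simp
  obtain H where H: "H > 0" "L2_bounded (\<kappa> * A) H u"
    using S_omega_L2_bound[OF u kA] by blast
  obtain C where C: "C > 0" and **: "\<forall>(u :: real^'d \<Rightarrow> complex) H.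
     rapid u \<longrightarrow> H \<ge> 0 \<longrightarrow> L2_bounded (\<kappa> * A) H u \<longrightarrow> sup_bounded A (C * H) u"
    using * A by blast
  have "sup_bounded A (C * H) u"
    using ** S_omega_rapid[OF u] H less_imp_le by blast
  then show ?thesis using C H(1) by (intro exI[of _ "C * H"]) simp
qed

end

section \<open>The space \<open>S_omega\<close> and its seminorms\<close>

lemma vector_space_fun_scale: "vector_space fun_scale"
  by unfold_locales (auto simp: fun_scale_def fun_eq_iff algebra_simps)

lemma fourier_linear:
  fixes u v :: "real^'d::finite \<Rightarrow> complex"
  assumes "integrable lborel u" "integrable lborel v"
  shows "fourier (\<lambda>x. a * u x + b * v x) = (\<lambda>\<xi>. a * fourier u \<xi> + b * fourier v \<xi>)"
proof
  fix \<xi>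
  define e where "e x = exp (- (\<i> * of_real (x \<bullet> \<xi>)))" for x :: "real^'d"
  have em: "e \<in> borel_measurable borel"
    unfolding e_def by (intro borel_measurable_continuous_onI continuous_intros)
  have int: "integrable lborel (\<lambda>x. e x * w x)" if "integrable lborel w" for w :: "real^'d \<Rightarrow> complex"
    using borel_measurable_integrable[OF that] em
    by (intro Bochner_Integration.integrable_bound[OF that]) (auto simp: e_def norm_mult norm_exp_eq_Re)
  have "(LINT x|lborel. e x * (a * u x + b * v x)) = (LINT x|lborel. a * (e x * u x) + b * (e x * v x))"
    by (intro Bochner_Integration.integral_cong refl) (simp add: algebra_simps)
  also have "\<dots> = a * (LINT x|lborel. e x * u x) + b * (LINT x|lborel. e x * v x)"
    unfolding Bochner_Integration.integral_add[OF integrable_mult_right[OF int[OF assms(1)]]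
      integrable_mult_right[OF int[OF assms(2)]]] integral_mult_right_zero ..
  finally show "fourier (\<lambda>x. a * u x + b * v x) \<xi> = a * fourier u \<xi> + b * fourier v \<xi>"
    unfolding fourier_def e_def .
qed

lemma D_linear:
  assumes "smooth u" "smooth v"
  shows "D \<alpha> (\<lambda>x. a * u x + b * v x) x = a * D \<alpha> u x + b * D \<alpha> v x"
  unfolding D_def pderivs_linear_combination(1)[OF assms] by (simp add: algebra_simps)

lemma bdd_above_linear:
  fixes f g :: "'a \<Rightarrow> complex" and w :: "'a \<Rightarrow> real"
  assumes "bdd_above (range (\<lambda>x. w x * cmod (f x)))" "bdd_above (range (\<lambda>x. w x * cmod (g x)))"
    and w: "\<And>x. 0 \<le> w x"
  shows "bdd_above (range (\<lambda>x. w x * cmod (a * f x + b * g x)))"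
proof -
  obtain F G where F: "\<And>x. w x * cmod (f x) \<le> F" and G: "\<And>x. w x * cmod (g x) \<le> G"
    using assms(1,2) unfolding bdd_above_def by blast
  have "w x * cmod (a * f x + b * g x) \<le> cmod a * F + cmod b * G" for x
  proof -
    have "w x * cmod (a * f x + b * g x) \<le> w x * (cmod a * cmod (f x) + cmod b * cmod (g x))"
      using norm_triangle_ineq[of "a * f x" "b * g x"] by (intro mult_left_mono w) (simp add: norm_mult)
    also have "\<dots> = cmod a * (w x * cmod (f x)) + cmod b * (w x * cmod (g x))" by (simp add: algebra_simps)
    also have "\<dots> \<le> cmod a * F + cmod b * G" by (intro add_mono mult_left_mono F G) auto
    finally show ?thesis .
  qed
  then show ?thesis by (intro bdd_aboveI2)
qed

lemma S_omega_linear: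
  assumes "u \<in> S_omega \<omega>" "v \<in> S_omega \<omega>"
  shows "(\<lambda>x. a * u x + b * v x) \<in> S_omega \<omega>"
proof -
  have u: "integrable lborel u" "smooth u" "smooth (fourier u)"
    and v: "integrable lborel v" "smooth v" "smooth (fourier v)"
    using assms by (auto simp: S_omega_def)
  have f: "fourier (\<lambda>x. a * u x + b * v x) = (\<lambda>\<xi>. a * fourier u \<xi> + b * fourier v \<xi>)"
    by (rule fourier_linear[OF u(1) v(1)])
  have "bdd_above (range (\<lambda>x. exp (\<mu> * \<omega> (norm x)) * cmod (D \<alpha> (\<lambda>x. a * u x + b * v x) x)))"
    if "\<mu> > 0" for \<mu> \<alpha>
    unfolding D_linear[OF u(2) v(2)]
    using assms that by (intro bdd_above_linear) (auto simp: S_omega_def)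
  moreover have "bdd_above (range (\<lambda>x. exp (\<mu> * \<omega> (norm x)) * cmod (D \<alpha> (fourier (\<lambda>x. a * u x + b * v x)) x)))"
    if "\<mu> > 0" for \<mu> \<alpha>
    unfolding f D_linear[OF u(3) v(3)]
    using assms that by (intro bdd_above_linear) (auto simp: S_omega_def)
  ultimately show ?thesis
    unfolding S_omega_def using u v pderivs_linear_combination(2) f by auto
qed

lemma pderivs_0: "pderivs is (\<lambda>_. 0) = (\<lambda>_. 0)"
  by (induction "is") (auto simp: pderiv_at_def)

lemma smooth_0: "smooth (\<lambda>_. 0)"
  unfolding smooth_def pderivs_0 by auto

lemma S_omega_0: "(\<lambda>_ :: real^'d::finite. 0) \<in> S_omega \<omega>"
proof -
  have "fourier (\<lambda>_ :: real^'d. 0) = (\<lambda>_. 0)" by (simp add: fourier_def fun_eq_iff)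
  then show ?thesis unfolding S_omega_def by (simp add: smooth_0 D_def pderivs_0)
qed

lemma subspace_S_omega: "module.subspace fun_scale (S_omega \<omega>)"
proof -
  interpret vector_space fun_scale by (rule vector_space_fun_scale)
  show ?thesis unfolding subspace_def
  proof (intro conjI ballI allI)
    show "0 \<in> S_omega \<omega>" using S_omega_0 by (simp add: zero_fun_def)
    fix u v :: "real^'a \<Rightarrow> complex" and c assume u: "u \<in> S_omega \<omega>"
    show "fun_scale c u \<in> S_omega \<omega>"
      using S_omega_linear[OF u u, of c 0] by (simp add: fun_scale_def)
    assume v: "v \<in> S_omega \<omega>"
    show "u + v \<in> S_omega \<omega>"
      using S_omega_linear[OF u v, of 1 1] by (simp add: plus_fun_def)
  qed
qed

context doubling_weight
begin

lemma weight_seq_antimono: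
  assumes "0 < \<mu>" "\<mu> \<le> \<nu>"
  shows "weight_seq \<omega> \<nu> n \<le> weight_seq \<omega> \<mu> n"
proof (rule weight_seq_upper)
  fix r :: real assume r: "r \<ge> 1"
  have "r ^ n * exp (- \<nu> * \<omega> r) \<le> r ^ n * exp (- \<mu> * \<omega> r)"
    using assms r weight_nonneg[of r] by (intro mult_left_mono) (auto simp: mult_right_mono)
  also have "\<dots> \<le> weight_seq \<omega> \<mu> n" by (rule weight_seq_lower[OF assms(1) r])
  finally show "r ^ n * exp (- \<nu> * \<omega> r) \<le> weight_seq \<omega> \<mu> n" .
qed (use assms in simp)

lemma S_seminorm_term:
  assumes "smooth u" "\<And>i. count_list is i = \<alpha> i" "\<And>i. count_list js i = \<beta> i"
  shows "cmod (of_real (\<Prod>i\<in>UNIV. (x $ i) ^ \<beta> i) * D \<alpha> u x) *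
        exp (- \<mu> * young_conj \<omega> (real (mi_size (\<lambda>i. \<alpha> i + \<beta> i)) / \<mu>))
    = cmod (mono_deriv js is u x) / weight_seq \<omega> \<mu> (length js + length is)"
proof -
  have "mi_size (\<lambda>i. \<alpha> i + \<beta> i) = mi_size \<alpha> + mi_size \<beta>"
    by (simp add: mi_size_def sum.distrib)
  also have "\<dots> = length js + length is"
    using mi_size_eq_length[of "is" \<alpha>] mi_size_eq_length[of js \<beta>] assms(2,3) by simp
  finally have n: "mi_size (\<lambda>i. \<alpha> i + \<beta> i) = length js + length is" .
  have "exp (- \<mu> * y) = 1 / exp (\<mu> * y)" for y by (simp add: exp_minus field_simps)
  then show ?thesis
    unfolding n weight_seq_def norm_mult cmod_D_eq[OF assms(1,2)] mono_word_eq[OF assms(3)] by simp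
qed

lemma S_seminorm_le:
  assumes u: "smooth u" and le: "\<And>js is x. cmod (mono_deriv js is u x)
    \<le> K * weight_seq \<omega> \<mu> (length js + length is)"
  shows "S_seminorm \<omega> \<mu> u \<le> K"
  unfolding S_seminorm_def
proof (rule cSUP_least)
  fix z :: "('a \<Rightarrow> nat) \<times> ('a \<Rightarrow> nat) \<times> (real^'a)"
  obtain \<alpha> \<beta> x where z: "z = (\<alpha>, \<beta>, x)" by (cases z)
  obtain "is" where i: "\<And>i. count_list is i = \<alpha> i" using ex_word_of_multiindex by blast
  obtain js where j: "\<And>i. count_list js i = \<beta> i" using ex_word_of_multiindex by blast
  show "(case z of (\<alpha>, \<beta>, x) \<Rightarrow> cmod (of_real (\<Prod>i\<in>UNIV. (x $ i) ^ \<beta> i) * D \<alpha> u x) *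
        exp (- \<mu> * young_conj \<omega> (real (mi_size (\<lambda>i. \<alpha> i + \<beta> i)) / \<mu>))) \<le> K"
    unfolding z prod.case S_seminorm_term[OF u i j]
    using le[of js x "is"] weight_seq_pos[of \<mu> "length js + length is"] by (simp add: pos_divide_le_eq)
qed simp

lemma sup_bounded_weight_seq:
  assumes A: "A \<ge> 1" and H: "H \<ge> 0" and u: "sup_bounded A H u"
    and C: "\<And>n. M n \<le> C * A ^ n * weight_seq \<omega> \<mu> n"
  shows "cmod (mono_deriv js is u x) \<le> (H * C) * weight_seq \<omega> \<mu> (length js + length is)"
proof -
  let ?n = "length js + length is"
  have "cmod (mono_deriv js is u x) \<le> H * M ?n / A ^ ?n"
    using u unfolding sup_bounded_def by blast
  also have "\<dots> \<le> H * (C * A ^ ?n * weight_seq \<omega> \<mu> ?n) / A ^ ?n"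
    using A H C by (intro divide_right_mono mult_left_mono) auto
  also have "\<dots> = (H * C) * weight_seq \<omega> \<mu> ?n" using A by simp
  finally show ?thesis .
qed

text \<open>The content is that the supremum is finite, which follows from \<open>S_omega_bound\<close>.\<close>

lemma S_seminorm_ge:
  assumes u: "u \<in> S_omega \<omega>" and \<mu>: "\<mu> > 0"
  shows "cmod (mono_deriv js is u x)
    \<le> S_seminorm \<omega> \<mu> u * weight_seq \<omega> \<mu> (length js + length is)"
proof -
  have sm: "smooth u" by (rule S_omega_smooth[OF u])
  obtain A C where A: "A \<ge> 1" "C > 0" "\<And>n. M n \<le> C * A ^ n * weight_seq \<omega> \<mu> n"
    using weight_seq_equiv[OF zero_less_one \<mu>] by blast
  obtain H where H: "H > 0" "sup_bounded A H u" using S_omega_bound[OF u A(1)] by blast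
  have bd: "bdd_above (range (\<lambda>(\<alpha>, \<beta>, x). cmod (of_real (\<Prod>i\<in>UNIV. (x $ i) ^ \<beta> i) * D \<alpha> u x) *
        exp (- \<mu> * young_conj \<omega> (real (mi_size (\<lambda>i. \<alpha> i + \<beta> i)) / \<mu>))))"
  proof (rule bdd_aboveI2)
    fix z :: "('a \<Rightarrow> nat) \<times> ('a \<Rightarrow> nat) \<times> (real^'a)"
    obtain \<alpha> \<beta> x where z: "z = (\<alpha>, \<beta>, x)" by (cases z)
    obtain "is" where i: "\<And>i. count_list is i = \<alpha> i" using ex_word_of_multiindex by blast
    obtain js where j: "\<And>i. count_list js i = \<beta> i" using ex_word_of_multiindex by blast
    show "(case z of (\<alpha>, \<beta>, x) \<Rightarrow> cmod (of_real (\<Prod>i\<in>UNIV. (x $ i) ^ \<beta> i) * D \<alpha> u x) *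
        exp (- \<mu> * young_conj \<omega> (real (mi_size (\<lambda>i. \<alpha> i + \<beta> i)) / \<mu>))) \<le> H * C"
      unfolding z prod.case S_seminorm_term[OF sm i j]
      using sup_bounded_weight_seq[OF A(1) less_imp_le[OF H(1)] H(2) A(3), of js x "is"]
        weight_seq_pos[of \<mu> "length js + length is"] by (simp add: pos_divide_le_eq)
  qed
  have "cmod (mono_deriv js is u x) / weight_seq \<omega> \<mu> (length js + length is) \<le> S_seminorm \<omega> \<mu> u"
    unfolding S_seminorm_def
    using cSUP_upper[OF UNIV_I bd, of "(count_list is, count_list js, x)"]
    unfolding prod.case S_seminorm_term[OF sm refl refl] .
  then show ?thesis using weight_seq_pos[of \<mu> "length js + length is"] by (simp add: pos_divide_le_eq)
qed

lemma S_seminorm_nonneg: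
  assumes "u \<in> S_omega \<omega>" "\<mu> > 0"
  shows "0 \<le> S_seminorm \<omega> \<mu> u"
proof -
  have "0 \<le> S_seminorm \<omega> \<mu> u * weight_seq \<omega> \<mu> 0"
    using order_trans[OF norm_ge_zero S_seminorm_ge[OF assms, of "[]" 0 "[]"]] by simp
  then show ?thesis using weight_seq_pos[of \<mu> 0] by (simp add: zero_le_mult_iff)
qed

lemma S_seminorm_linear_le:
  assumes "u \<in> S_omega \<omega>" "v \<in> S_omega \<omega>" "\<mu> > 0"
  shows "S_seminorm \<omega> \<mu> (\<lambda>x. a * u x + b * v x) \<le> cmod a * S_seminorm \<omega> \<mu> u + cmod b * S_seminorm \<omega> \<mu> v"
proof (rule S_seminorm_le)
  have sm: "smooth u" "smooth v" using assms S_omega_smooth by auto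
  show "smooth (\<lambda>x. a * u x + b * v x)" by (rule pderivs_linear_combination(2)[OF sm])
  fix js "is" :: "'a list" and x
  let ?w = "weight_seq \<omega> \<mu> (length js + length is)" and ?m = "complex_of_real (mono_word js x)"
  have eq: "?m * pderivs is (\<lambda>x. a * u x + b * v x) x = a * (?m * pderivs is u x) + b * (?m * pderivs is v x)"
    unfolding pderivs_linear_combination(1)[OF sm] by (simp add: algebra_simps)
  have "cmod (?m * pderivs is (\<lambda>x. a * u x + b * v x) x)
      \<le> cmod a * cmod (?m * pderivs is u x) + cmod b * cmod (?m * pderivs is v x)"
    unfolding eq norm_mult[of a, symmetric] norm_mult[of b, symmetric] by (rule norm_triangle_ineq)
  also have "\<dots> \<le> cmod a * (S_seminorm \<omega> \<mu> u * ?w) + cmod b * (S_seminorm \<omega> \<mu> v * ?w)"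
    by (intro add_mono mult_left_mono S_seminorm_ge assms norm_ge_zero)
  finally show "cmod (?m * pderivs is (\<lambda>x. a * u x + b * v x) x)
      \<le> (cmod a * S_seminorm \<omega> \<mu> u + cmod b * S_seminorm \<omega> \<mu> v) * ?w"
    by (simp add: algebra_simps)
qed

lemma seminorm_on_S_seminorm:
  assumes \<mu>: "\<mu> > 0"
  shows "seminorm_on fun_scale (S_omega \<omega>) (S_seminorm \<omega> \<mu>)"
  unfolding seminorm_on_def
proof (intro conjI ballI allI)
  fix u :: "real^'a \<Rightarrow> complex" assume u: "u \<in> S_omega \<omega>"
  show "0 \<le> S_seminorm \<omega> \<mu> u" by (rule S_seminorm_nonneg[OF u \<mu>])
  show "S_seminorm \<omega> \<mu> (u + v) \<le> S_seminorm \<omega> \<mu> u + S_seminorm \<omega> \<mu> v" if "v \<in> S_omega \<omega>" for v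
    using S_seminorm_linear_le[OF u that \<mu>, of 1 1] by (simp add: plus_fun_def)
  have le: "S_seminorm \<omega> \<mu> (fun_scale c w) \<le> cmod c * S_seminorm \<omega> \<mu> w" if "w \<in> S_omega \<omega>"
    for c and w :: "real^'a \<Rightarrow> complex"
    using S_seminorm_linear_le[OF that that \<mu>, of c 0] by (simp add: fun_scale_def)
  fix c
  have cu: "fun_scale c u \<in> S_omega \<omega>"
    using S_omega_linear[OF u u, of c 0] by (simp add: fun_scale_def)
  show "S_seminorm \<omega> \<mu> (fun_scale c u) = cmod c * S_seminorm \<omega> \<mu> u"
  proof (cases "c = 0")
    case True
    then show ?thesis using le[OF u, of c] S_seminorm_nonneg[OF cu \<mu>] by simp
  next
    case False
    have "fun_scale (1 / c) (fun_scale c u) = u" using False by (simp add: fun_scale_def)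
    then have "S_seminorm \<omega> \<mu> u \<le> cmod (1 / c) * S_seminorm \<omega> \<mu> (fun_scale c u)"
      using le[OF cu, of "1 / c"] by simp
    then have "cmod c * S_seminorm \<omega> \<mu> u \<le> S_seminorm \<omega> \<mu> (fun_scale c u)"
      using False by (simp add: norm_divide field_simps)
    then show ?thesis using le[OF u, of c] by simp
  qed
qed

lemma S_seminorm_mono:
  assumes u: "u \<in> S_omega \<omega>" and "0 < \<mu>" "\<mu> \<le> \<nu>"
  shows "S_seminorm \<omega> \<mu> u \<le> S_seminorm \<omega> \<nu> u"
proof (rule S_seminorm_le[OF S_omega_smooth[OF u]])
  have \<nu>: "\<nu> > 0" using assms by simp
  fix js "is" x
  show "cmod (mono_deriv js is u x)
      \<le> S_seminorm \<omega> \<nu> u * weight_seq \<omega> \<mu> (length js + length is)"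
    using S_seminorm_ge[OF u \<nu>] weight_seq_antimono[OF assms(2,3)] S_seminorm_nonneg[OF u \<nu>]
    by (meson mult_left_mono order_trans)
qed

lemma seminormed_space_S_omega:
  "seminormed_space fun_scale (S_omega \<omega> :: (real^'d::finite \<Rightarrow> complex) set) {S_seminorm \<omega> \<mu> |\<mu>. 0 < \<mu>}"
proof -
  interpret vector_space fun_scale by (rule vector_space_fun_scale)
  show ?thesis
  proof
    show "subspace (S_omega \<omega> :: (real^'d \<Rightarrow> complex) set)" by (rule subspace_S_omega)
    show "seminorm_on fun_scale (S_omega \<omega>) p" if "p \<in> {S_seminorm \<omega> \<mu> |\<mu>. 0 < \<mu>}"
      for p :: "(real^'d \<Rightarrow> complex) \<Rightarrow> real"
      using that seminorm_on_S_seminorm by blast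
    show "{S_seminorm \<omega> \<mu> |\<mu>. 0 < \<mu>} \<noteq> ({} :: ((real^'d \<Rightarrow> complex) \<Rightarrow> real) set)"
      using zero_less_one by blast
    show "\<exists>r\<in>{S_seminorm \<omega> \<mu> |\<mu>. 0 < \<mu>}. \<forall>u\<in>S_omega \<omega>. p u \<le> r u \<and> q u \<le> r u"
      if pq: "p \<in> {S_seminorm \<omega> \<mu> |\<mu>. 0 < \<mu>}" "q \<in> {S_seminorm \<omega> \<mu> |\<mu>. 0 < \<mu>}"
      for p q :: "(real^'d \<Rightarrow> complex) \<Rightarrow> real"
    proof -
      obtain \<mu> \<nu> where mn: "p = S_seminorm \<omega> \<mu>" "\<mu> > 0" "q = S_seminorm \<omega> \<nu>" "\<nu> > 0" using pq by blast
      have "\<forall>u\<in>S_omega \<omega>. p u \<le> S_seminorm \<omega> (max \<mu> \<nu>) u \<and> q u \<le> S_seminorm \<omega> (max \<mu> \<nu>) u"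
        unfolding mn by (intro ballI conjI S_seminorm_mono) (auto simp: mn)
      moreover have "max \<mu> \<nu> > 0" using mn by simp
      ultimately show ?thesis by blast
    qed
    show "\<exists>p\<in>{S_seminorm \<omega> \<mu> |\<mu>. 0 < \<mu>}. 0 < p u" if u: "u \<in> S_omega \<omega>" "u \<noteq> 0" for u :: "real^'d \<Rightarrow> complex"
    proof -
      obtain x where x: "u x \<noteq> 0" using u(2) by (auto simp: fun_eq_iff)
      have "cmod (u x) \<le> S_seminorm \<omega> 1 u * M 0"
        using S_seminorm_ge[OF u(1) zero_less_one, of "[]" x "[]"] by simp
      then have "0 < S_seminorm \<omega> 1 u * M 0" using x by (meson less_le_trans zero_less_norm_iff)
      then have "0 < S_seminorm \<omega> 1 u" using weight_seq_pos[of 1 0] by (simp add: zero_less_mult_iff)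
      then show ?thesis using zero_less_one by blast
    qed
  qed
qed

end

section \<open>Summation over all words\<close>

definition word_measure :: "(('d list \<times> 'd list) \<times> (real^'d::finite)) measure" where
  "word_measure = count_space UNIV \<Otimes>\<^sub>M lborel"

interpretation word_pair: pair_sigma_finite "count_space (UNIV :: ('d::finite list \<times> 'd list) set)" "lborel :: (real^'d) measure"
  by (intro pair_sigma_finite.intro sigma_finite_measure_count_space_countable sigma_finite_lborel) auto

definition total_length :: "'d list \<times> 'd list \<Rightarrow> nat" where
  "total_length k = length (fst k) + length (snd k)"

lemma word_measure_measurable:
  fixes f :: "'d::finite list \<times> 'd list \<Rightarrow> real^'d \<Rightarrow> 'b::topological_space"
  assumes "\<And>k. f k \<in> borel_measurable borel"
  shows "(\<lambda>z. f (fst z) (snd z)) \<in> borel_measurable word_measure"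
  unfolding word_measure_def
  by (rule measurable_pair_measure_countable1) (use assms in auto)

text \<open>There are \<open>CARD('d) ^ n\<close> words of length \<open>n\<close>.\<close>

lemma sum_words_le:
  fixes F :: "'d::finite list set"
  assumes "finite F"
  shows "(\<Sum>w\<in>F. (1 / (2 * real CARD('d))) ^ length w) \<le> 2"
proof -
  let ?D = "real CARD('d)"
  define N where "N = Suc (Max (insert 0 (length ` F)))"
  have sub: "F \<subseteq> (\<Union>n<N. {w::'d list. set w \<subseteq> UNIV \<and> length w = n})"
    using assms by (auto simp: N_def le_imp_less_Suc)
  have fin: "finite {w::'d list. set w \<subseteq> UNIV \<and> length w = n}" for n
    by (rule finite_lists_length_eq) simp
  have "(\<Sum>w\<in>F. (1 / (2 * ?D)) ^ length w) \<le> (\<Sum>w\<in>(\<Union>n<N. {w::'d list. set w \<subseteq> UNIV \<and> length w = n}). (1 / (2 * ?D)) ^ length w)"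
    by (rule sum_mono2[OF _ sub]) (use fin in auto)
  also have "\<dots> = (\<Sum>n<N. \<Sum>w\<in>{w::'d list. set w \<subseteq> UNIV \<and> length w = n}. (1 / (2 * ?D)) ^ length w)"
    using fin by (intro sum.UNION_disjoint) auto
  also have "\<dots> = (\<Sum>n<N. (1 / 2) ^ n)"
  proof (intro sum.cong refl)
    fix n
    have "(\<Sum>w\<in>{w::'d list. set w \<subseteq> UNIV \<and> length w = n}. (1 / (2 * ?D)) ^ length w)
        = (\<Sum>w\<in>{w::'d list. set w \<subseteq> UNIV \<and> length w = n}. (1 / (2 * ?D)) ^ n)"
      by (intro sum.cong) auto
    also have "\<dots> = ?D ^ n * (1 / (2 * ?D)) ^ n"
      using card_lists_length_eq[of "UNIV :: 'd set" n] by simp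
    also have "\<dots> = (1 / 2) ^ n" by (simp flip: power_mult_distrib)
    finally show "(\<Sum>w\<in>{w::'d list. set w \<subseteq> UNIV \<and> length w = n}. (1 / (2 * ?D)) ^ length w) = (1 / 2) ^ n" .
  qed
  also have "\<dots> \<le> (\<Sum>n. (1 / 2) ^ n)" by (intro sum_le_suminf summable_geometric) auto
  also have "\<dots> = (2::real)" by (subst suminf_geometric) auto
  finally show ?thesis .
qed

lemma integrable_words:
  "integrable (count_space UNIV) (\<lambda>k::'d::finite list \<times> 'd list. (1 / (2 * real CARD('d))) ^ total_length k)"
proof -
  let ?r = "1 / (2 * real CARD('d))"
  let ?f = "\<lambda>k::'d list \<times> 'd list. ?r ^ total_length k"
  have "sum ?f F \<le> 4" if F: "finite F" for F
  proof -
    have "sum ?f F \<le> sum ?f (fst ` F \<times> snd ` F)"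
      using F by (intro sum_mono2) (auto intro: rev_image_eqI)
    also have "\<dots> = (\<Sum>v\<in>fst ` F. \<Sum>w\<in>snd ` F. ?r ^ length v * ?r ^ length w)"
      unfolding sum.cartesian_product by (intro sum.cong refl) (auto simp: total_length_def power_add)
    also have "\<dots> = (\<Sum>v\<in>fst ` F. ?r ^ length v) * (\<Sum>w\<in>snd ` F. ?r ^ length w)"
      by (simp only: sum_product)
    also have "\<dots> \<le> 2 * 2" using F by (intro mult_mono sum_words_le sum_nonneg) auto
    finally show ?thesis by simp
  qed
  then have "?f summable_on UNIV"
    by (intro nonneg_bdd_above_summable_on bdd_aboveI2[where M=4]) auto
  then have "(\<lambda>k. norm (?f k)) summable_on UNIV" by simp
  then show ?thesis
    unfolding abs_summable_on_def[symmetric] abs_summable_equivalent .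
qed

lemma integrable_word_measure:
  fixes f :: "('d::finite list \<times> 'd list) \<times> (real^'d) \<Rightarrow> 'b::{banach,second_countable_topology}"
  assumes m: "f \<in> borel_measurable word_measure"
    and le: "\<And>k x. norm (f (k, x)) \<le> K * (1 / (2 * real CARD('d))) ^ total_length k * (1 / poly_weight x)"
  shows "integrable word_measure f"
proof -
  let ?r = "1 / (2 * real CARD('d))"
  let ?g = "\<lambda>z::('d list \<times> 'd list) \<times> (real^'d). K * ?r ^ total_length (fst z) * (1 / poly_weight (snd z))"
  have "integrable (count_space UNIV \<Otimes>\<^sub>M lborel) ?g"
  proof (rule word_pair.Fubini_integrable)
    show "?g \<in> borel_measurable (count_space UNIV \<Otimes>\<^sub>M lborel)"
      unfolding word_measure_def[symmetric]
      by (rule word_measure_measurable[of "\<lambda>k x. K * ?r ^ total_length k * (1 / poly_weight x)"]) simp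
    have "(LINT x|lborel. norm (?g (k, x))) = ?r ^ total_length k * (\<bar>K\<bar> * (LINT x|lborel. 1 / poly_weight (x::real^'d)))" for k
    proof -
      have "norm (?g (k, x)) = (?r ^ total_length k * \<bar>K\<bar>) * (1 / poly_weight x)" for x
        using poly_weight_pos[of x] by (simp add: abs_mult)
      then show ?thesis by (simp only: integral_mult_right_zero mult.assoc)
    qed
    then show "integrable (count_space UNIV) (\<lambda>k. LINT x|lborel. norm (?g (k, x)))"
      by (simp only:) (intro integrable_mult_left integrable_words)
    show "AE k in count_space UNIV. integrable lborel (\<lambda>x. ?g (k, x))"
      unfolding fst_conv snd_conv by (intro AE_I2 integrable_mult_right integrable_inverse_poly_weight)
  qed
  then have g: "integrable word_measure ?g" unfolding word_measure_def .
  show ?thesis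
  proof (rule Bochner_Integration.integrable_bound[OF g m], rule AE_I2)
    fix z :: "('d list \<times> 'd list) \<times> (real^'d)"
    show "norm (f z) \<le> norm (?g z)"
      using order_trans[OF le[of "fst z" "snd z"] abs_ge_self] by simp
  qed
qed

lemma slice_integral_le:
  fixes f :: "('d::finite list \<times> 'd list) \<times> (real^'d) \<Rightarrow> real"
  assumes int: "integrable word_measure f" and nonneg: "\<And>z. 0 \<le> f z"
  shows "(LINT x|lborel. f (k, x)) \<le> (LINT z|word_measure. f z)"
proof -
  define F where "F k = (LINT x|lborel. f (k, x))" for k
  have i: "integrable (count_space UNIV) F"
    unfolding F_def by (rule word_pair.integrable_fst'[OF int[unfolded word_measure_def]])
  have F0: "0 \<le> F k" for k unfolding F_def using nonneg by (intro integral_nonneg_AE AE_I2)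
  have "(LINT j|count_space UNIV. indicator {k} j * F j) = F k"
    by (subst lebesgue_integral_count_space_finite_support) (cases "F k = 0"; auto simp: indicator_def)+
  moreover have "(LINT j|count_space UNIV. indicator {k} j * F j) \<le> (LINT j|count_space UNIV. F j)"
    using i F0 by (intro Bochner_Integration.integral_mono') (auto simp: indicator_def)
  moreover have "(LINT j|count_space UNIV. F j) = (LINT z|word_measure. f z)"
    unfolding F_def word_measure_def by (rule word_pair.integral_fst'[OF int[unfolded word_measure_def]])
  ultimately show ?thesis unfolding F_def by simp
qed

section \<open>Nuclearity\<close>

text \<open>The index \<open>z = ((js, is), x)\<close> runs through the measure space \<open>word_measure\<close>.\<close>

definition op_value :: "('d list \<times> 'd list) \<times> (real^'d::finite) \<Rightarrow> (real^'d \<Rightarrow> complex) \<Rightarrow> complex" where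
  "op_value z u = of_real (mono_word (fst (fst z)) (snd z)) * pderivs (snd (fst z)) u (snd z)"

lemma op_value_measurable:
  assumes "smooth u"
  shows "(\<lambda>z. op_value z u) \<in> borel_measurable word_measure"
  unfolding op_value_def
  by (rule word_measure_measurable[of "\<lambda>k x. mono_deriv (fst k) (snd k) u x"])
    (intro borel_measurable_continuous_onI continuous_intros smooth_continuous assms)

context doubling_weight
begin

definition geometric_weight :: "real \<Rightarrow> ('d list \<times> 'd list) \<times> (real^'d::finite) \<Rightarrow> real" where
  "geometric_weight A z = A ^ total_length (fst z) / M (total_length (fst z))"

lemma geometric_weight_measurable: "geometric_weight A \<in> borel_measurable word_measure"
  unfolding geometric_weight_def[abs_def]
  by (rule word_measure_measurable[of "\<lambda>k x. A ^ total_length k / M (total_length k)"]) simp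

lemma geometric_weight_pos: "A > 0 \<Longrightarrow> 0 < geometric_weight A z"
  unfolding geometric_weight_def using weight_seq_pos by simp

lemma poly_weight_measurable_word: "(\<lambda>z. 1 / poly_weight (snd z)) \<in> borel_measurable word_measure"
  by (rule word_measure_measurable[of "\<lambda>k x. 1 / poly_weight x"]) simp

lemma weighted_sup_bounded_op_value:
  "A > 0 \<Longrightarrow> weighted_sup_bounded A H u \<Longrightarrow> cmod (op_value z u) \<le> H / geometric_weight A z * (1 / poly_weight (snd z))"
  unfolding weighted_sup_bounded_def op_value_def geometric_weight_def total_length_def by simp

lemma S_omega_weighted_bound:
  fixes u :: "real^'d::finite \<Rightarrow> complex"
  assumes u: "u \<in> S_omega \<omega>" and A: "A \<ge> 1"
  shows "\<exists>C>0. weighted_sup_bounded A C u"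
proof -
  obtain \<kappa> where \<kappa>: "\<kappa> \<ge> 1" and *: "\<forall>A\<ge>1. \<exists>C>0. \<forall>(u :: real^'d \<Rightarrow> complex) H.
     H \<ge> 0 \<longrightarrow> sup_bounded (\<kappa> * A) H u \<longrightarrow> weighted_sup_bounded A (C * H) u"
    using weighted_sup_le[where 'd='d] by blast
  have kA: "\<kappa> * A \<ge> 1" using \<kappa> A mult_mono[of 1 \<kappa> 1 A] by simp
  obtain H where H: "H > 0" "sup_bounded (\<kappa> * A) H u" using S_omega_bound[OF u kA] by blast
  obtain C where C: "C > 0" and **: "\<forall>(u :: real^'d \<Rightarrow> complex) H.
     H \<ge> 0 \<longrightarrow> sup_bounded (\<kappa> * A) H u \<longrightarrow> weighted_sup_bounded A (C * H) u"
    using * A by blast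
  have "weighted_sup_bounded A (C * H) u" using ** H less_imp_le by blast
  then show ?thesis using C H(1) by (intro exI[of _ "C * H"]) simp
qed

lemma integrable_geometric:
  fixes f :: "('d::finite list \<times> 'd list) \<times> (real^'d) \<Rightarrow> real"
  assumes f: "f \<in> borel_measurable word_measure"
    and le: "\<And>z. \<bar>f z\<bar> \<le> K * q ^ total_length (fst z) * (1 / poly_weight (snd z))\<^sup>2"
    and q: "0 \<le> q" "q \<le> 1 / (2 * real CARD('d))" and K: "0 \<le> K"
  shows "integrable word_measure f"
proof (rule integrable_word_measure[OF f])
  fix k :: "'d list \<times> 'd list" and x :: "real^'d"
  have "\<bar>f (k, x)\<bar> \<le> K * q ^ total_length k * (1 / poly_weight x)\<^sup>2" using le[of "(k, x)"] by simp
  also have "\<dots> \<le> K * (1 / (2 * real CARD('d))) ^ total_length k * (1 / poly_weight x)"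
  proof (intro mult_mono power_mono mult_nonneg_nonneg q K order_refl)
    have "(1 / poly_weight x) * (1 / poly_weight x) \<le> (1 / poly_weight x) * 1"
      using poly_weight_ge_1[of x] by (intro mult_left_mono) auto
    then show "(1 / poly_weight x)\<^sup>2 \<le> 1 / poly_weight x" by (simp add: power2_eq_square)
  qed (use q in auto)
  finally show "norm (f (k, x)) \<le> K * (1 / (2 * real CARD('d))) ^ total_length k * (1 / poly_weight x)" by simp
qed

lemma integrable_form:
  fixes u :: "real^'d::finite \<Rightarrow> complex"
  assumes u: "u \<in> S_omega \<omega>" and A: "A \<ge> 1"
  shows "integrable word_measure (\<lambda>z. (geometric_weight A z)\<^sup>2 * (cmod (op_value z u))\<^sup>2)"
proof -
  define A' where "A' = 2 * real CARD('d) * A"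
  have D: "real CARD('d) \<ge> 1" using zero_less_card_finite[where 'a='d] by linarith
  have D2: "1 \<le> 2 * real CARD('d)" using D by linarith
  then have A': "A' \<ge> 1" using mult_mono[of 1 "2 * real CARD('d)" 1 A] A unfolding A'_def by linarith
  obtain C where C: "C > 0" "weighted_sup_bounded A' C u" using S_omega_weighted_bound[OF u A'] by blast
  have AA: "A / A' = 1 / (2 * real CARD('d))" using A by (simp add: A'_def)
  show ?thesis
  proof (rule integrable_geometric[where K="C\<^sup>2" and q="(A / A')\<^sup>2"])
    show "(\<lambda>z. (geometric_weight A z)\<^sup>2 * (cmod (op_value z u))\<^sup>2) \<in> borel_measurable word_measure"
      using geometric_weight_measurable op_value_measurable[OF S_omega_smooth[OF u]] by measurable
    fix z :: "('d list \<times> 'd list) \<times> (real^'d)"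
    let ?n = "total_length (fst z)"
    have "cmod (op_value z u) \<le> C / geometric_weight A' z * (1 / poly_weight (snd z))"
      using A' C by (intro weighted_sup_bounded_op_value) auto
    then have "geometric_weight A z * cmod (op_value z u)
        \<le> geometric_weight A z * (C / geometric_weight A' z * (1 / poly_weight (snd z)))"
      using geometric_weight_pos[of A z] A by (intro mult_left_mono) auto
    also have "\<dots> = C * (A / A') ^ ?n * (1 / poly_weight (snd z))"
      using weight_seq_pos[of 1 ?n] by (simp add: geometric_weight_def power_divide)
    finally have "(geometric_weight A z * cmod (op_value z u))\<^sup>2 \<le> (C * (A / A') ^ ?n * (1 / poly_weight (snd z)))\<^sup>2"
      using geometric_weight_pos[of A z] A by (intro power_mono) auto
    also have "\<dots> = C\<^sup>2 * ((A / A')\<^sup>2) ^ ?n * (1 / poly_weight (snd z))\<^sup>2"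
      by (simp only: power_mult_distrib power_mult[symmetric] mult.commute[of ?n])
    finally show "\<bar>(geometric_weight A z)\<^sup>2 * (cmod (op_value z u))\<^sup>2\<bar>
        \<le> C\<^sup>2 * ((A / A')\<^sup>2) ^ ?n * (1 / poly_weight (snd z))\<^sup>2"
      by (simp only: power_mult_distrib[symmetric] abs_power2)
  next
    show "(A / A')\<^sup>2 \<le> 1 / (2 * real CARD('d))"
    proof -
      have "1 / (2 * real CARD('d)) \<le> 1" using D2 by (subst divide_le_eq_1) linarith
      then have "1 / (2 * real CARD('d)) * (1 / (2 * real CARD('d))) \<le> 1 / (2 * real CARD('d)) * 1"
        by (intro mult_left_mono) auto
      then show ?thesis unfolding AA power2_eq_square by simp
    qed
  qed simp_all
qed

lemma L2_bounded_form:
  fixes u :: "real^'d::finite \<Rightarrow> complex"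
  assumes u: "u \<in> S_omega \<omega>" and A: "A \<ge> 1"
  shows "L2_bounded A (sqrt (LINT z|word_measure. (geometric_weight A z)\<^sup>2 * (cmod (op_value z u))\<^sup>2)) u"
  unfolding L2_bounded_def
proof (intro allI)
  fix js "is" :: "'d list"
  let ?n = "length js + length is"
  let ?I = "LINT z|word_measure. (geometric_weight A z)\<^sup>2 * (cmod (op_value z u))\<^sup>2"
  have "(LINT x|lborel. (geometric_weight A ((js, is), x))\<^sup>2 * (cmod (op_value ((js, is), x) u))\<^sup>2) \<le> ?I"
    by (rule slice_integral_le[OF integrable_form[OF u A]]) simp
  then have "(A ^ ?n / M ?n)\<^sup>2 * (L2_square js is u) \<le> ?I"
    unfolding geometric_weight_def op_value_def total_length_def fst_conv snd_conv integral_mult_right_zero .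
  then have "(M ?n / A ^ ?n)\<^sup>2 * ((A ^ ?n / M ?n)\<^sup>2 * (L2_square js is u))
      \<le> (M ?n / A ^ ?n)\<^sup>2 * ?I" by (rule mult_left_mono) simp
  moreover have "(M ?n / A ^ ?n)\<^sup>2 * ((A ^ ?n / M ?n)\<^sup>2 * y) = y" for y
    using A weight_seq_pos[of 1 ?n] by (simp add: power_divide)
  ultimately have "(L2_square js is u) \<le> ?I * (M ?n / A ^ ?n)\<^sup>2"
    by (simp only: mult.commute[of ?I])
  moreover have "0 \<le> ?I" by (intro integral_nonneg_AE AE_I2) auto
  ultimately show "(L2_square js is u)
      \<le> (sqrt ?I * M ?n / A ^ ?n)\<^sup>2"
    by (simp add: power_mult_distrib power_divide)
qed

lemma sup_bounded_mono:
  assumes "sup_bounded A H u" "1 \<le> B" "B \<le> A" "0 \<le> H"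
  shows "sup_bounded B H u"
  unfolding sup_bounded_def
proof (intro allI)
  fix js "is" :: "'a list" and x
  let ?n = "length js + length is"
  have "cmod (mono_deriv js is u x) \<le> H * M ?n / A ^ ?n"
    using assms(1) unfolding sup_bounded_def by blast
  also have "\<dots> \<le> H * M ?n / B ^ ?n"
    using assms weight_seq_pos[of 1 ?n] by (intro divide_left_mono power_mono mult_nonneg_nonneg) auto
  finally show "cmod (mono_deriv js is u x) \<le> H * M ?n / B ^ ?n" .
qed

text \<open>\<open>nuclear_linking_map_of_kernels\<close> for the evaluations \<open>op_value\<close>; all its hypotheses are inequalities
  between geometric factors.\<close>

theorem S_omega_linking_maps_nuclear:
  fixes p :: "(real^'d::finite \<Rightarrow> complex) \<Rightarrow> real"
  assumes p: "seminorm_on fun_scale (S_omega \<omega>) p" and \<mu>: "\<mu> > 0" and K: "K > 0"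
    and pK: "\<forall>u\<in>S_omega \<omega>. p u \<le> K * S_seminorm \<omega> \<mu> u"
  shows "\<exists>\<nu>>0. \<exists>K'>0. (\<forall>u\<in>S_omega \<omega>. p u \<le> K' * S_seminorm \<omega> \<nu> u) \<and>
    nuclear_linking_map fun_scale (S_omega \<omega>) (\<lambda>u. K' * S_seminorm \<omega> \<nu> u) p"
proof -
  define D where "D = real CARD('d)"
  have D: "D \<ge> 1" using zero_less_card_finite[where 'a='d] unfolding D_def by linarith
  obtain \<kappa>1 where \<kappa>1: "\<kappa>1 \<ge> 1" and L2_sup: "\<forall>A\<ge>1. \<exists>C>0. \<forall>(u :: real^'d \<Rightarrow> complex) H.
     rapid u \<longrightarrow> H \<ge> 0 \<longrightarrow> L2_bounded (\<kappa>1 * A) H u \<longrightarrow> sup_bounded A (C * H) u"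
    using sup_le_L2[where 'd='d] by blast
  obtain \<kappa>2 where \<kappa>2: "\<kappa>2 \<ge> 1" and sup_weighted: "\<forall>A\<ge>1. \<exists>C>0. \<forall>(u :: real^'d \<Rightarrow> complex) H.
     H \<ge> 0 \<longrightarrow> sup_bounded (\<kappa>2 * A) H u \<longrightarrow> weighted_sup_bounded A (C * H) u"
    using weighted_sup_le[where 'd='d] by blast
  have ge1: "1 \<le> x * y" if "1 \<le> x" "1 \<le> y" for x y :: real
    using mult_mono[of 1 x 1 y] that by simp
  obtain A0 C0 where A0: "A0 \<ge> 1" "C0 > 0" "\<And>n. M n \<le> C0 * A0 ^ n * weight_seq \<omega> \<mu> n"
    using weight_seq_equiv[OF zero_less_one \<mu>] by blast
  \<comment> \<open>\<open>p\<close> is controlled by suprema at \<open>A0\<close>, hence by the Hilbert norm at \<open>A1\<close>. The Hilbert norm of the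
    expansion is the one at \<open>A3\<close>; it bounds the evaluations at \<open>A2\<close>, and \<open>q\<close> bounds them at \<open>A4\<close>. The
    integrability conditions hold because \<open>A1 / A2\<close> and \<open>A3\<^sup>2 / A4\<close> are equal to \<open>1 / (2 * D)\<close>, which
    makes the sum over all words finite.\<close>
  define A1 where "A1 = \<kappa>1 * A0"
  have A1: "A1 \<ge> 1" unfolding A1_def by (intro ge1 \<kappa>1 A0)
  define A2 where "A2 = 2 * D * A1"
  have A2: "A2 \<ge> 1" unfolding A2_def using D by (intro ge1 A1) auto
  define A3 where "A3 = \<kappa>1 * (\<kappa>2 * A2)"
  have A3: "A3 \<ge> 1" unfolding A3_def by (intro ge1 \<kappa>1 \<kappa>2 A2)
  define A4 where "A4 = 2 * D * A3\<^sup>2"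
  have A4: "A4 \<ge> 1" unfolding A4_def power2_eq_square using D by (intro ge1 A3) auto
  define A5 where "A5 = \<kappa>2 * A4"
  have A5: "A5 \<ge> 1" unfolding A5_def by (intro ge1 \<kappa>2 A4)
  have k2A2: "\<kappa>2 * A2 \<ge> 1" by (intro ge1 \<kappa>2 A2)
  have A05: "A0 \<le> A5"
  proof -
    have "A0 \<le> A1" unfolding A1_def using \<kappa>1 A0 mult_right_mono[of 1 \<kappa>1 A0] by simp
    also have "A1 \<le> A2" unfolding A2_def using D A1 mult_right_mono[of 1 "2 * D" A1] by simp
    also have "A2 \<le> \<kappa>2 * A2" using \<kappa>2 A2 mult_right_mono[of 1 \<kappa>2 A2] by simp
    also have "\<dots> \<le> A3" unfolding A3_def using \<kappa>1 k2A2 mult_right_mono[of 1 \<kappa>1 "\<kappa>2 * A2"] by simp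
    also have "A3 \<le> A3\<^sup>2" using A3 by (simp add: power2_eq_square)
    also have "\<dots> \<le> A4" unfolding A4_def using D A3 mult_right_mono[of 1 "2 * D" "A3\<^sup>2"] by simp
    also have "\<dots> \<le> A5" unfolding A5_def using \<kappa>2 A4 mult_right_mono[of 1 \<kappa>2 A4] by simp
    finally show ?thesis .
  qed
  obtain C1 where C1: "C1 > 0" and b1: "\<forall>(u :: real^'d \<Rightarrow> complex) H.
     rapid u \<longrightarrow> H \<ge> 0 \<longrightarrow> L2_bounded A1 H u \<longrightarrow> sup_bounded A0 (C1 * H) u"
    using L2_sup A0(1) unfolding A1_def by blast
  obtain C2 where C2: "C2 > 0" and b2: "\<forall>(u :: real^'d \<Rightarrow> complex) H.
     rapid u \<longrightarrow> H \<ge> 0 \<longrightarrow> L2_bounded A3 H u \<longrightarrow> sup_bounded (\<kappa>2 * A2) (C2 * H) u"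
    using L2_sup k2A2 unfolding A3_def by blast
  obtain C3 where C3: "C3 > 0" and b3: "\<forall>(u :: real^'d \<Rightarrow> complex) H.
     H \<ge> 0 \<longrightarrow> sup_bounded (\<kappa>2 * A2) H u \<longrightarrow> weighted_sup_bounded A2 (C3 * H) u"
    using sup_weighted A2 by blast
  obtain C4 where C4: "C4 > 0" and b4: "\<forall>(u :: real^'d \<Rightarrow> complex) H.
     H \<ge> 0 \<longrightarrow> sup_bounded A5 H u \<longrightarrow> weighted_sup_bounded A4 (C4 * H) u"
    using sup_weighted A4 unfolding A5_def by blast
  obtain \<nu> C5 where \<nu>: "\<nu> > 0" and C5: "C5 > 0" and geo: "\<forall>n. A5 ^ n * weight_seq \<omega> \<nu> n \<le> C5 * M n"
    using weight_seq_geometric[OF zero_less_one, of A5] by blast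
  define q where "q = (S_seminorm \<omega> \<nu> :: (real^'d \<Rightarrow> complex) \<Rightarrow> real)"
  have q0: "0 \<le> q u" if "u \<in> S_omega \<omega>" for u unfolding q_def by (rule S_seminorm_nonneg[OF that \<nu>])
  have q_sup: "sup_bounded A5 (C5 * q u) u" if u: "u \<in> S_omega \<omega>" for u
    unfolding sup_bounded_def
  proof (intro allI)
    fix js "is" :: "'d list" and x
    let ?n = "length js + length is"
    have "cmod (mono_deriv js is u x) \<le> q u * weight_seq \<omega> \<nu> ?n"
      unfolding q_def by (rule S_seminorm_ge[OF u \<nu>])
    also have "\<dots> \<le> q u * (C5 * M ?n / A5 ^ ?n)"
      using geo A5 q0[OF u] by (intro mult_left_mono) (auto simp: pos_le_divide_eq mult.commute)
    finally show "cmod (mono_deriv js is u x) \<le> C5 * q u * M ?n / A5 ^ ?n"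
      by (simp add: mult_ac)
  qed
  have p_sup: "p u \<le> (K * C0) * H" if u: "u \<in> S_omega \<omega>" and H: "H \<ge> 0" "sup_bounded A0 H u" for u H
  proof -
    have "S_seminorm \<omega> \<mu> u \<le> H * C0"
      by (rule S_seminorm_le[OF S_omega_smooth[OF u] sup_bounded_weight_seq[OF A0(1) H A0(3)]])
    then have "K * S_seminorm \<omega> \<mu> u \<le> K * (H * C0)" using K by (intro mult_left_mono) auto
    then show ?thesis using pK u by (force simp: mult_ac)
  qed
  define K' where "K' = max 1 (K * C0 * C5)"
  have K': "K' \<ge> 1" "K' \<ge> K * C0 * C5" by (auto simp: K'_def)
  have pq: "p u \<le> K' * q u" if u: "u \<in> S_omega \<omega>" for u
  proof -
    have H0: "0 \<le> C5 * q u" using C5 q0[OF u] by simp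
    have "p u \<le> (K * C0) * (C5 * q u)"
      by (rule p_sup[OF u H0 sup_bounded_mono[OF q_sup[OF u] A0(1) A05 H0]])
    also have "\<dots> = (K * C0 * C5) * q u" by simp
    also have "\<dots> \<le> K' * q u" using K'(2) q0[OF u] by (intro mult_right_mono)
    finally show ?thesis .
  qed
  have q_le: "q u \<le> K' * q u" if "u \<in> S_omega \<omega>" for u
    using mult_right_mono[OF K'(1) q0[OF that]] by simp
  define Kb where "Kb = (K * C0 * C1)\<^sup>2"
  define c where "c z = (geometric_weight A3 z)\<^sup>2" for z :: "('d list \<times> 'd list) \<times> (real^'d)"
  define w where "w z = C3 * C2 / geometric_weight A2 z * (1 / poly_weight (snd z))"
    for z :: "('d list \<times> 'd list) \<times> (real^'d)"
  define a where "a z = C4 * C5 / geometric_weight A4 z * (1 / poly_weight (snd z))"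
    for z :: "('d list \<times> 'd list) \<times> (real^'d)"
  define b where "b z = Kb * (geometric_weight A1 z)\<^sup>2" for z :: "('d list \<times> 'd list) \<times> (real^'d)"
  note gpos = geometric_weight_pos[OF less_le_trans[OF zero_less_one]]
  have cm: "c \<in> borel_measurable word_measure" unfolding c_def
    using geometric_weight_measurable by measurable
  have wm: "w \<in> borel_measurable word_measure" unfolding w_def
    using geometric_weight_measurable poly_weight_measurable_word by measurable
  have am: "a \<in> borel_measurable word_measure" unfolding a_def
    using geometric_weight_measurable poly_weight_measurable_word by measurable
  have bm: "b \<in> borel_measurable word_measure" unfolding b_def
    using geometric_weight_measurable by measurable
  have c0: "0 \<le> c z" for z by (simp add: c_def)
  have w0: "0 < w z" for z unfolding w_def
    by (intro mult_pos_pos divide_pos_pos C2 C3 gpos[OF A2] poly_weight_pos zero_less_one)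
  have a0: "0 \<le> a z" for z unfolding a_def
    by (intro less_imp_le mult_pos_pos divide_pos_pos C4 C5 gpos[OF A4] poly_weight_pos zero_less_one)
  have b0: "0 \<le> b z" for z by (simp add: b_def Kb_def)
  \<comment> \<open>\<open>M\<close> cancels in the three integrability conditions; only ratios of the constants remain.\<close>
  have ratio: "geometric_weight x z / geometric_weight y z = (x / y) ^ total_length (fst z)"
    for x y and z :: "('d list \<times> 'd list) \<times> (real^'d)"
    using weight_seq_pos[of 1 "total_length (fst z)"] by (simp add: geometric_weight_def power_divide)
  have ca: "integrable word_measure (\<lambda>z. c z * (a z)\<^sup>2)"
  proof (rule integrable_geometric[where K="(C4 * C5)\<^sup>2" and q="(A3 / A4)\<^sup>2"])
    show "(\<lambda>z. c z * (a z)\<^sup>2) \<in> borel_measurable word_measure" using cm am by measurable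
    fix z :: "('d list \<times> 'd list) \<times> (real^'d)"
    have "c z * (a z)\<^sup>2 = (C4 * C5)\<^sup>2 * (geometric_weight A3 z / geometric_weight A4 z)\<^sup>2 * (1 / poly_weight (snd z))\<^sup>2"
      unfolding c_def a_def by (simp add: power_mult_distrib power_divide)
    then show "\<bar>c z * (a z)\<^sup>2\<bar> \<le> (C4 * C5)\<^sup>2 * ((A3 / A4)\<^sup>2) ^ total_length (fst z) * (1 / poly_weight (snd z))\<^sup>2"
      unfolding ratio by (simp add: power_mult[symmetric] mult.commute)
  next
    have "(A3 / A4)\<^sup>2 = 1 / (2 * D) * (1 / (2 * D * A3\<^sup>2))"
      using A3 D by (simp add: A4_def power2_eq_square)
    also have "\<dots> \<le> 1 / (2 * D) * 1"
      using A4 D unfolding A4_def[symmetric] by (intro mult_left_mono) auto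
    finally show "(A3 / A4)\<^sup>2 \<le> 1 / (2 * real CARD('d))" by (simp add: D_def)
  qed simp_all
  have bw: "integrable word_measure (\<lambda>z. b z * (w z)\<^sup>2)"
  proof (rule integrable_geometric[where K="Kb * (C3 * C2)\<^sup>2" and q="(A1 / A2)\<^sup>2"])
    show "(\<lambda>z. b z * (w z)\<^sup>2) \<in> borel_measurable word_measure" using bm wm by measurable
    fix z :: "('d list \<times> 'd list) \<times> (real^'d)"
    have "b z * (w z)\<^sup>2 = Kb * (C3 * C2)\<^sup>2 * (geometric_weight A1 z / geometric_weight A2 z)\<^sup>2 * (1 / poly_weight (snd z))\<^sup>2"
      unfolding b_def w_def by (simp add: power_mult_distrib power_divide)
    then show "\<bar>b z * (w z)\<^sup>2\<bar> \<le> Kb * (C3 * C2)\<^sup>2 * ((A1 / A2)\<^sup>2) ^ total_length (fst z) * (1 / poly_weight (snd z))\<^sup>2"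
      unfolding ratio by (simp add: power_mult[symmetric] mult.commute Kb_def)
  next
    have "(A1 / A2)\<^sup>2 = 1 / (2 * D) * (1 / (2 * D))"
      using A1 by (simp add: A2_def power2_eq_square)
    also have "\<dots> \<le> 1 / (2 * D) * 1" using D by (intro mult_left_mono) auto
    finally show "(A1 / A2)\<^sup>2 \<le> 1 / (2 * real CARD('d))" by (simp add: D_def)
  qed (simp_all add: Kb_def)
  have caw: "integrable word_measure (\<lambda>z. c z * a z * w z)"
  proof (rule integrable_geometric[where K="(C4 * C5) * (C3 * C2)" and q="(A3 / A4) * (A3 / A2)"])
    show "(\<lambda>z. c z * a z * w z) \<in> borel_measurable word_measure" using cm am wm by measurable
    fix z :: "('d list \<times> 'd list) \<times> (real^'d)"
    have "c z * a z * w z = (C4 * C5) * (C3 * C2) * ((geometric_weight A3 z / geometric_weight A4 z)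
        * (geometric_weight A3 z / geometric_weight A2 z)) * (1 / poly_weight (snd z))\<^sup>2"
      unfolding c_def a_def w_def by (simp add: power2_eq_square mult_ac)
    moreover have "0 \<le> c z * a z * w z" using c0 a0 w0 by (simp add: less_imp_le)
    ultimately show "\<bar>c z * a z * w z\<bar>
        \<le> (C4 * C5) * (C3 * C2) * ((A3 / A4) * (A3 / A2)) ^ total_length (fst z) * (1 / poly_weight (snd z))\<^sup>2"
      unfolding ratio power_mult_distrib[of "A3 / A4"] by simp
  next
    have "(A3 / A4) * (A3 / A2) = 1 / (2 * D) * (1 / A2)"
      using A3 by (simp add: A4_def power2_eq_square)
    also have "\<dots> \<le> 1 / (2 * D) * 1" using D A2 by (intro mult_left_mono) auto
    finally show "(A3 / A4) * (A3 / A2) \<le> 1 / (2 * real CARD('d))" by (simp add: D_def)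
    show "0 \<le> (A3 / A4) * (A3 / A2)" using A3 A4 A2 by simp
  qed (use C2 C3 C4 C5 in simp)
  have "nuclear_linking_map fun_scale (S_omega \<omega>) (\<lambda>u. K' * q u) p"
  proof (rule nuclear_linking_map_of_kernels[where L=op_value and m=word_measure and c=c and w=w and a=a and b=b])
    show "vector_space fun_scale" by (rule vector_space_fun_scale)
    show "module.subspace fun_scale (S_omega \<omega>)" by (rule subspace_S_omega)
    show "seminorm_on fun_scale (S_omega \<omega>) (\<lambda>u. K' * q u)"
      using seminorm_on_S_seminorm[OF \<nu>, where 'a='d] K'(1)
      unfolding q_def seminorm_on_def by (simp add: distrib_left[symmetric])
    show "seminorm_on fun_scale (S_omega \<omega>) p" by (rule p)
    fix z :: "('d list \<times> 'd list) \<times> (real^'d)" and u :: "real^'d \<Rightarrow> complex"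
    assume u: "u \<in> S_omega \<omega>"
    have sm: "smooth u" by (rule S_omega_smooth[OF u])
    have r: "rapid u" by (rule S_omega_rapid[OF u])
    show "op_value z (u + v) = op_value z u + op_value z v" if v: "v \<in> S_omega \<omega>" for v
      using pderivs_linear_combination(1)[OF sm S_omega_smooth[OF v], of "snd (fst z)" 1 1]
      by (simp add: op_value_def plus_fun_def algebra_simps)
    show "op_value z (fun_scale k u) = k * op_value z u" for k
      using pderivs_linear_combination(1)[OF sm sm, of "snd (fst z)" k 0]
      by (simp add: op_value_def fun_scale_def)
    show "(\<lambda>z. op_value z u) \<in> borel_measurable word_measure" by (rule op_value_measurable[OF sm])
    have ws: "weighted_sup_bounded A4 (C4 * (C5 * q u)) u"
      using b4 q_sup[OF u] q0[OF u] C5 by simp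
    have "cmod (op_value z u) \<le> (C4 * (C5 * q u)) / geometric_weight A4 z * (1 / poly_weight (snd z))"
      by (rule weighted_sup_bounded_op_value[OF _ ws]) (use A4 in simp)
    also have "\<dots> = a z * q u" by (simp add: a_def)
    also have "\<dots> \<le> a z * (K' * q u)" by (intro mult_left_mono q_le u a0)
    finally show "cmod (op_value z u) \<le> a z * (K' * q u)" .
    define H where "H = sqrt (LINT z|word_measure. c z * (cmod (op_value z u))\<^sup>2)"
    have H0: "0 \<le> H" unfolding H_def c_def by (intro real_sqrt_ge_zero integral_nonneg_AE AE_I2) auto
    have "L2_bounded A3 H u" unfolding H_def c_def by (rule L2_bounded_form[OF u A3])
    then have "sup_bounded (\<kappa>2 * A2) (C2 * H) u" using b2 r H0 by blast
    moreover have "0 \<le> C2 * H" using C2 H0 by simp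
    ultimately have ws': "weighted_sup_bounded A2 (C3 * (C2 * H)) u" using b3 by blast
    have "cmod (op_value z u) \<le> (C3 * (C2 * H)) / geometric_weight A2 z * (1 / poly_weight (snd z))"
      by (rule weighted_sup_bounded_op_value[OF _ ws']) (use A2 in simp)
    also have "\<dots> = w z * H" by (simp add: w_def)
    finally show "cmod (op_value z u) \<le> w z * sqrt (LINT z|word_measure. c z * (cmod (op_value z u))\<^sup>2)"
      unfolding H_def .
    define I where "I = (LINT z|word_measure. (geometric_weight A1 z)\<^sup>2 * (cmod (op_value z u))\<^sup>2)"
    have I0: "0 \<le> I" unfolding I_def by (intro integral_nonneg_AE AE_I2) auto
    have "L2_bounded A1 (sqrt I) u" unfolding I_def by (rule L2_bounded_form[OF u A1])
    then have "sup_bounded A0 (C1 * sqrt I) u" using b1 r I0 real_sqrt_ge_zero by blast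
    moreover have "0 \<le> C1 * sqrt I" using C1 I0 by simp
    ultimately have "p u \<le> (K * C0) * (C1 * sqrt I)" using p_sup[OF u] by blast
    moreover have "0 \<le> p u" using p u unfolding seminorm_on_def by blast
    ultimately have "(p u)\<^sup>2 \<le> ((K * C0) * (C1 * sqrt I))\<^sup>2" by (intro power_mono)
    also have "\<dots> = Kb * I" using I0 by (simp add: Kb_def power_mult_distrib)
    also have "\<dots> = (LINT z|word_measure. b z * (cmod (op_value z u))\<^sup>2)"
      unfolding I_def b_def integral_mult_right_zero[symmetric] mult.assoc ..
    finally show "(p u)\<^sup>2 \<le> (LINT z|word_measure. b z * (cmod (op_value z u))\<^sup>2)" .
  qed (fact cm wm am bm c0 w0 a0 b0 ca bw caw)+
  then show ?thesis using \<nu> K' pq unfolding q_def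
    by (intro exI[of _ \<nu>] conjI exI[of _ K']) auto
qed

end

theorem theorem3p6:
  fixes \<omega> :: "real \<Rightarrow> real"
  assumes "weight_function \<omega>"
    and "\<exists>H>1. \<forall>t\<ge>0. 2 * \<omega> t \<le> \<omega> (H * t) + H"
  shows "nuclear_space fun_scale (S_topology \<omega> :: (real^'d::finite \<Rightarrow> complex) topology)"
proof -
  interpret doubling_weight \<omega> by (rule doubling_weight.intro[OF assms])
  interpret S: seminormed_space fun_scale "S_omega \<omega> :: (real^'d \<Rightarrow> complex) set" "{S_seminorm \<omega> \<mu> |\<mu>. 0 < \<mu>}"
    by (rule seminormed_space_S_omega)
  show ?thesis
    unfolding S_topology_def
  proof (rule S.nuclear_space_T)
    fix p q :: "(real^'d \<Rightarrow> complex) \<Rightarrow> real" and K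
    assume p: "seminorm_on fun_scale (S_omega \<omega>) p" and q: "q \<in> {S_seminorm \<omega> \<mu> |\<mu>. 0 < \<mu>}"
      and K: "K > 0" and le: "\<forall>u\<in>S_omega \<omega>. p u \<le> K * q u"
    obtain \<mu> where \<mu>: "\<mu> > 0" "q = S_seminorm \<omega> \<mu>" using q by blast
    obtain \<nu> K' where "\<nu> > 0" "K' > 0" "\<forall>u\<in>S_omega \<omega>. p u \<le> K' * S_seminorm \<omega> \<nu> u"
      "nuclear_linking_map fun_scale (S_omega \<omega>) (\<lambda>u. K' * S_seminorm \<omega> \<nu> u) p"
      using S_omega_linking_maps_nuclear[OF p \<mu>(1) K le[unfolded \<mu>(2)]] by blast
    then show "\<exists>r\<in>{S_seminorm \<omega> \<mu> |\<mu>. 0 < \<mu>}. \<exists>K'>0. (\<forall>u\<in>S_omega \<omega>. p u \<le> K' * r u) \<and>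
        nuclear_linking_map fun_scale (S_omega \<omega>) (\<lambda>u. K' * r u) p" by blast
  qed
qed

end
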